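(* Let $\Lambda:\mathcal D\to\mathbb R^m$ be an admissible Lagrange multiplier function, let $\Delta t>0$, let $\gamma$ be a positive real number (or, more generally, a symmetric positive definite $d\times d$ matrix), and let $\Psi_{\Delta t}^{\rm rev}:T^*\mathcal M\to T^*\mathcal M$ be the associated RATTLE map with momentum reversal and reverse projection check (see context). Let $(G^n)_{n\ge0}$ and $(G^{n+1/2})_{n\ge0}$ be independent sequences of independent centered Gaussian vectors in $\mathbb R^d$ with identity covariance, and $(U^n)_{n\ge0}$ an independent sequence of independent uniform random variables on $(0,1)$. Consider the Markov chain $(q^n,p^n)_{n\ge0}$ on $T^*\mathcal M$ (constrained Generalized Hybrid Monte Carlo) defined as follows. Given $(q^n,p^n)\in T^*\mathcal M$: (i) let $p^{n+1/4}$ be the solution of $$p^{n+1/4}=p^n-\tfrac{\Delta t}{4}\gamma M^{-1}(p^n+p^{n+1/4})+\sqrt{\gamma\Delta t}\,G^n+\nabla\xi(q^n)\lambda^{n+1/4},\qquad[\nabla\xi(q^n)]^TM^{-1}p^{n+1/4}=0,$$ where $\lambda^{n+1/4}\in\mathbb R^m$ is the Lagrange multiplier enforcing the constraint; (ii) set $(\tilde q^{n+1},\tilde p^{n+3/4})=\Psi_{\Delta t}^{\rm rev}(q^n,p^{n+1/4})$; (iii) if $U^n\le\exp\big(-H(\tilde q^{n+1},\tilde p^{n+3/4})+H(q^n,p^{n+1/4})\big)$, set $(q^{n+1},p^{n+3/4})=(\tilde q^{n+1},\tilde p^{n+3/4})$; otherwise set $(q^{n+1},p^{n+3/4})=(q^n,p^{n+1/4})$;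 (iv) set $\tilde p^{n+1}=-p^{n+3/4}$; (v) let $p^{n+1}$ be the solution of $$p^{n+1}=\tilde p^{n+1}-\tfrac{\Delta t}{4}\gamma M^{-1}(\tilde p^{n+1}+p^{n+1})+\sqrt{\gamma\Delta t}\,G^{n+1/2}+\nabla\xi(q^{n+1})\lambda^{n+1},\qquad[\nabla\xi(q^{n+1})]^TM^{-1}p^{n+1}=0,$$ where $\lambda^{n+1}\in\mathbb R^m$ is the Lagrange multiplier enforcing the constraint. Then this Markov chain admits $\mu$ as an invariant measure.
   Context: **Geometric setting.** Let $1\le m<d$ be integers, $M\in\mathbb R^{d\times d}$ a fixed symmetric positive definite matrix, and $\xi=(\xi_1,\dots,\xi_m):\mathbb R^d\to\mathbb R^m$ a smooth function. $\nabla\xi(q)\in\mathbb R^{d\times m}$ is the matrix whose columns are the gradients $\nabla\xi_i(q)$. Set $\mathcal M=\{q\in\mathbb R^d:\xi(q)=0\}$, and assume that $G_M(q)=[\nabla\xi(q)]^TM^{-1}\nabla\xi(q)\in\mathbb R^{m\times m}$ is invertible for all $q$ in a neighborhood of $\mathcal M$ (so $\mathcal M$ is a smooth submanifold of codimension $m$). Let $V:\mathbb R^d\to\mathbb R$ be smooth. Put $T_q^*\mathcal M=\{p\in\mathbb R^d:[\nabla\xi(q)]^TM^{-1}p=0\}$ and $T^*\mathcal M=\{(q,p)\in\mathbb R^d\times\mathbb R^d:\xi(q)=0,\ [\nabla\xi(q)]^TM^{-1}p=0\}$. The phase-space Liouville measure on $T^*\mathcal M$ is $\sigma_{T^*\mathcal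 M}(dq\,dp)=\sigma^M_{\mathcal M}(dq)\,\sigma^{M^{-1}}_{T_q^*\mathcal M}(dp)$, where $\sigma^M_{\mathcal M}$ is the Riemannian measure on $\mathcal M$ induced by the scalar product $q^TM\tilde q$ on $\mathbb R^d$ and $\sigma^{M^{-1}}_{T_q^*\mathcal M}$ is the Lebesgue measure on $T_q^*\mathcal M$ induced by the scalar product $p^TM^{-1}\tilde p$. **Target measure.** $H(q,p)=V(q)+\frac12p^TM^{-1}p$. The constant $Z_\nu=\int_{\mathcal M}e^{-V}d\sigma^M_{\mathcal M}$ is assumed finite (and positive), and $\mu(dq\,dp)=Z_\mu^{-1}e^{-H(q,p)}\sigma_{T^*\mathcal M}(dq\,dp)$ with $Z_\mu=\int_{T^*\mathcal M}e^{-H}d\sigma_{T^*\mathcal M}$. **Admissible Lagrange multiplier function.** A $C^1$ function $\Lambda:\mathcal D\to\mathbb R^m$ defined on an open set $\mathcal D$ of $\mathcal M\times\mathbb R^d$ such that for all $(q,\tilde q)\in\mathcal D$: (projection) $\tilde q+M^{-1}\nabla\xi(q)\Lambda(q,\tilde q)\in\mathcal M$; and (non-tangential projection) the $m\times m$ matrix $\left[\nabla\xi\big(\tilde q+M^{-1}\nabla\xi(q)\Lambda(q,\tilde q)\big)\right]^TM^{-1}\nabla\xi(q)$ is invertible. **RATTLE map.** Given $\Lambda$ and a timestep $\Delta t>0$, let $$A=\Big\{(q,p)\in T^*\mathcal M:\ \big(q,\,q+\Delta t\,M^{-1}[p-\tfrac{\Delta t}{2}\nabla V(q)]\big)\in\mathcal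 D\Big\},$$ an open subset of $T^*\mathcal M$. For $(q,p)\in A$, set $\Psi_{\Delta t}(q,p)=(q^1,-p^1)\in T^*\mathcal M$, where $\lambda^{1/2}=\frac1{\Delta t}\Lambda\big(q,q+\Delta tM^{-1}[p-\frac{\Delta t}2\nabla V(q)]\big)$, $p^{1/2}=p-\frac{\Delta t}2\nabla V(q)+\nabla\xi(q)\lambda^{1/2}$, $q^1=q+\Delta t\,M^{-1}p^{1/2}$, $p^1=p^{1/2}-\frac{\Delta t}2\nabla V(q^1)+\nabla\xi(q^1)\lambda^1$, with $\lambda^1\in\mathbb R^m$ the unique vector such that $[\nabla\xi(q^1)]^TM^{-1}p^1=0$. **Map with reverse projection check.** Let $$B=\big\{(q,p)\in A:\ \Psi_{\Delta t}(q,p)\in A\ \text{ and }\ (\Psi_{\Delta t}\circ\Psi_{\Delta t})(q,p)=(q,p)\big\},$$ and for $(q,p)\in T^*\mathcal M$ let $\Psi_{\Delta t}^{\rm rev}(q,p)=\Psi_{\Delta t}(q,p)$ if $(q,p)\in B$ and $\Psi_{\Delta t}^{\rm rev}(q,p)=(q,p)$ if $(q,p)\notin B$. The linear systems in steps (i) and (v) have unique solutions, because $[\nabla\xi(q)]^TM^{-1}(\mathrm{Id}+\frac{\Delta t}4\gamma M^{-1})^{-1}\nabla\xi(q)$ is invertible for $q\in\mathcal M$. When $\gamma$ is a matrix, $\sqrt{\gamma\Delta t}$ denotes the symmetric positive definite square root. *)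

theory Defs
  imports "HOL-Probability.Probability"
begin

text \<open>Functions of class \<open>C\<^sup>n\<close> on an open set: all iterated directional derivatives of order at
  most \<open>n\<close> exist and are continuous.\<close>

primrec Ck_on :: "nat \<Rightarrow> 'a::real_normed_vector set \<Rightarrow> ('a \<Rightarrow> 'b::real_normed_vector) \<Rightarrow> bool" where
  "Ck_on 0 S f \<longleftrightarrow> continuous_on S f"
| "Ck_on (Suc n) S f \<longleftrightarrow>
     (\<forall>x\<in>S. f differentiable (at x)) \<and>
     (\<forall>v. Ck_on n S (\<lambda>x. frechet_derivative f (at x) v))"

definition smooth_on :: "'a::real_normed_vector set \<Rightarrow> ('a \<Rightarrow> 'b::real_normed_vector) \<Rightarrow> bool" where
  "smooth_on S f \<longleftrightarrow> (\<forall>n. Ck_on n S f)"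

text \<open>Class \<open>C\<^sup>1\<close> on a subset \<open>D\<close> that need not be open in the ambient space (below: an open subset
  of a submanifold): near each point of \<open>D\<close> there is a \<open>C\<^sup>1\<close> extension to an ambient open set.\<close>

definition C1_on_subset :: "'a::real_normed_vector set \<Rightarrow> ('a \<Rightarrow> 'b::real_normed_vector) \<Rightarrow> bool" where
  "C1_on_subset D f \<longleftrightarrow>
     (\<forall>x\<in>D. \<exists>W F. open W \<and> x \<in> W \<and> Ck_on 1 W F \<and> (\<forall>y\<in>W \<inter> D. F y = f y))"

definition grad :: "(real^'d \<Rightarrow> real) \<Rightarrow> real^'d \<Rightarrow> real^'d" where
  "grad f x = (\<chi> i. frechet_derivative f (at x) (axis i 1))"

definition nabla :: "(real^'d \<Rightarrow> real^'m) \<Rightarrow> real^'d \<Rightarrow> real^'m^'d" where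
  "nabla \<xi> q = (\<chi> i j. grad (\<lambda>x. \<xi> x $ j) q $ i)"

definition spd :: "real^'d^'d \<Rightarrow> bool" where
  "spd A \<longleftrightarrow> transpose A = A \<and> (\<forall>x. x \<noteq> 0 \<longrightarrow> x \<bullet> (A *v x) > 0)"

definition spd_sqrt :: "real^'d^'d \<Rightarrow> real^'d^'d" where
  "spd_sqrt A = (THE S. spd S \<and> S ** S = A)"

definition level_set :: "(real^'d \<Rightarrow> real^'m) \<Rightarrow> (real^'d) set" where
  "level_set \<xi> = {q. \<xi> q = 0}"

definition gram :: "real^'d^'d \<Rightarrow> (real^'d \<Rightarrow> real^'m) \<Rightarrow> real^'d \<Rightarrow> real^'m^'m" where
  "gram M \<xi> q = transpose (nabla \<xi> q) ** matrix_inv M ** nabla \<xi> q"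

definition cotangent_space :: "real^'d^'d \<Rightarrow> (real^'d \<Rightarrow> real^'m) \<Rightarrow> real^'d \<Rightarrow> (real^'d) set" where
  "cotangent_space M \<xi> q = {p. transpose (nabla \<xi> q) *v (matrix_inv M *v p) = 0}"

definition cotangent_bundle ::
    "real^'d^'d \<Rightarrow> (real^'d \<Rightarrow> real^'m) \<Rightarrow> ((real^'d) \<times> (real^'d)) set" where
  "cotangent_bundle M \<xi> = {(q, p). q \<in> level_set \<xi> \<and> p \<in> cotangent_space M \<xi> q}"

abbreviation phase_space ::
    "real^'d^'d \<Rightarrow> (real^'d \<Rightarrow> real^'m) \<Rightarrow> ((real^'d) \<times> (real^'d)) measure" where
  "phase_space M \<xi> \<equiv> restrict_space borel (cotangent_bundle M \<xi>)"

text \<open>Smooth local parametrization of a submanifold \<open>S\<close> of dimension \<open>CARD('k)\<close>; its image is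
  relatively open in \<open>S\<close>, so that \<open>\<phi>\<close> is the inverse of a chart.\<close>

definition local_parametrization ::
    "(real^'d) set \<Rightarrow> (real^'k) set \<Rightarrow> (real^'k \<Rightarrow> real^'d) \<Rightarrow> bool" where
  "local_parametrization S U \<phi> \<longleftrightarrow>
     open U \<and> smooth_on U \<phi> \<and> (\<forall>x\<in>U. inj (frechet_derivative \<phi> (at x))) \<and>
     openin (top_of_set S) (\<phi> ` U) \<and> (\<exists>\<psi>. homeomorphism U (\<phi> ` U) \<phi> \<psi>)"

text \<open>Volume element \<open>sqrt (det g)\<close> of the metric induced by the scalar product with matrix \<open>Q\<close>.\<close>

definition volume_density ::
    "real^'d^'d \<Rightarrow> (real^'k \<Rightarrow> real^'d) \<Rightarrow> real^'k \<Rightarrow> real" where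
  "volume_density Q \<phi> x =
     (let J = jacobian \<phi> (at x) in sqrt (det (transpose J ** Q ** J)))"

text \<open>The Riemannian measure on \<open>S\<close> is the unique Borel measure on \<open>S\<close> given by the volume element
  in every chart. The type argument carries the dimension of \<open>S\<close>.\<close>

definition riemannian_measure ::
    "'k::finite itself \<Rightarrow> real^'d^'d \<Rightarrow> (real^'d) set \<Rightarrow> (real^'d) measure" where
  "riemannian_measure k Q S = (THE \<sigma>. sets \<sigma> = sets (restrict_space borel S) \<and>
     (\<forall>(U :: (real^'k) set) \<phi> E. local_parametrization S U \<phi> \<and> E \<in> sets borel \<and> E \<subseteq> U \<longrightarrow>
        emeasure \<sigma> (\<phi> ` E) = (\<integral>\<^sup>+x\<in>E. ennreal (volume_density Q \<phi> x) \<partial>lborel)))"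

text \<open>Lebesgue measure on a linear subspace \<open>E\<close> of dimension \<open>CARD('k)\<close> with the scalar product with
  matrix \<open>Q\<close>: the columns of \<open>B\<close> form an orthonormal basis of \<open>E\<close>, whose choice is immaterial.\<close>

definition subspace_lebesgue ::
    "'k::finite itself \<Rightarrow> real^'d^'d \<Rightarrow> (real^'d) set \<Rightarrow> (real^'d) measure" where
  "subspace_lebesgue k Q E =
     (let B = (SOME B :: real^'k^'d. range ((*v) B) = E \<and> transpose B ** Q ** B = mat 1)
      in distr lborel (restrict_space borel E) ((*v) B))"

definition liouville ::
    "'k::finite itself \<Rightarrow> real^'d^'d \<Rightarrow> (real^'d \<Rightarrow> real^'m) \<Rightarrow> ((real^'d) \<times> (real^'d)) measure" where
  "liouville k M \<xi> = measure_of (cotangent_bundle M \<xi>) (sets (phase_space M \<xi>))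
     (\<lambda>A. \<integral>\<^sup>+q. emeasure (subspace_lebesgue k (matrix_inv M) (cotangent_space M \<xi> q)) {p. (q, p) \<in> A}
           \<partial>riemannian_measure k M (level_set \<xi>))"

definition hamiltonian ::
    "real^'d^'d \<Rightarrow> (real^'d \<Rightarrow> real) \<Rightarrow> (real^'d) \<times> (real^'d) \<Rightarrow> real" where
  "hamiltonian M V = (\<lambda>(q, p). V q + 1/2 * (p \<bullet> (matrix_inv M *v p)))"

definition Z_nu ::
    "'k::finite itself \<Rightarrow> real^'d^'d \<Rightarrow> (real^'d \<Rightarrow> real^'m) \<Rightarrow> (real^'d \<Rightarrow> real) \<Rightarrow> ennreal" where
  "Z_nu k M \<xi> V = (\<integral>\<^sup>+q. ennreal (exp (- V q)) \<partial>riemannian_measure k M (level_set \<xi>))"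

definition Z_mu ::
    "'k::finite itself \<Rightarrow> real^'d^'d \<Rightarrow> (real^'d \<Rightarrow> real^'m) \<Rightarrow> (real^'d \<Rightarrow> real) \<Rightarrow> ennreal" where
  "Z_mu k M \<xi> V = (\<integral>\<^sup>+x. ennreal (exp (- hamiltonian M V x)) \<partial>liouville k M \<xi>)"

definition target_measure ::
    "'k::finite itself \<Rightarrow> real^'d^'d \<Rightarrow> (real^'d \<Rightarrow> real^'m) \<Rightarrow> (real^'d \<Rightarrow> real)
      \<Rightarrow> ((real^'d) \<times> (real^'d)) measure" where
  "target_measure k M \<xi> V =
     density (liouville k M \<xi>) (\<lambda>x. ennreal (exp (- hamiltonian M V x)) / Z_mu k M \<xi> V)"

definition admissible ::
    "real^'d^'d \<Rightarrow> (real^'d \<Rightarrow> real^'m) \<Rightarrow> ((real^'d) \<times> (real^'d)) set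
      \<Rightarrow> ((real^'d) \<times> (real^'d) \<Rightarrow> real^'m) \<Rightarrow> bool" where
  "admissible M \<xi> D \<Lambda> \<longleftrightarrow>
     openin (top_of_set (level_set \<xi> \<times> UNIV)) D \<and> C1_on_subset D \<Lambda> \<and>
     (\<forall>(q, q')\<in>D.
        let q1 = q' + matrix_inv M *v (nabla \<xi> q *v \<Lambda> (q, q')) in
        q1 \<in> level_set \<xi> \<and> invertible (transpose (nabla \<xi> q1) ** matrix_inv M ** nabla \<xi> q))"

definition unconstrained_position ::
    "real^'d^'d \<Rightarrow> (real^'d \<Rightarrow> real) \<Rightarrow> real \<Rightarrow> (real^'d) \<times> (real^'d) \<Rightarrow> real^'d" where
  "unconstrained_position M V dt = (\<lambda>(q, p). q + dt *\<^sub>R (matrix_inv M *v (p - (dt/2) *\<^sub>R grad V q)))"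

definition rattle_domain ::
    "real^'d^'d \<Rightarrow> (real^'d \<Rightarrow> real^'m) \<Rightarrow> (real^'d \<Rightarrow> real) \<Rightarrow> ((real^'d) \<times> (real^'d)) set \<Rightarrow> real
      \<Rightarrow> ((real^'d) \<times> (real^'d)) set" where
  "rattle_domain M \<xi> V D dt =
     {(q, p) \<in> cotangent_bundle M \<xi>. (q, unconstrained_position M V dt (q, p)) \<in> D}"

definition rattle ::
    "real^'d^'d \<Rightarrow> (real^'d \<Rightarrow> real^'m) \<Rightarrow> (real^'d \<Rightarrow> real)
      \<Rightarrow> ((real^'d) \<times> (real^'d) \<Rightarrow> real^'m) \<Rightarrow> real \<Rightarrow> (real^'d) \<times> (real^'d) \<Rightarrow> (real^'d) \<times> (real^'d)" where
  "rattle M \<xi> V \<Lambda> dt = (\<lambda>(q, p).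
     let l_half = (1/dt) *\<^sub>R \<Lambda> (q, unconstrained_position M V dt (q, p));
         p_half = p - (dt/2) *\<^sub>R grad V q + nabla \<xi> q *v l_half;
         q1 = q + dt *\<^sub>R (matrix_inv M *v p_half);
         p1 = (\<lambda>l. p_half - (dt/2) *\<^sub>R grad V q1 + nabla \<xi> q1 *v l);
         l1 = (THE l. transpose (nabla \<xi> q1) *v (matrix_inv M *v p1 l) = 0)
     in (q1, - p1 l1))"

definition reversible_domain ::
    "real^'d^'d \<Rightarrow> (real^'d \<Rightarrow> real^'m) \<Rightarrow> (real^'d \<Rightarrow> real) \<Rightarrow> ((real^'d) \<times> (real^'d)) set
      \<Rightarrow> ((real^'d) \<times> (real^'d) \<Rightarrow> real^'m) \<Rightarrow> real \<Rightarrow> ((real^'d) \<times> (real^'d)) set" where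
  "reversible_domain M \<xi> V D \<Lambda> dt =
     {x \<in> rattle_domain M \<xi> V D dt.
        rattle M \<xi> V \<Lambda> dt x \<in> rattle_domain M \<xi> V D dt \<and>
        rattle M \<xi> V \<Lambda> dt (rattle M \<xi> V \<Lambda> dt x) = x}"

definition rattle_rev ::
    "real^'d^'d \<Rightarrow> (real^'d \<Rightarrow> real^'m) \<Rightarrow> (real^'d \<Rightarrow> real) \<Rightarrow> ((real^'d) \<times> (real^'d)) set
      \<Rightarrow> ((real^'d) \<times> (real^'d) \<Rightarrow> real^'m) \<Rightarrow> real \<Rightarrow> (real^'d) \<times> (real^'d) \<Rightarrow> (real^'d) \<times> (real^'d)" where
  "rattle_rev M \<xi> V D \<Lambda> dt x =
     (if x \<in> reversible_domain M \<xi> V D \<Lambda> dt then rattle M \<xi> V \<Lambda> dt x else x)"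

definition momentum_update ::
    "real^'d^'d \<Rightarrow> (real^'d \<Rightarrow> real^'m) \<Rightarrow> real^'d^'d \<Rightarrow> real
      \<Rightarrow> real^'d \<Rightarrow> real^'d \<Rightarrow> real^'d \<Rightarrow> real^'d" where
  "momentum_update M \<xi> \<gamma> dt q p g = (THE p'.
     (\<exists>l. p' = p - (dt/4) *\<^sub>R (\<gamma> *v (matrix_inv M *v (p + p')))
             + spd_sqrt (dt *\<^sub>R \<gamma>) *v g + nabla \<xi> q *v l) \<and>
     transpose (nabla \<xi> q) *v (matrix_inv M *v p') = 0)"

definition ghmc_step ::
    "real^'d^'d \<Rightarrow> (real^'d \<Rightarrow> real^'m) \<Rightarrow> (real^'d \<Rightarrow> real) \<Rightarrow> ((real^'d) \<times> (real^'d)) set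
      \<Rightarrow> ((real^'d) \<times> (real^'d) \<Rightarrow> real^'m) \<Rightarrow> real \<Rightarrow> real^'d^'d
      \<Rightarrow> real^'d \<Rightarrow> real \<Rightarrow> real^'d \<Rightarrow> (real^'d) \<times> (real^'d) \<Rightarrow> (real^'d) \<times> (real^'d)" where
  "ghmc_step M \<xi> V D \<Lambda> dt \<gamma> g u g_half = (\<lambda>(q, p).
     let x = (q, momentum_update M \<xi> \<gamma> dt q p g);
         y = rattle_rev M \<xi> V D \<Lambda> dt x;
         (q1, p34) = (if u \<le> exp (- hamiltonian M V y + hamiltonian M V x) then y else x)
     in (q1, momentum_update M \<xi> \<gamma> dt q1 (- p34) g_half))"

definition std_gaussian :: "(real^'d) measure" where
  "std_gaussian = density lborel (\<lambda>x. ennreal (\<Prod>i\<in>UNIV. std_normal_density (x $ i)))"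

definition events_of :: "'w measure \<Rightarrow> 'b measure \<Rightarrow> ('w \<Rightarrow> 'b) \<Rightarrow> 'w set set" where
  "events_of \<Omega> N X = {X -` A \<inter> space \<Omega> | A. A \<in> sets N}"

datatype noise_source = Initial | Gauss nat | Gauss_half nat | Uniform nat

definition ghmc_inputs ::
    "'w measure \<Rightarrow> 's measure \<Rightarrow> ('w \<Rightarrow> 's) \<Rightarrow> (nat \<Rightarrow> 'w \<Rightarrow> real^'d) \<Rightarrow> (nat \<Rightarrow> 'w \<Rightarrow> real^'d)
      \<Rightarrow> (nat \<Rightarrow> 'w \<Rightarrow> real) \<Rightarrow> bool" where
  "ghmc_inputs \<Omega> N X0 G G_half U \<longleftrightarrow>
     prob_space \<Omega> \<and> X0 \<in> \<Omega> \<rightarrow>\<^sub>M N \<and>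
     (\<forall>n. G n \<in> \<Omega> \<rightarrow>\<^sub>M borel \<and> distr \<Omega> borel (G n) = std_gaussian) \<and>
     (\<forall>n. G_half n \<in> \<Omega> \<rightarrow>\<^sub>M borel \<and> distr \<Omega> borel (G_half n) = std_gaussian) \<and>
     (\<forall>n. U n \<in> \<Omega> \<rightarrow>\<^sub>M borel \<and> distr \<Omega> borel (U n) = uniform_measure lborel {0<..<1}) \<and>
     prob_space.indep_sets \<Omega>
       (\<lambda>s. case s of Initial \<Rightarrow> events_of \<Omega> N X0
                    | Gauss n \<Rightarrow> events_of \<Omega> borel (G n)
                    | Gauss_half n \<Rightarrow> events_of \<Omega> borel (G_half n)
                    | Uniform n \<Rightarrow> events_of \<Omega> borel (U n)) UNIV"

definition invariant_probability :: "'s measure \<Rightarrow> ('s \<Rightarrow> 's measure) \<Rightarrow> 's measure \<Rightarrow> bool" where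
  "invariant_probability N K \<mu> \<longleftrightarrow>
     K \<in> N \<rightarrow>\<^sub>M prob_algebra N \<and> \<mu> \<in> space (prob_algebra N) \<and> \<mu> \<bind> K = \<mu>"

end

theory Submission
  imports Defs
begin

text \<open>
  One step of the chain is a momentum update, a Metropolis step whose proposal is the RATTLE map, and, after
  reversal of the momentum, another momentum update. Each of these random maps preserves the measure
  \<open>\<mu> \<propto> e\<^sup>-\<^sup>H d\<sigma>\<close> on the cotangent bundle, and each uses fresh noise, so the whole step preserves it
  (\<open>step_invariant\<close>).

  \<^bold>\<open>Momentum updates.\<close> For a fixed position \<open>q\<close> the momentum is a standard Gaussian vector in an orthonormal
  frame of the cotangent space. The update \<open>p \<mapsto> p'\<close> is a midpoint rule in which the noise \<open>g\<close> and the friction are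
  balanced. If the noise is updated too, to \<open>g' = g - 1/2 noise\<^sup>T M\<^sup>-\<^sup>1 (p + p')\<close>, then \<open>p\<^sup>T M\<^sup>-\<^sup>1 p + |g|\<^sup>2\<close> is
  conserved (\<open>momentum_update_energy\<close>). Hence \<open>(p, g) \<mapsto> (p', g')\<close> is a linear isometry, and as these preserve the
  standard Gaussian measure, \<open>p'\<close> has the law of \<open>p\<close> (\<open>fiber_invariance\<close>).

  \<^bold>\<open>Metropolis step.\<close> The RATTLE map with reverse projection check, \<open>\<Phi>\<close>, is an involution. Once it is known to
  preserve the Liouville measure (\<open>distr_\<Phi>\<close>), the usual argument applies (\<open>mh_step_invariant\<close>). The preservation
  can be seen on pairs of positions. If RATTLE moves \<open>(q, p)\<close> to \<open>(q1, p1)\<close>, momentum reversal included, then the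
  two positions determine both momenta: there is a map \<open>transition\<close>, given by a symmetric generating function,
  with \<open>(q, p) = transition q q1\<close> and \<open>(q1, p1) = transition q1 q\<close> (\<open>rattle_transition\<close>). So in terms of the pair
  \<open>(q, q1)\<close> the map \<open>\<Phi>\<close> is the exchange of the two entries. For fixed \<open>q\<close> the coordinates of the momentum are
  affine in \<open>q1\<close>, and an area formula on the manifold (\<open>area_formula\<close>) expresses the Liouville measure
  as \<open>w(q, q1) d\<sigma>(q) d\<sigma>(q1)\<close> with an explicit symmetric density \<open>w\<close> (\<open>fiber_area\<close>, \<open>link_density_sym\<close>). It is
  therefore invariant under the exchange (\<open>emeasure_liouville_image\<close>).

  \<^bold>\<open>Foundations.\<close> The Riemannian measure is defined by its values on parametrized sets. That it exists is shown
  by gluing a countable atlas, and that it is unique needs charts that are smooth, which come from the inverse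
  function theorem (\<open>level_set_chart\<close>). The charts are chosen with linear inverses. The Liouville
  measure is then a push-forward of a product measure under a Borel frame of the cotangent spaces
  (\<open>liouville_eq_distr\<close>). The square root of \<open>\<gamma> dt\<close> comes from the spectral theorem (\<open>spd_square_root_ex1\<close>).
\<close>

section \<open>Change of variables in Euclidean spaces\<close>

text \<open>The change of variables theorem concerns \<open>real^'n\<close> with a well-ordered index type. A well-ordered index
  type of size \<open>DIM('a)\<close> is attached to every Euclidean space \<open>'a\<close>, and the theorem is transported along
  coordinates to \<open>real^'k\<close> with arbitrary finite \<open>'k\<close>; for the product \<open>real^'k \<times> real^'d\<close>, the invariance of
  Lebesgue measure under linear isometries is obtained in the same way.\<close>

typedef (overloaded) ('a::euclidean_space) coord = "{..<DIM('a)}"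
  by (rule exI[of _ 0]) simp

instantiation coord :: (euclidean_space) linorder
begin
definition less_eq_coord :: "'a coord \<Rightarrow> 'a coord \<Rightarrow> bool"
  where "less_eq_coord i j \<longleftrightarrow> Rep_coord i \<le> Rep_coord j"
definition less_coord :: "'a coord \<Rightarrow> 'a coord \<Rightarrow> bool"
  where "less_coord i j \<longleftrightarrow> Rep_coord i < Rep_coord j"
instance
  by intro_classes (auto simp: less_eq_coord_def less_coord_def Rep_coord_inject)
end

lemma UNIV_coord: "(UNIV :: 'a::euclidean_space coord set) = Abs_coord ` {..<DIM('a)}"
  using type_definition.univ[OF type_definition_coord] by blast

instance coord :: (euclidean_space) finite
  by intro_classes (simp add: UNIV_coord)

instance coord :: (euclidean_space) wellorder
proof
  fix P :: "'a coord \<Rightarrow> bool" and a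
  assume *: "\<And>x. (\<And>y. y < x \<Longrightarrow> P y) \<Longrightarrow> P x"
  show "P a"
    by (induction a rule: measure_induct_rule[of Rep_coord]) (rule *, simp add: less_coord_def)
qed

lemma card_coord: "CARD('a::euclidean_space coord) = DIM('a)"
proof -
  have "inj_on (Abs_coord :: nat \<Rightarrow> 'a coord) {..<DIM('a)}"
    by (intro inj_onI) (simp add: Abs_coord_inject)
  then show ?thesis
    by (simp add: UNIV_coord card_image)
qed

definition coord_basis :: "'a::euclidean_space coord \<Rightarrow> 'a"
  where "coord_basis = (SOME b. bij_betw b UNIV Basis)"

lemma bij_coord_basis: "bij_betw coord_basis UNIV (Basis :: 'a::euclidean_space set)"
proof -
  have "\<exists>b :: 'a coord \<Rightarrow> 'a. bij_betw b UNIV Basis"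
    by (rule finite_same_card_bij) (auto simp: card_coord)
  then show ?thesis
    unfolding coord_basis_def by (rule someI_ex)
qed

definition coords :: "'a::euclidean_space \<Rightarrow> real^'a coord"
  where "coords x = (\<chi> i. x \<bullet> coord_basis i)"

definition uncoords :: "real^'a coord \<Rightarrow> 'a::euclidean_space"
  where "uncoords y = (\<Sum>i\<in>UNIV. y $ i *\<^sub>R coord_basis i)"

lemma sum_coord_basis: "(\<Sum>i\<in>UNIV. f (coord_basis i)) = (\<Sum>b\<in>(Basis :: 'a::euclidean_space set). f b)"
  by (rule sum.reindex_bij_betw[OF bij_coord_basis])

lemma coord_basis_in_Basis [simp]: "coord_basis i \<in> Basis"
  using bij_coord_basis by (auto simp: bij_betw_def)

lemma coord_basis_eq_iff [simp]: "coord_basis i = coord_basis j \<longleftrightarrow> i = j"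
  using bij_coord_basis by (auto simp: bij_betw_def inj_on_def)

lemma uncoords_coords [simp]: "uncoords (coords x) = x"
  unfolding uncoords_def coords_def
  by (simp add: sum_coord_basis[of "\<lambda>b. (x \<bullet> b) *\<^sub>R b"] euclidean_representation)

lemma coords_uncoords [simp]: "coords (uncoords y) = y"
proof (rule vec_eq_iff[THEN iffD2], rule allI)
  fix j
  have "coords (uncoords y) $ j = (\<Sum>i\<in>UNIV. if i = j then y $ i else 0)"
    unfolding coords_def uncoords_def
    by (simp add: inner_sum_left inner_Basis if_distrib cong: if_cong)
  then show "coords (uncoords y) $ j = y $ j"
    by simp
qed

lemma coords_eq_iff [simp]: "coords x = coords y \<longleftrightarrow> x = y"
  by (metis uncoords_coords)

lemma linear_coords: "linear coords"
  by (intro linearI) (auto simp: coords_def vec_eq_iff inner_add_left)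

lemma linear_uncoords: "linear uncoords"
  by (intro linearI) (auto simp: uncoords_def sum.distrib scaleR_add_left scaleR_sum_right)

lemma bounded_linear_coords: "bounded_linear coords"
  and bounded_linear_uncoords: "bounded_linear uncoords"
  using linear_coords linear_uncoords linear_conv_bounded_linear by auto

lemma continuous_on_coords [continuous_intros]: "continuous_on S f \<Longrightarrow> continuous_on S (\<lambda>x. coords (f x))"
  and continuous_on_uncoords [continuous_intros]: "continuous_on S g \<Longrightarrow> continuous_on S (\<lambda>x. uncoords (g x))"
  by (auto intro: bounded_linear.continuous_on bounded_linear_coords bounded_linear_uncoords)

lemma measurable_coords [measurable]: "coords \<in> borel_measurable borel"
  and measurable_uncoords [measurable]: "uncoords \<in> borel_measurable borel"
  by (auto intro!: borel_measurable_continuous_onI continuous_intros)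

lemma inner_coords: "coords x \<bullet> coords y = x \<bullet> y"
  unfolding inner_vec_def coords_def
  by (simp add: sum_coord_basis[of "\<lambda>b. (x \<bullet> b) * (y \<bullet> b)"] euclidean_inner[of x y])

lemma vimage_coords: "coords -` A = uncoords ` A" "uncoords -` B = coords ` B"
  by (auto simp: image_iff) (metis uncoords_coords coords_uncoords)+

lemma Basis_vec_axis: "(Basis :: (real^'n) set) = range (\<lambda>i. axis i 1)"
  by (auto simp: Basis_vec_def)

lemma prod_Basis_vec: "(\<Prod>b\<in>(Basis :: (real^'n) set). f b) = (\<Prod>i\<in>UNIV. f (axis i 1))"
  unfolding Basis_vec_axis by (subst prod.reindex) (auto simp: inj_on_def axis_eq_axis)

lemma distr_coords: "distr lborel borel coords = (lborel :: (real^'a::euclidean_space coord) measure)"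
proof (rule lborel_eqI[symmetric])
  fix l u :: "real^'a coord"
  assume "\<And>b. b \<in> Basis \<Longrightarrow> l \<bullet> b \<le> u \<bullet> b"
  from this[of "axis i 1" for i] have le: "l $ i \<le> u $ i" for i
    by (simp add: inner_axis)
  have un: "uncoords v \<bullet> coord_basis i = v $ i" for v :: "real^'a coord" and i
    using coords_uncoords[of v] by (metis coords_def vec_lambda_beta)
  have Bas: "b \<in> Basis \<longleftrightarrow> (\<exists>i. b = coord_basis i)" for b :: 'a
    using bij_coord_basis[where 'a='a] by (auto simp: bij_betw_def)
  have "coords -` box l u = box (uncoords l) (uncoords u :: 'a)"
  proof (intro set_eqI iffI)
    fix x assume "x \<in> coords -` box l u"
    then have "l $ i < x \<bullet> coord_basis i \<and> x \<bullet> coord_basis i < u $ i" for i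
      by (simp add: mem_box_cart) (simp add: coords_def)
    then show "x \<in> box (uncoords l) (uncoords u :: 'a)"
      by (auto simp: mem_box(1) Bas un)
  next
    fix x :: 'a assume "x \<in> box (uncoords l) (uncoords u)"
    then have "uncoords l \<bullet> coord_basis i < x \<bullet> coord_basis i \<and> x \<bullet> coord_basis i < uncoords u \<bullet> coord_basis i" for i
      by (simp add: mem_box)
    then show "x \<in> coords -` box l u"
      by (simp add: mem_box_cart un) (simp add: coords_def)
  qed
  then have "emeasure (distr lborel borel coords) (box l u) = emeasure lborel (box (uncoords l) (uncoords u :: 'a))"
    by (subst emeasure_distr) auto
  also have "\<dots> = (\<Prod>b\<in>Basis. (uncoords u - uncoords l :: 'a) \<bullet> b)"
    by (rule emeasure_lborel_box) (auto simp: Bas un le)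
  also have "(\<Prod>b\<in>Basis. (uncoords u - uncoords l :: 'a) \<bullet> b) = (\<Prod>i\<in>UNIV. (u - l) $ i)"
    by (subst prod.reindex_bij_betw[OF bij_coord_basis, symmetric]) (simp add: inner_diff_left un)
  also have "\<dots> = (\<Prod>b\<in>Basis. (u - l) \<bullet> b)"
    by (simp add: prod_Basis_vec inner_axis)
  finally show "emeasure (distr lborel borel coords) (box l u) = (\<Prod>b\<in>Basis. (u - l) \<bullet> b)" .
qed simp

lemma emeasure_coords_image:
  assumes "A \<in> sets borel"
  shows "coords ` A \<in> sets borel" "emeasure lborel (coords ` A) = emeasure lborel A"
proof -
  have "uncoords -` A \<inter> space borel \<in> sets borel"
    using assms by measurable
  then show *: "coords ` A \<in> sets borel"
    by (simp add: vimage_coords)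
  have "coords -` (coords ` A) = A"
    by (auto simp: vimage_coords image_image)
  then show "emeasure lborel (coords ` A) = emeasure lborel A"
    by (subst distr_coords[symmetric], subst emeasure_distr) (use * in auto)
qed

lemma nn_integral_uncoords:
  assumes "f \<in> borel_measurable borel"
  shows "(\<integral>\<^sup>+y. f (uncoords y) \<partial>lborel) = (\<integral>\<^sup>+x. f x \<partial>lborel)"
  using assms by (subst distr_coords[symmetric]) (simp add: nn_integral_distr)

lemma det_reindex:
  fixes A :: "real^'n::finite^'n" and b :: "'m::finite \<Rightarrow> 'n"
  assumes b: "bij b"
  shows "det (\<chi> i j. A $ b i $ b j :: real^'m^'m) = det A"
proof -
  let ?f = "map_permutation UNIV b"
  have inj: "inj_on b UNIV" and bb: "bij_betw b UNIV UNIV"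
    using b by (auto simp: bij_def)
  have bij: "bij_betw ?f {p. p permutes UNIV} {p. p permutes UNIV}"
  proof (rule bij_betw_byWitness[where f' = "map_permutation UNIV (inv b)"])
    show "\<forall>p\<in>{p. p permutes UNIV}. map_permutation UNIV (inv b) (?f p) = p"
      using map_permutation_compose_inv[OF bb] b by (auto simp: bij_is_inj)
    show "\<forall>p\<in>{p. p permutes UNIV}. ?f (map_permutation UNIV (inv b) p) = p"
      using map_permutation_compose_inv[OF bij_betw_inv_into[OF bb]] b
      by (auto simp: surj_f_inv_f bij_is_surj)
    show "?f ` {p. p permutes UNIV} \<subseteq> {p. p permutes UNIV}"
      using map_permutation_permutes[OF bb] by auto
    show "map_permutation UNIV (inv b) ` {p. p permutes UNIV} \<subseteq> {p. p permutes UNIV}"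
      using map_permutation_permutes[OF bij_betw_inv_into[OF bb]] by auto
  qed
  have "det A = (\<Sum>p | p permutes UNIV. of_int (sign (?f p)) * (\<Prod>i\<in>UNIV. A $ i $ ?f p i))"
    unfolding det_def by (rule sum.reindex_bij_betw[OF bij, symmetric])
  also have "\<dots> = (\<Sum>p | p permutes (UNIV :: 'm set). of_int (sign p) * (\<Prod>i\<in>UNIV. A $ b i $ b (p i)))"
  proof (rule sum.cong[OF refl])
    fix p :: "'m \<Rightarrow> 'm" assume "p \<in> {p. p permutes UNIV}"
    then have p: "p permutes UNIV" by simp
    have "(\<Prod>i\<in>UNIV. A $ i $ ?f p i) = (\<Prod>i\<in>UNIV. A $ b i $ ?f p (b i))"
      by (rule prod.reindex_bij_betw[OF bb, symmetric])
    then show "of_int (sign (?f p)) * (\<Prod>i\<in>UNIV. A $ i $ ?f p i) = real_of_int (sign p) * (\<Prod>i\<in>UNIV. A $ b i $ b (p i))"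
      by (simp add: map_permutation_apply[OF inj] sign_map_permutation[OF inj p])
  qed
  also have "\<dots> = det (\<chi> i j. A $ b i $ b j :: real^'m^'m)"
    unfolding det_def by simp
  finally show ?thesis ..
qed

text \<open>The integral is finite exactly when the image has finite measure; otherwise both sides are infinite,
  so that no integrability has to be checked in applications.\<close>

lemma emeasure_differentiable_image_wellorder:
  fixes g :: "real^'n::{finite,wellorder} \<Rightarrow> real^'n::_"
  assumes S: "S \<in> sets lebesgue"
    and g': "\<And>x. x \<in> S \<Longrightarrow> (g has_derivative g' x) (at x within S)"
    and inj: "inj_on g S"
  shows "emeasure lebesgue (g ` S) = (\<integral>\<^sup>+x. (if x \<in> S then ennreal \<bar>det (matrix (g' x))\<bar> else 0) \<partial>lborel)"
proof -
  let ?f = "\<lambda>x. if x \<in> S then \<bar>det (matrix (g' x))\<bar> else 0"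
  have "(\<lambda>x. \<bar>det (matrix (g' x))\<bar>) \<in> borel_measurable (lebesgue_on S)"
    using borel_measurable_det_Jacobian[OF S g'] by measurable
  then have f: "?f \<in> borel_measurable lebesgue"
    using S by (subst borel_measurable_if) auto
  have gS: "g ` S \<in> sets lebesgue"
    by (rule differentiable_image_in_sets_lebesgue[OF S]) (use g' in \<open>auto simp: differentiable_on_def differentiable_def\<close>)
  have iff: "(g ` S \<in> lmeasurable \<and> measure lebesgue (g ` S) = m) \<longleftrightarrow> (integral\<^sup>N lebesgue ?f = ennreal m \<and> 0 \<le> m)" for m
    using has_measure_differentiable_image[OF S g' inj, of m] f
      has_integral_iff_nn_integral_lebesgue[of ?f m]
    by (simp add: has_integral_restrict_UNIV)
  have "emeasure lebesgue (g ` S) = integral\<^sup>N lebesgue ?f"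
  proof (cases "integral\<^sup>N lebesgue ?f = \<infinity>")
    case True
    then have "g ` S \<notin> lmeasurable"
      using iff[of "measure lebesgue (g ` S)"] by auto
    then show ?thesis
      using True gS by (auto simp: fmeasurable_def less_top[symmetric])
  next
    case False
    then obtain m where m: "integral\<^sup>N lebesgue ?f = ennreal m" "0 \<le> m"
      by (cases "integral\<^sup>N lebesgue ?f") auto
    then show ?thesis
      using iff[of m] by (auto simp: emeasure_eq_measure2)
  qed
  also have "integral\<^sup>N lebesgue ?f = (\<integral>\<^sup>+x. (if x \<in> S then ennreal \<bar>det (matrix (g' x))\<bar> else 0) \<partial>lborel)"
    unfolding nn_integral_completion by (intro nn_integral_cong) auto
  finally show ?thesis .
qed

lemma det_matrix_coords:
  fixes f :: "real^'n \<Rightarrow> real^'n"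
  shows "det (matrix (coords \<circ> f \<circ> uncoords)) = det (matrix f)"
proof -
  let ?ax = "\<lambda>i::'n. axis i (1::real)"
  have ax: "bij_betw ?ax UNIV Basis"
    by (auto simp: bij_betw_def inj_on_def axis_eq_axis Basis_vec_axis)
  define b where "b i = inv_into UNIV ?ax (coord_basis i)" for i :: "(real^'n) coord"
  have b: "bij b"
    unfolding b_def using bij_betw_trans[OF bij_coord_basis bij_betw_inv_into[OF ax]]
    by (simp add: o_def)
  have axb: "?ax (b i) = coord_basis i" for i
    unfolding b_def using bij_betw_inv_into_right[OF ax] by simp
  have un: "uncoords (axis j 1) = ?ax (b j)" for j
    unfolding uncoords_def axb by (simp add: axis_def if_distrib if_distribR cong: if_cong)
  have "matrix (coords \<circ> f \<circ> uncoords) = (\<chi> i j. matrix f $ b i $ b j)"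
    by (simp add: matrix_def coords_def un vec_eq_iff axb[symmetric] inner_axis)
  then show ?thesis
    using det_reindex[OF b, of "matrix f"] by simp
qed

proposition emeasure_differentiable_image:
  fixes g :: "real^'n \<Rightarrow> real^'n"
  assumes E: "E \<in> sets borel" and gE: "g ` E \<in> sets borel"
    and g': "\<And>x. x \<in> E \<Longrightarrow> (g has_derivative g' x) (at x)"
    and inj: "inj_on g E"
    and meas: "(\<lambda>x. if x \<in> E then \<bar>det (matrix (g' x))\<bar> else 0) \<in> borel_measurable borel"
  shows "emeasure lborel (g ` E) = (\<integral>\<^sup>+x\<in>E. ennreal \<bar>det (matrix (g' x))\<bar> \<partial>lborel)"
proof -
  let ?h = "coords \<circ> g \<circ> uncoords"
  let ?h' = "\<lambda>y. coords \<circ> g' (uncoords y) \<circ> uncoords"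
  have im: "?h ` (coords ` E) = coords ` (g ` E)"
    by (auto simp: image_iff)
  have mem: "y \<in> coords ` E \<longleftrightarrow> uncoords y \<in> E" for y
    by (metis (no_types) coords_uncoords image_iff uncoords_coords)
  have "emeasure lborel (g ` E) = emeasure lebesgue (?h ` (coords ` E))"
    unfolding im using emeasure_coords_image[OF gE] by simp
  also have "\<dots> = (\<integral>\<^sup>+y. (if y \<in> coords ` E then ennreal \<bar>det (matrix (?h' y))\<bar> else 0) \<partial>lborel)"
  proof (rule emeasure_differentiable_image_wellorder)
    show "coords ` E \<in> sets lebesgue"
      using emeasure_coords_image[OF E] by auto
    show "inj_on ?h (coords ` E)"
    proof (rule inj_onI)
      fix x y assume *: "x \<in> coords ` E" "y \<in> coords ` E" "?h x = ?h y"
      then have "uncoords (?h x) = uncoords (?h y)" by simp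
      with * have "uncoords x = uncoords y"
        using inj mem by (auto simp: inj_on_def)
      then show "x = y" by (metis coords_uncoords)
    qed
    fix y assume "y \<in> coords ` E"
    then have "(g has_derivative g' (uncoords y)) (at (uncoords y))"
      by (auto intro: g')
    then have "(g \<circ> uncoords has_derivative g' (uncoords y) \<circ> uncoords) (at y)"
      by (intro diff_chain_at bounded_linear_imp_has_derivative bounded_linear_uncoords)
    then have "(coords \<circ> (g \<circ> uncoords) has_derivative coords \<circ> (g' (uncoords y) \<circ> uncoords)) (at y)"
      by (rule diff_chain_at) (rule bounded_linear_imp_has_derivative[OF bounded_linear_coords])
    then have "(?h has_derivative ?h' y) (at y)"
      by (simp only: comp_assoc)
    then show "(?h has_derivative ?h' y) (at y within coords ` E)"
      by (rule has_derivative_at_withinI)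
  qed
  also have "\<dots> = (\<integral>\<^sup>+y. ennreal (if uncoords y \<in> E then \<bar>det (matrix (g' (uncoords y)))\<bar> else 0) \<partial>lborel)"
    by (intro nn_integral_cong) (auto simp: det_matrix_coords mem)
  also have "\<dots> = (\<integral>\<^sup>+x. ennreal (if x \<in> E then \<bar>det (matrix (g' x))\<bar> else 0) \<partial>lborel)"
    using nn_integral_uncoords[of "\<lambda>x. ennreal (if x \<in> E then \<bar>det (matrix (g' x))\<bar> else 0)"] meas by simp
  also have "\<dots> = (\<integral>\<^sup>+x\<in>E. ennreal \<bar>det (matrix (g' x))\<bar> \<partial>lborel)"
    by (intro nn_integral_cong) (auto simp: indicator_def)
  finally show ?thesis .
qed

text \<open>Applied to the sets \<open>E \<inter> g\<^sup>-\<^sup>1(A)\<close>, the formula for sets says that \<open>g\<close> pushes the density \<open>|det g'|\<close> on \<open>E\<close>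
  forward to Lebesgue measure on \<open>g(E)\<close>.\<close>

proposition nn_integral_differentiable_image:
  fixes g :: "real^'n \<Rightarrow> real^'n"
  assumes E: "E \<in> sets borel" and gE: "g ` E \<in> sets borel"
    and g': "\<And>x. x \<in> E \<Longrightarrow> (g has_derivative g' x) (at x)"
    and inj: "inj_on g E"
    and meas: "(\<lambda>x. if x \<in> E then \<bar>det (matrix (g' x))\<bar> else 0) \<in> borel_measurable borel"
    and f: "f \<in> borel_measurable borel"
  shows "(\<integral>\<^sup>+y\<in>g ` E. f y \<partial>lborel) = (\<integral>\<^sup>+x\<in>E. ennreal \<bar>det (matrix (g' x))\<bar> * f (g x) \<partial>lborel)"
proof -
  define h where "h x = (if x \<in> E then g x else 0)" for x
  let ?d = "\<lambda>x. ennreal (if x \<in> E then \<bar>det (matrix (g' x))\<bar> else 0)"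
  have "continuous_on E g"
    using g' by (meson continuous_at_imp_continuous_on has_derivative_continuous)
  then have h [measurable]: "h \<in> borel_measurable borel"
    unfolding h_def using E by (simp add: borel_measurable_continuous_on_if continuous_on_const)
  note [measurable] = E gE meas f
  have eq: "density lborel (indicator (g ` E)) = distr (density lborel ?d) borel h"
  proof (rule measure_eqI)
    fix A :: "(real^'n) set" assume "A \<in> sets (density lborel (indicator (g ` E)))"
    then have A [measurable]: "A \<in> sets borel" by simp
    have EA: "E \<inter> h -` A \<in> sets borel"
      using measurable_sets[OF h A] E by auto
    have gEA: "g ` (E \<inter> h -` A) = g ` E \<inter> A"
      by (auto simp: h_def)
    have "emeasure (density lborel (indicator (g ` E))) A = emeasure lborel (g ` (E \<inter> h -` A))"
      unfolding gEA by (simp add: emeasure_density) (simp add: indicator_inter_arith[symmetric])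
    also have "\<dots> = (\<integral>\<^sup>+x\<in>E \<inter> h -` A. ennreal \<bar>det (matrix (g' x))\<bar> \<partial>lborel)"
    proof (rule emeasure_differentiable_image[OF EA])
      show "g ` (E \<inter> h -` A) \<in> sets borel" unfolding gEA by measurable
      show "inj_on g (E \<inter> h -` A)" using inj by (rule inj_on_subset) auto
      have "(\<lambda>x. (if x \<in> E then \<bar>det (matrix (g' x))\<bar> else 0) * indicator (E \<inter> h -` A) x) \<in> borel_measurable borel"
        using EA by measurable
      moreover have "(\<lambda>x. (if x \<in> E then \<bar>det (matrix (g' x))\<bar> else 0) * indicator (E \<inter> h -` A) x)
         = (\<lambda>x. if x \<in> E \<inter> h -` A then \<bar>det (matrix (g' x))\<bar> else 0)"
        by (auto simp: fun_eq_iff indicator_def)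
      ultimately show "(\<lambda>x. if x \<in> E \<inter> h -` A then \<bar>det (matrix (g' x))\<bar> else 0) \<in> borel_measurable borel"
        by simp
    qed (use g' in auto)
    also have "\<dots> = emeasure (distr (density lborel ?d) borel h) A"
    proof -
      have "h -` A \<in> sets borel" using measurable_sets[OF h A] by simp
      then show ?thesis
        by (simp add: emeasure_distr emeasure_density)
           (intro nn_integral_cong, auto simp: indicator_def)
    qed
    finally show "emeasure (density lborel (indicator (g ` E))) A = emeasure (distr (density lborel ?d) borel h) A" .
  qed simp
  have "(\<integral>\<^sup>+y\<in>g ` E. f y \<partial>lborel) = (\<integral>\<^sup>+y. f y \<partial>density lborel (indicator (g ` E)))"
    by (simp add: nn_integral_density mult.commute)
  also have "\<dots> = (\<integral>\<^sup>+x. ?d x * f (h x) \<partial>lborel)"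
    unfolding eq by (simp add: nn_integral_distr nn_integral_density)
  also have "\<dots> = (\<integral>\<^sup>+x\<in>E. ennreal \<bar>det (matrix (g' x))\<bar> * f (g x) \<partial>lborel)"
    by (intro nn_integral_cong) (auto simp: h_def)
  finally show ?thesis .
qed

proposition distr_lborel_matrix:
  fixes A :: "real^'n^'n"
  assumes A: "det A \<noteq> 0"
  shows "distr lborel borel ((*v) A) = density lborel (\<lambda>_. ennreal (1 / \<bar>det A\<bar>))"
proof (rule measure_eqI)
  fix X :: "(real^'n) set" assume "X \<in> sets (distr lborel borel ((*v) A))"
  then have X [measurable]: "X \<in> sets borel" by simp
  have A_meas [measurable]: "(*v) A \<in> borel_measurable borel"
    by (intro borel_measurable_continuous_onI continuous_intros)
  define Y where "Y = (*v) A -` X"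
  have Y: "Y \<in> sets borel" unfolding Y_def using measurable_sets[OF A_meas X] by simp
  have "invertible A" using A by (simp add: invertible_det_nz)
  then have surj: "surj ((*v) A)" and inj: "inj ((*v) A)"
    by (auto simp: invertible_eq_bij bij_def)
  have AY: "(*v) A ` Y = X"
    unfolding Y_def using surj by auto
  have "emeasure lborel X = (\<integral>\<^sup>+x\<in>Y. ennreal \<bar>det (matrix ((*v) A))\<bar> \<partial>lborel)"
    unfolding AY[symmetric]
  proof (rule emeasure_differentiable_image[OF Y])
    show "(*v) A ` Y \<in> sets borel" unfolding AY by measurable
    show "inj_on ((*v) A) Y" using inj by (rule inj_on_subset) auto
    show "((*v) A has_derivative (*v) A) (at x)" for x
      by (rule bounded_linear_imp_has_derivative) (rule matrix_vector_mul_bounded_linear)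
  qed (use Y in measurable)
  also have "\<dots> = ennreal \<bar>det A\<bar> * emeasure lborel Y"
    using Y by (simp add: nn_integral_cmult)
  finally have "emeasure lborel X = ennreal \<bar>det A\<bar> * emeasure lborel Y" .
  then have "ennreal (1 / \<bar>det A\<bar>) * emeasure lborel X = ennreal (1 / \<bar>det A\<bar> * \<bar>det A\<bar>) * emeasure lborel Y"
    by (subst ennreal_mult) (auto simp: mult.assoc)
  then have "ennreal (1 / \<bar>det A\<bar>) * emeasure lborel X = emeasure lborel Y"
    using A by simp
  then show "emeasure (distr lborel borel ((*v) A)) X = emeasure (density lborel (\<lambda>_. ennreal (1 / \<bar>det A\<bar>))) X"
    by (simp add: emeasure_distr Y_def[symmetric] emeasure_density nn_integral_cmult)
qed simp

text \<open>In coordinates \<open>f\<close> is an orthogonal matrix, whose determinant is \<open>1\<close> or \<open>-1\<close>.\<close>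

proposition distr_lborel_isometry:
  fixes f :: "'a::euclidean_space \<Rightarrow> 'a"
  assumes f: "linear f" and norm: "\<And>x. norm (f x) = norm x"
  shows "distr lborel borel f = lborel"
proof -
  have contf: "continuous_on UNIV f"
    using f by (simp add: linear_continuous_on linear_conv_bounded_linear)
  then have [measurable]: "f \<in> borel_measurable borel"
    by (rule borel_measurable_continuous_onI)
  let ?h = "coords \<circ> f \<circ> uncoords"
  have "linear ?h"
    using f linear_coords linear_uncoords by (intro linear_compose)
  moreover have "norm (?h y) = norm y" for y
    using norm[of "uncoords y"] inner_coords[of "f (uncoords y)" "f (uncoords y)"]
      inner_coords[of "uncoords y" "uncoords y"] by (simp add: norm_eq_sqrt_inner)
  ultimately have orth: "orthogonal_transformation ?h"
    by (simp add: orthogonal_transformation)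
  then have hA: "?h = (*v) (matrix ?h)" and "orthogonal_matrix (matrix ?h)"
    using \<open>linear ?h\<close> orthogonal_transformation_matrix by (auto simp: matrix_works)
  then have "det (matrix ?h) = 1 \<or> det (matrix ?h) = -1"
    by (rule_tac det_orthogonal_matrix)
  then have "distr lborel borel ((*v) (matrix ?h)) = lborel"
    by (subst distr_lborel_matrix) (auto simp: density_1)
  then have h: "distr lborel borel ?h = lborel"
    by (simp only: hA[symmetric])
  have "distr lborel borel f = distr (distr lborel borel (coords \<circ> f)) borel uncoords"
    by (simp add: distr_distr o_def)
  also have "distr lborel borel (coords \<circ> f) = distr (distr lborel borel coords) borel ?h"
    by (simp add: distr_distr o_def)
  also have "\<dots> = distr lborel borel coords"
    unfolding distr_coords h ..
  also have "distr \<dots> borel uncoords = distr lborel borel (\<lambda>x. x)"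
    by (simp add: distr_distr o_def)
  also have "\<dots> = lborel"
    by (rule distr_id2) simp
  finally show ?thesis .
qed

section \<open>Symmetric positive definite matrices\<close>

text \<open>Products with a transpose stay in this form, as the rules below expect.\<close>

declare transpose_matrix_vector [simp del]

lemma inner_matrix_transpose: "x \<bullet> (A *v y) = (transpose A *v x) \<bullet> y"
  for A :: "real^'n^'m"
  by (metis dot_lmul_matrix transpose_matrix_vector)

text \<open>A maximizer \<open>e\<close> of \<open>x \<bullet> f x\<close> on the unit sphere of \<open>V\<close>, with maximum \<open>c\<close>, is an eigenvector: the quadratic
  form \<open>q x = c |x|\<^sup>2 - x \<bullet> f x\<close> is nonnegative on \<open>V\<close> and vanishes at \<open>e\<close>, so its derivative at \<open>e\<close> in the
  direction \<open>w = c e - f e\<close>, which is \<open>2 |w|\<^sup>2\<close>, vanishes.\<close>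

lemma selfadjoint_eigenvector:
  fixes f :: "'a::euclidean_space \<Rightarrow> 'a"
  assumes f: "linear f" and sa: "\<And>x y. f x \<bullet> y = x \<bullet> f y"
    and V: "subspace V" and inv: "f ` V \<subseteq> V" and ne: "V \<noteq> {0}"
  obtains e c where "e \<in> V" "norm e = 1" "f e = c *\<^sub>R e"
proof -
  obtain v where v: "v \<in> V" "v \<noteq> 0"
    using ne subspace_0[OF V] by blast
  let ?K = "sphere 0 1 \<inter> V"
  have "compact ?K"
    using V by (intro compact_Int_closed closed_subspace) auto
  moreover have "(1 / norm v) *\<^sub>R v \<in> ?K"
    using v V by (auto simp: subspace_scale)
  moreover have contf: "continuous_on UNIV f"
    using f by (simp add: linear_continuous_on linear_conv_bounded_linear)
  then have "continuous_on ?K (\<lambda>x. x \<bullet> f x)"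
    by (intro continuous_intros continuous_on_subset[OF contf]) auto
  ultimately obtain e where e: "e \<in> ?K" and max: "\<And>x. x \<in> ?K \<Longrightarrow> x \<bullet> f x \<le> e \<bullet> f e"
    using continuous_attains_sup[of ?K "\<lambda>x. x \<bullet> f x"] by blast
  define c where "c = e \<bullet> f e"
  define q where "q x = c * (x \<bullet> x) - x \<bullet> f x" for x
  have q_nonneg: "q x \<ge> 0" if "x \<in> V" for x
  proof (cases "x = 0")
    case False
    have "(1 / norm x) *\<^sub>R x \<in> ?K"
      using that False V by (auto simp: subspace_scale)
    from max[OF this] have "(1 / norm x)^2 * (x \<bullet> f x) \<le> c"
      using f by (simp add: linear_cmul c_def power2_eq_square)
    then show ?thesis
      using False by (simp add: q_def field_simps power2_norm_eq_inner[symmetric])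
  qed (use f in \<open>simp add: q_def linear_0\<close>)
  have ee: "e \<bullet> e = 1"
    using e by (simp add: norm_eq_1)
  define w where "w = c *\<^sub>R e - f e"
  have w: "w \<in> V"
    unfolding w_def using e inv V by (intro subspace_diff subspace_scale) auto
  \<comment> \<open>a step \<open>t\<close> for which \<open>2 t b + t\<^sup>2 q w < 0\<close> unless \<open>b = 0\<close>\<close>
  let ?b = "w \<bullet> w" and ?t = "- (w \<bullet> w) / (q w + 1)"
  have expand: "q (e + t *\<^sub>R w) = 2 * t * ?b + t^2 * q w" for t
  proof -
    have 1: "w \<bullet> w = c * (w \<bullet> e) - w \<bullet> f e"
      by (subst (2) w_def) (simp add: inner_diff_right)
    have 2: "e \<bullet> f w = w \<bullet> f e" by (metis sa inner_commute)
    have 3: "w \<bullet> e = e \<bullet> w" by (rule inner_commute)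
    have "q (e + t *\<^sub>R w) = 2 * t * (c * (w \<bullet> e) - w \<bullet> f e) + t^2 * q w"
      unfolding q_def using f
      by (simp add: linear_add linear_cmul inner_add_left inner_add_right 2 3 ee c_def[symmetric]
          algebra_simps power2_eq_square)
    then show ?thesis
      unfolding 1[symmetric] .
  qed
  have "0 \<le> q (e + ?t *\<^sub>R w)"
    using w e V by (intro q_nonneg subspace_add subspace_scale) auto
  also have "q (e + ?t *\<^sub>R w) = - ((?b)^2 * (q w + 2) / (q w + 1)^2)"
    unfolding expand using q_nonneg[OF w] by (simp add: divide_simps) (simp add: algebra_simps power2_eq_square)
  finally have "(?b)^2 * (q w + 2) / (q w + 1)^2 \<le> 0"
    by simp
  then have "?b = 0"
    using q_nonneg[OF w] by (simp add: divide_le_0_iff mult_le_0_iff)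
  then have "f e = c *\<^sub>R e"
    by (simp add: w_def)
  with e show thesis
    by (intro that[of e c]) auto
qed

text \<open>Induction on the dimension: the orthogonal complement of an eigenvector is invariant, because \<open>f\<close> is
  self-adjoint.\<close>

lemma selfadjoint_eigenbasis:
  fixes f :: "'a::euclidean_space \<Rightarrow> 'a"
  assumes f: "linear f" and sa: "\<And>x y. f x \<bullet> y = x \<bullet> f y"
  shows "subspace V \<Longrightarrow> f ` V \<subseteq> V \<Longrightarrow>
    \<exists>B. finite B \<and> pairwise orthogonal B \<and> (\<forall>b\<in>B. norm b = 1) \<and> span B = V \<and> (\<forall>b\<in>B. \<exists>c. f b = c *\<^sub>R b)"
proof (induction "dim V" arbitrary: V rule: less_induct)
  case less
  show ?case
  proof (cases "V = {0}")
    case True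
    then show ?thesis by (intro exI[of _ "{}"]) auto
  next
    case False
    then obtain e c where e: "e \<in> V" "norm e = 1" "f e = c *\<^sub>R e"
      using selfadjoint_eigenvector[OF f sa less.prems] by blast
    define W where "W = {x \<in> V. x \<bullet> e = 0}"
    have W: "subspace W"
      unfolding W_def using less.prems(1) by (auto simp: subspace_def inner_add_left)
    have ee: "e \<bullet> e = 1" using e by (simp add: norm_eq_1)
    have "e \<notin> W" using ee by (simp add: W_def)
    moreover have "W \<subseteq> V" by (auto simp: W_def)
    ultimately have "W \<subset> V" using e(1) by blast
    then have "dim W < dim V"
      using W less.prems(1) by (metis dim_psubset span_eq_iff)
    moreover have "f ` W \<subseteq> W"
      using less.prems(2) e by (auto simp: W_def sa)
    ultimately obtain B where B: "finite B" "pairwise orthogonal B" "\<forall>b\<in>B. norm b = 1" "span B = W"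
        "\<forall>b\<in>B. \<exists>c. f b = c *\<^sub>R b"
      using less.hyps[OF _ W] by blast
    have BW: "b \<in> W" if "b \<in> B" for b
      using that B(4) span_base by blast
    have "span (insert e B) = V"
    proof (rule span_subspace[OF _ _ less.prems(1)])
      show "insert e B \<subseteq> V" using e BW by (auto simp: W_def)
      show "V \<subseteq> span (insert e B)"
      proof
        fix x assume x: "x \<in> V"
        have "x - (x \<bullet> e) *\<^sub>R e \<in> W"
          using x e less.prems(1) ee by (auto simp: W_def inner_diff_left intro: subspace_diff subspace_scale)
        then show "x \<in> span (insert e B)"
          using B(4) by (auto simp: span_insert)
      qed
    qed
    moreover have "pairwise orthogonal (insert e B)"
      using B(2) BW by (auto simp: pairwise_insert W_def orthogonal_def inner_commute)
    ultimately show ?thesis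
      using B e by (intro exI[of _ "insert e B"]) auto
  qed
qed

lemma spdD:
  assumes "spd A"
  shows "transpose A = A" "x \<noteq> 0 \<Longrightarrow> x \<bullet> (A *v x) > 0" "x \<bullet> (A *v x) \<ge> 0"
    "x \<bullet> (A *v x) = 0 \<longleftrightarrow> x = 0"
  using assms by (auto simp: spd_def) (metis inner_zero_left less_eq_real_def order_less_irrefl)+

lemma spd_inner_swap: "spd A \<Longrightarrow> x \<bullet> (A *v y) = (A *v x) \<bullet> y"
  by (metis inner_matrix_transpose spdD(1))

text \<open>For uniqueness, a root \<open>T\<close> satisfies \<open>(T + r) (T - r) b = 0\<close> for every eigenvector \<open>b\<close> of \<open>A\<close> with eigenvalue
  \<open>r\<^sup>2\<close>, and \<open>T + r\<close> is injective; hence \<open>T\<close> is determined on an eigenbasis of \<open>A\<close>.\<close>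

lemma spd_square_root_ex1:
  fixes A :: "real^'n^'n"
  assumes A: "spd A"
  shows "\<exists>!S. spd S \<and> S ** S = A"
proof -
  obtain B where B: "finite B" "pairwise orthogonal B" "\<forall>b\<in>B. norm b = 1" "span B = UNIV"
      and ev: "\<forall>b\<in>B. \<exists>c. A *v b = c *\<^sub>R b"
    using selfadjoint_eigenbasis[OF matrix_vector_mul_linear spd_inner_swap[OF A, symmetric] subspace_UNIV subset_UNIV]
    by blast
  define r where "r b = sqrt (b \<bullet> (A *v b))" for b
  have bb: "b \<bullet> b' = (if b = b' then 1 else 0)" if "b \<in> B" "b' \<in> B" for b b'
    using that B(2,3) by (auto simp: pairwise_def orthogonal_def norm_eq_1)
  have r: "r b > 0" "A *v b = (r b)^2 *\<^sub>R b" if "b \<in> B" for b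
  proof -
    have "b \<noteq> 0" using bb[OF that that] by auto
    then show "r b > 0" unfolding r_def using spdD[OF A] by simp
    obtain c where c: "A *v b = c *\<^sub>R b" using ev \<open>b \<in> B\<close> by blast
    then show "A *v b = (r b)^2 *\<^sub>R b"
      unfolding r_def using bb[OF that that] spdD(3)[OF A, of b] by simp
  qed
  define s where "s x = (\<Sum>b\<in>B. (r b * (x \<bullet> b)) *\<^sub>R b)" for x
  have lin: "linear s"
    unfolding s_def
    by (intro linearI)
       (simp_all add: inner_add_left distrib_left scaleR_add_left sum.distrib scaleR_sum_right mult.left_commute)
  have xs: "x \<bullet> s y = (\<Sum>b\<in>B. r b * (x \<bullet> b) * (y \<bullet> b))" for x y
    unfolding s_def by (simp add: inner_sum_right mult_ac)
  let ?S = "matrix s"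
  have Sv: "?S *v x = s x" for x
    using lin by (simp add: matrix_works)
  have sb: "s b = r b *\<^sub>R b" if "b \<in> B" for b
  proof -
    have "s b = (\<Sum>b'\<in>B. if b' = b then r b *\<^sub>R b else 0)"
      unfolding s_def using that bb by (intro sum.cong) auto
    then show ?thesis using B(1) that by simp
  qed
  have "spd ?S"
    unfolding spd_def
  proof (intro conjI allI impI)
    have "(transpose ?S *v x) \<bullet> y = (?S *v x) \<bullet> y" for x y
      by (simp add: inner_matrix_transpose[symmetric] Sv xs inner_commute[of "s x"] mult_ac)
    then have "transpose ?S *v x = ?S *v x" for x
      using vector_eq_rdot by blast
    then show "transpose ?S = ?S"
      by (simp add: matrix_eq)
    fix x :: "real^'n" assume "x \<noteq> 0"
    have "\<exists>b\<in>B. x \<bullet> b \<noteq> 0"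
    proof (rule ccontr)
      assume "\<not> ?thesis"
      then have "(\<Sum>b\<in>B. (x \<bullet> b) *\<^sub>R b) = 0" by simp
      then show False
        using orthonormal_basis_expand[OF B(2) _ _ B(1), of x] B(3,4) \<open>x \<noteq> 0\<close> by simp
    qed
    then obtain b where b: "b \<in> B" "x \<bullet> b \<noteq> 0" by blast
    have "0 < r b * (x \<bullet> b) * (x \<bullet> b)"
      using r(1)[OF b(1)] b(2) by (auto simp: mult.assoc zero_less_mult_iff linorder_neq_iff)
    also have "\<dots> \<le> (\<Sum>b\<in>B. r b * (x \<bullet> b) * (x \<bullet> b))"
      by (rule member_le_sum[OF b(1)]) (use r B(1) in \<open>auto simp: mult.assoc less_imp_le\<close>)
    finally show "0 < x \<bullet> (?S *v x)"
      by (simp add: Sv xs)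
  qed
  moreover have "?S ** ?S = A"
  proof -
    have "s (s x) = A *v x" for x
    proof (rule linear_eq_on_span[of "\<lambda>x. s (s x)" "(*v) A" B x])
      show "linear (\<lambda>x. s (s x))" using linear_compose[OF lin lin] by (simp add: o_def)
      show "s (s b) = A *v b" if "b \<in> B" for b
        using that lin by (simp add: sb r linear_cmul power2_eq_square)
    qed (use B in auto)
    then show ?thesis
      by (simp add: matrix_eq Sv matrix_vector_mul_assoc[symmetric])
  qed
  moreover have "T = ?S" if T: "spd T" "T ** T = A" for T
  proof -
    have "T *v b = s b" if b: "b \<in> B" for b
    proof -
      define w where "w = T *v b - r b *\<^sub>R b"
      have "T *v w = (T ** T) *v b - r b *\<^sub>R (T *v b)"
        unfolding w_def by (simp add: matrix_vector_mult_diff_distrib matrix_vector_mul_assoc matrix_vector_mult_scaleR)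
      also have "\<dots> = - r b *\<^sub>R w"
        unfolding w_def T(2) r(2)[OF b] by (simp add: algebra_simps power2_eq_square)
      finally have "w \<bullet> (T *v w) = - r b * (w \<bullet> w)" by simp
      then have "w \<bullet> (T *v w) \<le> 0"
        using r(1)[OF b] by simp
      then have "w = 0"
        using spdD(2)[OF T(1), of w] by fastforce
      then show ?thesis by (simp add: w_def sb[OF b])
    qed
    then have "T *v x = s x" for x
      by (intro linear_eq_on_span[of "(*v) T" s B x]) (use lin B in auto)
    then show ?thesis by (simp add: matrix_eq Sv)
  qed
  ultimately show ?thesis by blast
qed

lemma spd_sqrt:
  assumes "spd A"
  shows "spd (spd_sqrt A)" "spd_sqrt A ** spd_sqrt A = A"
  using theI'[OF spd_square_root_ex1[OF assms]] unfolding spd_sqrt_def by auto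

lemma matrix_inv:
  fixes A :: "real^'n^'m"
  assumes "invertible A"
  shows "A ** matrix_inv A = mat 1" "matrix_inv A ** A = mat 1"
  using someI_ex[of "\<lambda>B. A ** B = mat 1 \<and> B ** A = mat 1"] assms
  unfolding invertible_def matrix_inv_def by auto

lemma matrix_inv_vec [simp]:
  fixes A :: "real^'n^'n"
  assumes "invertible A"
  shows "A *v (matrix_inv A *v x) = x" "matrix_inv A *v (A *v x) = x"
  using matrix_inv[OF assms] by (simp_all add: matrix_vector_mul_assoc)

lemma invertible_injI: "(\<And>x. A *v x = 0 \<Longrightarrow> x = 0) \<Longrightarrow> invertible A" for A :: "real^'n^'n"
  by (meson invertible_left_inverse matrix_left_invertible_ker)

lemma spd_invertible: "spd A \<Longrightarrow> invertible A"
  by (rule invertible_injI) (metis inner_zero_right spdD(4))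

lemma spd_matrix_inv:
  assumes A: "spd A"
  shows "spd (matrix_inv A)"
proof -
  note inv = spd_invertible[OF A]
  have "x \<bullet> (matrix_inv A *v y) = (matrix_inv A *v x) \<bullet> y" for x y
    using spd_inner_swap[OF A, of "matrix_inv A *v x" "matrix_inv A *v y"] inv by simp
  then have "transpose (matrix_inv A) *v x = matrix_inv A *v x" for x
    by (metis inner_matrix_transpose vector_eq_rdot)
  moreover have "0 < x \<bullet> (matrix_inv A *v x)" if "x \<noteq> 0" for x
  proof -
    have "matrix_inv A *v x \<noteq> 0" using that matrix_inv_vec(1)[OF inv, of x] by force
    then have "0 < (matrix_inv A *v x) \<bullet> (A *v (matrix_inv A *v x))" by (rule spdD(2)[OF A])
    then show ?thesis using inv by (simp add: inner_commute)
  qed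
  ultimately show ?thesis by (simp add: spd_def matrix_eq)
qed

lemma spd_add: "spd A \<Longrightarrow> spd B \<Longrightarrow> spd (A + B)"
  by (auto simp: spd_def transpose_def vec_eq_iff matrix_vector_mult_add_rdistrib inner_add_right add_pos_pos)

lemma spd_scaleR: "spd A \<Longrightarrow> c > 0 \<Longrightarrow> spd (c *\<^sub>R A)"
  by (auto simp: spd_def transpose_def vec_eq_iff scaleR_matrix_vector_assoc[symmetric])

lemma spd_congruence:
  fixes C :: "real^'k^'d"
  assumes A: "spd A" and C: "inj ((*v) C)"
  shows "spd (transpose C ** A ** C)"
proof -
  have "transpose (transpose C ** A ** C) = transpose C ** A ** C"
    by (simp add: matrix_transpose_mul spdD(1)[OF A] matrix_mul_assoc)
  moreover have "0 < x \<bullet> ((transpose C ** A ** C) *v x)" if "x \<noteq> 0" for x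
  proof -
    have "C *v x \<noteq> 0" using that injD[OF C, of x 0] by auto
    then show ?thesis
      using spdD(2)[OF A, of "C *v x"]
      by (simp add: matrix_vector_mul_assoc[symmetric] inner_matrix_transpose)
  qed
  ultimately show ?thesis by (simp add: spd_def)
qed

lemma spd_det_pos: "spd A \<Longrightarrow> det A > 0"
proof -
  assume A: "spd A"
  have "det A = (det (spd_sqrt A))^2"
    by (metis A det_mul power2_eq_square spd_sqrt(2))
  moreover have "det A \<noteq> 0"
    using spd_invertible[OF A] by (simp add: invertible_det_nz)
  ultimately show ?thesis
    by (metis zero_less_power2 power_zero_numeral)
qed

subsection \<open>Continuity of matrix operations\<close>

lemma continuous_on_matrix_mult [continuous_intros]:
  fixes F :: "'a::topological_space \<Rightarrow> real^'n^'m" and G :: "'a \<Rightarrow> real^'p^'n"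
  shows "continuous_on X F \<Longrightarrow> continuous_on X G \<Longrightarrow> continuous_on X (\<lambda>x. F x ** G x)"
  unfolding matrix_matrix_mult_def by (intro continuous_intros)

lemma continuous_on_matrix_vector_mult' [continuous_intros]:
  fixes F :: "'a::topological_space \<Rightarrow> real^'n^'m"
  shows "continuous_on X F \<Longrightarrow> continuous_on X G \<Longrightarrow> continuous_on X (\<lambda>x. F x *v G x)"
  unfolding matrix_vector_mult_def by (intro continuous_intros)

lemma continuous_on_transpose' [continuous_intros]:
  fixes F :: "'a::topological_space \<Rightarrow> real^'n^'m"
  shows "continuous_on X F \<Longrightarrow> continuous_on X (\<lambda>x. transpose (F x))"
  unfolding transpose_def by (intro continuous_intros)

lemma continuous_on_det' [continuous_intros]:
  fixes F :: "'a::topological_space \<Rightarrow> real^'n^'n"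
  shows "continuous_on X F \<Longrightarrow> continuous_on X (\<lambda>x. det (F x))"
  unfolding det_def by (intro continuous_intros)

lemma matrix_inv_cramer:
  fixes A :: "real^'n^'n"
  assumes "invertible A"
  shows "matrix_inv A $ k $ l = det (\<chi> i j. if j = k then axis l 1 $ i else A $ i $ j) / det A"
proof -
  have "A *v (matrix_inv A *v axis l 1) = axis l 1"
    using assms by simp
  then have "matrix_inv A *v axis l 1 = (\<chi> k. det (\<chi> i j. if j = k then axis l 1 $ i else A $ i $ j) / det A)"
    using assms by (subst (asm) cramer) (auto simp: invertible_det_nz)
  then show ?thesis
    by (simp add: vec_eq_iff matrix_vector_mult_basis column_def)
qed

lemma continuous_on_matrix_inv [continuous_intros]:
  fixes F :: "'a::topological_space \<Rightarrow> real^'n^'n"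
  assumes F: "continuous_on X F" and inv: "\<And>x. x \<in> X \<Longrightarrow> invertible (F x)"
  shows "continuous_on X (\<lambda>x. matrix_inv (F x))"
proof -
  have "continuous_on X (\<lambda>x. \<chi> k l. det (\<chi> i j. if j = k then axis l 1 $ i else F x $ i $ j) / det (F x))"
  proof (intro continuous_intros)
    fix k l i j :: 'n
    show "continuous_on X (\<lambda>x. if j = k then axis l 1 $ i else F x $ i $ j)"
      by (cases "j = k") (auto intro!: continuous_intros F)
  qed (use F inv in \<open>auto simp: invertible_det_nz\<close>)
  then show ?thesis
    by (rule continuous_on_eq) (simp add: vec_eq_iff matrix_inv_cramer inv)
qed

section \<open>Smooth functions and charts of a level set\<close>

lemma continuous_on_vec_iff:
  fixes f :: "'a::topological_space \<Rightarrow> ('b::topological_space)^'n"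
  shows "continuous_on S f \<longleftrightarrow> (\<forall>i. continuous_on S (\<lambda>x. f x $ i))"
  using continuous_on_vec_lambda[of S "\<lambda>i x. f x $ i"] by (auto intro: continuous_on_component)

lemma Ck_on_cong:
  assumes S: "open S"
  shows "(\<And>x. x \<in> S \<Longrightarrow> f x = g x) \<Longrightarrow> Ck_on n S f \<Longrightarrow> Ck_on n S g"
proof (induction n arbitrary: f g)
  case 0
  then show ?case using continuous_on_cong[of S S f g] by simp
next
  case (Suc n)
  have der: "(g has_derivative frechet_derivative f (at x)) (at x)" if "x \<in> S" for x
  proof -
    have "(f has_derivative frechet_derivative f (at x)) (at x)"
      using Suc.prems(2) that by (simp add: frechet_derivative_works)
    then show ?thesis
      by (rule has_derivative_transform_within_open[OF _ S that]) (use Suc.prems in auto)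
  qed
  then have eq: "frechet_derivative f (at x) = frechet_derivative g (at x)" if "x \<in> S" for x
    using frechet_derivative_at[OF der[OF that]] by simp
  have "Ck_on n S (\<lambda>x. frechet_derivative g (at x) v)" for v
    by (rule Suc.IH[of "\<lambda>x. frechet_derivative f (at x) v"]) (use Suc.prems eq in auto)
  then show ?case
    using der by (auto simp: differentiable_def)
qed

lemma Ck_on_componentI:
  fixes f :: "'a::euclidean_space \<Rightarrow> real^'n"
  assumes S: "open S"
  shows "(\<And>i. Ck_on n S (\<lambda>x. f x $ i)) \<Longrightarrow> Ck_on n S f"
proof (induction n arbitrary: f)
  case 0
  then show ?case by (simp add: continuous_on_vec_iff)
next
  case (Suc n)
  let ?f' = "\<lambda>x v. \<chi> i. frechet_derivative (\<lambda>y. f y $ i) (at x) v"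
  have der: "(f has_derivative ?f' x) (at x)" if "x \<in> S" for x
  proof -
    have "((\<lambda>y. f y $ i) has_derivative (\<lambda>v. ?f' x v $ i)) (at x)" for i
      using Suc.prems[of i] that by (simp add: frechet_derivative_works)
    then show ?thesis
      by (subst has_derivative_componentwise_within) (auto simp: Basis_vec_axis inner_axis)
  qed
  have eq: "frechet_derivative f (at x) = ?f' x" if "x \<in> S" for x
    using frechet_derivative_at[OF der[OF that]] by simp
  have "Ck_on n S (\<lambda>x. frechet_derivative f (at x) v)" for v
  proof (rule Ck_on_cong[OF S, of "\<lambda>x. ?f' x v"])
    show "Ck_on n S (\<lambda>x. ?f' x v)"
      by (rule Suc.IH) (use Suc.prems in simp)
  qed (simp add: eq)
  then show ?case
    using der by (auto simp: differentiable_def)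
qed

lemma smooth_on_component:
  fixes f :: "'a::euclidean_space \<Rightarrow> real^'n"
  assumes S: "open S" and f: "smooth_on S f"
  shows "smooth_on S (\<lambda>x. f x $ i)"
proof -
  have "Ck_on n S f \<Longrightarrow> Ck_on n S (\<lambda>x. f x $ i)" for n
  proof (induction n arbitrary: f)
    case 0
    then show ?case by (simp add: continuous_on_vec_iff)
  next
    case (Suc n)
    have der: "((\<lambda>y. f y $ i) has_derivative (\<lambda>v. frechet_derivative f (at x) v $ i)) (at x)" if "x \<in> S" for x
      using Suc.prems that
      by (auto simp: frechet_derivative_works intro: bounded_linear.has_derivative[OF bounded_linear_vec_nth])
    have eq: "frechet_derivative (\<lambda>y. f y $ i) (at x) = (\<lambda>v. frechet_derivative f (at x) v $ i)" if "x \<in> S" for x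
      using frechet_derivative_at[OF der[OF that]] by simp
    have "Ck_on n S (\<lambda>x. frechet_derivative (\<lambda>y. f y $ i) (at x) v)" for v
      by (rule Ck_on_cong[OF S, of "\<lambda>x. frechet_derivative f (at x) v $ i"])
         (use Suc.prems in \<open>auto simp: eq intro: Suc.IH\<close>)
    then show ?case
      using der by (auto simp: differentiable_def)
  qed
  then show ?thesis using f by (simp add: smooth_on_def)
qed

lemma smooth_on_imp_differentiable: "smooth_on S f \<Longrightarrow> x \<in> S \<Longrightarrow> f differentiable (at x)"
  unfolding smooth_on_def by (metis Ck_on.simps(2))

lemma smooth_on_imp_continuous_on: "smooth_on S f \<Longrightarrow> continuous_on S f"
  unfolding smooth_on_def by (metis Ck_on.simps(1))

lemma smooth_on_frechet_derivative: "smooth_on S f \<Longrightarrow> smooth_on S (\<lambda>x. frechet_derivative f (at x) v)"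
  unfolding smooth_on_def by (metis Ck_on.simps(2))

lemma linear_eq_sum_axis:
  fixes f :: "real^'n \<Rightarrow> 'b::real_vector"
  assumes "linear f"
  shows "f v = (\<Sum>i\<in>UNIV. v $ i *\<^sub>R f (axis i 1))"
proof -
  have "v = (\<Sum>i\<in>UNIV. v $ i *\<^sub>R axis i 1)"
    using basis_expansion[of v] by (simp add: scalar_mult_eq_scaleR)
  then have "f v = f (\<Sum>i\<in>UNIV. v $ i *\<^sub>R axis i 1)" by simp
  then show ?thesis
    using assms by (simp add: linear_sum linear_cmul)
qed

text \<open>Smoothness by coinduction: a class of differentiable functions that contains all directional derivatives
  of its members consists of smooth functions.\<close>

lemma smooth_coinduct:
  fixes C :: "('a::euclidean_space \<Rightarrow> real) \<Rightarrow> bool"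
  assumes U: "open U"
    and C: "\<And>f. C f \<Longrightarrow> \<exists>f'. (\<forall>x\<in>U. (f has_derivative f' x) (at x)) \<and> (\<forall>v. C (\<lambda>x. f' x v))"
  shows "C f \<Longrightarrow> smooth_on U f"
proof -
  have "C f \<Longrightarrow> Ck_on n U f" for n
  proof (induction n arbitrary: f)
    case 0
    then show ?case
      using C by (metis Ck_on.simps(1) continuous_at_imp_continuous_on has_derivative_continuous)
  next
    case (Suc n)
    obtain f' where f': "\<And>x. x \<in> U \<Longrightarrow> (f has_derivative f' x) (at x)" "\<And>v. C (\<lambda>x. f' x v)"
      using C[OF Suc.prems] by blast
    have "Ck_on n U (\<lambda>x. frechet_derivative f (at x) v)" for v
      by (rule Ck_on_cong[OF U _ Suc.IH[OF f'(2)[of v]]]) (metis f'(1) frechet_derivative_at)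
    then show ?case
      using f'(1) by (auto simp: differentiable_def)
  qed
  then show "C f \<Longrightarrow> smooth_on U f" by (simp add: smooth_on_def)
qed

text \<open>The functions obtained from compositions of smooth functions with \<open>\<phi>\<close> by ring operations and reciprocals.
  If the partial derivatives of \<open>\<phi>\<close> belong to this algebra, it is closed under differentiation, by the rules of
  calculus, and hence consists of smooth functions. Since \<open>\<phi>\<close> will solve a differential equation
  \<open>\<phi>' = g \<circ> \<phi>\<close> with smooth \<open>g\<close>, this gives all its derivatives at once.\<close>

inductive smooth_algebra :: "'a set \<Rightarrow> ('a \<Rightarrow> real^'d) \<Rightarrow> ('a \<Rightarrow> real) \<Rightarrow> bool" for U \<phi> where
  comp: "smooth_on UNIV G \<Longrightarrow> smooth_algebra U \<phi> (\<lambda>x. G (\<phi> x))"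
| const: "smooth_algebra U \<phi> (\<lambda>_. c)"
| add: "smooth_algebra U \<phi> f \<Longrightarrow> smooth_algebra U \<phi> g \<Longrightarrow> smooth_algebra U \<phi> (\<lambda>x. f x + g x)"
| mult: "smooth_algebra U \<phi> f \<Longrightarrow> smooth_algebra U \<phi> g \<Longrightarrow> smooth_algebra U \<phi> (\<lambda>x. f x * g x)"
| recip: "smooth_algebra U \<phi> f \<Longrightarrow> (\<And>x. x \<in> U \<Longrightarrow> f x \<noteq> 0) \<Longrightarrow> smooth_algebra U \<phi> (\<lambda>x. 1 / f x)"

lemma smooth_algebra_sum:
  "(\<And>i. i \<in> I \<Longrightarrow> smooth_algebra U \<phi> (f i)) \<Longrightarrow> smooth_algebra U \<phi> (\<lambda>x. \<Sum>i\<in>I. f i x)"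
  by (induction I rule: infinite_finite_induct) (auto intro: smooth_algebra.intros)

lemma smooth_algebra_prod:
  "(\<And>i. i \<in> I \<Longrightarrow> smooth_algebra U \<phi> (f i)) \<Longrightarrow> smooth_algebra U \<phi> (\<lambda>x. \<Prod>i\<in>I. f i x)"
  by (induction I rule: infinite_finite_induct) (auto intro: smooth_algebra.intros)

lemma smooth_algebra_det:
  "(\<And>i j. smooth_algebra U \<phi> (\<lambda>x. A x $ i $ j)) \<Longrightarrow> smooth_algebra U \<phi> (\<lambda>x. det (A x))"
  unfolding det_def
  by (intro smooth_algebra_sum smooth_algebra.mult smooth_algebra.const smooth_algebra_prod)

lemma smooth_algebra_derivative:
  fixes U :: "'a::euclidean_space set" and \<phi> :: "'a \<Rightarrow> real^'d"
  assumes \<phi>': "\<And>x. x \<in> U \<Longrightarrow> (\<phi> has_derivative \<phi>' x) (at x)"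
    and alg: "\<And>v i. smooth_algebra U \<phi> (\<lambda>x. \<phi>' x v $ i)"
  shows "smooth_algebra U \<phi> f \<Longrightarrow>
    \<exists>f'. (\<forall>x\<in>U. (f has_derivative f' x) (at x)) \<and> (\<forall>v. smooth_algebra U \<phi> (\<lambda>x. f' x v))"
proof (induction rule: smooth_algebra.induct)
  case (comp G)
  let ?G' = "\<lambda>i q. frechet_derivative G (at q) (axis i 1)"
  have G': "(G has_derivative frechet_derivative G (at q)) (at q)" for q
    using comp by (simp add: frechet_derivative_works[symmetric] smooth_on_imp_differentiable)
  have "((\<lambda>x. G (\<phi> x)) has_derivative (\<lambda>v. \<Sum>i\<in>UNIV. ?G' i (\<phi> x) * \<phi>' x v $ i)) (at x)" if "x \<in> U" for x
  proof -
    have "((\<lambda>x. G (\<phi> x)) has_derivative (\<lambda>v. frechet_derivative G (at (\<phi> x)) (\<phi>' x v))) (at x)"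
      using diff_chain_at[OF \<phi>'[OF that] G'] by (simp add: o_def)
    then show ?thesis
      by (subst (asm) linear_eq_sum_axis[OF has_derivative_linear[OF G']]) (simp add: mult.commute)
  qed
  moreover have "smooth_algebra U \<phi> (\<lambda>x. \<Sum>i\<in>UNIV. ?G' i (\<phi> x) * \<phi>' x v $ i)" for v
    by (intro smooth_algebra_sum smooth_algebra.mult alg smooth_algebra.comp[of "?G' i" for i]
        smooth_on_frechet_derivative comp)
  ultimately show ?case
    by (intro exI[of _ "\<lambda>x v. \<Sum>i\<in>UNIV. ?G' i (\<phi> x) * \<phi>' x v $ i"]) auto
next
  case (const c)
  show ?case
    by (intro exI[of _ "\<lambda>x v. 0"]) (auto intro: smooth_algebra.const)
next
  case (add f g)
  then obtain f' g' where "\<forall>x\<in>U. (f has_derivative f' x) (at x)" "\<forall>v. smooth_algebra U \<phi> (\<lambda>x. f' x v)"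
    "\<forall>x\<in>U. (g has_derivative g' x) (at x)" "\<forall>v. smooth_algebra U \<phi> (\<lambda>x. g' x v)" by blast
  then show ?case
    by (intro exI[of _ "\<lambda>x v. f' x v + g' x v"])
       (auto intro!: has_derivative_add smooth_algebra.add)
next
  case (mult f g)
  then obtain f' g' where "\<forall>x\<in>U. (f has_derivative f' x) (at x)" "\<forall>v. smooth_algebra U \<phi> (\<lambda>x. f' x v)"
    "\<forall>x\<in>U. (g has_derivative g' x) (at x)" "\<forall>v. smooth_algebra U \<phi> (\<lambda>x. g' x v)" by blast
  with mult.hyps show ?case
    by (intro exI[of _ "\<lambda>x v. f x * g' x v + f' x v * g x"])
       (auto intro!: has_derivative_mult smooth_algebra.add smooth_algebra.mult)
next
  case (recip f)
  then obtain f' where f': "\<forall>x\<in>U. (f has_derivative f' x) (at x)" "\<forall>v. smooth_algebra U \<phi> (\<lambda>x. f' x v)"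
    by blast
  have "((\<lambda>x. 1 / f x) has_derivative (\<lambda>v. (- 1) * (f' x v * ((1 / f x) * (1 / f x))))) (at x)" if "x \<in> U" for x
  proof -
    have "((\<lambda>x. inverse (f x)) has_derivative (\<lambda>v. - (inverse (f x) * f' x v * inverse (f x)))) (at x)"
      using f' that recip.hyps by (intro Deriv.has_derivative_inverse) auto
    then show ?thesis by (simp add: divide_inverse mult_ac)
  qed
  moreover have "smooth_algebra U \<phi> (\<lambda>x. (- 1) * (f' x v * ((1 / f x) * (1 / f x))))" for v
    using f' recip.hyps by (intro smooth_algebra.mult smooth_algebra.const smooth_algebra.recip) auto
  ultimately show ?case
    by (intro exI[of _ "\<lambda>x v. (- 1) * (f' x v * ((1 / f x) * (1 / f x)))"]) auto
qed

lemma smooth_on_nth: "smooth_on UNIV (\<lambda>q::real^'d. q $ i)"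
proof -
  have C: "Ck_on n UNIV (\<lambda>_::real^'d. c::real)" for n c
    by (induction n arbitrary: c) auto
  have D: "frechet_derivative (\<lambda>q::real^'d. q $ i) (at x) = (\<lambda>v. v $ i)" for x
    by (rule frechet_derivative_at[symmetric]) (rule bounded_linear_imp_has_derivative[OF bounded_linear_vec_nth])
  have "Ck_on n UNIV (\<lambda>q::real^'d. q $ i)" for n
  proof (cases n)
    case (Suc k)
    have "(\<lambda>q::real^'d. q $ i) differentiable (at x)" for x
      by (rule bounded_linear_imp_differentiable[OF bounded_linear_vec_nth])
    then show ?thesis using C by (simp add: Suc D)
  qed (auto intro: continuous_intros)
  then show ?thesis by (simp add: smooth_on_def)
qed

subsection \<open>The constraint gradients\<close>

lemma nabla_nth: "nabla \<xi> q $ i $ j = frechet_derivative (\<lambda>x. \<xi> x $ j) (at q) (axis i 1)"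
  by (simp add: nabla_def grad_def)

lemma smooth_on_nabla:
  assumes "smooth_on UNIV \<xi>"
  shows "smooth_on UNIV (\<lambda>q. nabla \<xi> q $ i $ j)"
  unfolding nabla_nth using assms by (intro smooth_on_frechet_derivative smooth_on_component) auto

lemma continuous_on_nabla:
  assumes "smooth_on UNIV \<xi>"
  shows "continuous_on UNIV (nabla \<xi>)"
  using smooth_on_imp_continuous_on[OF smooth_on_nabla[OF assms]] by (simp add: continuous_on_vec_iff)

lemma continuous_on_grad:
  assumes "smooth_on UNIV V"
  shows "continuous_on UNIV (grad V)"
  unfolding continuous_on_vec_iff grad_def
  using smooth_on_imp_continuous_on[OF smooth_on_frechet_derivative[OF assms]] by simp

lemma has_derivative_nabla:
  assumes "smooth_on UNIV \<xi>"
  shows "(\<xi> has_derivative (\<lambda>v. transpose (nabla \<xi> q) *v v)) (at q)"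
proof -
  let ?D = "frechet_derivative \<xi> (at q)"
  have D: "(\<xi> has_derivative ?D) (at q)"
    using assms by (simp add: frechet_derivative_works[symmetric] smooth_on_imp_differentiable)
  have "?D (axis i 1) $ j = nabla \<xi> q $ i $ j" for i j
  proof -
    have "((\<lambda>x. \<xi> x $ j) has_derivative (\<lambda>v. ?D v $ j)) (at q)"
      using D by (rule bounded_linear.has_derivative[OF bounded_linear_vec_nth])
    then show ?thesis unfolding nabla_nth by (metis frechet_derivative_at)
  qed
  then have "?D v = transpose (nabla \<xi> q) *v v" for v
    by (subst linear_eq_sum_axis[OF has_derivative_linear[OF D]])
       (simp add: vec_eq_iff matrix_vector_mult_def transpose_def mult.commute)
  with D show ?thesis by (metis (no_types, lifting) ext)
qed

subsection \<open>Charts\<close>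

lemma orthonormal_frame_exists:
  fixes S :: "(real^'d) set"
  assumes S: "subspace S" and dim: "dim S = CARD('k)"
  obtains B :: "real^'k^'d" where "range ((*v) B) = S" "transpose B ** B = mat 1"
proof -
  obtain T where T: "T \<subseteq> S" "pairwise orthogonal T" "\<And>x. x \<in> T \<Longrightarrow> norm x = 1" "independent T"
      "card T = dim S" "span T = S"
    using orthonormal_basis_subspace[OF S] by blast
  have "finite T" using T(4) by (rule independent_imp_finite)
  then obtain b :: "'k \<Rightarrow> real^'d" where b: "bij_betw b UNIV T"
    using finite_same_card_bij[of "UNIV :: 'k set" T] T(5) dim by auto
  define B :: "real^'k^'d" where "B = (\<chi> i j. b j $ i)"
  have col: "column j B = b j" for j
    by (simp add: column_def B_def vec_eq_iff)
  have "b i \<bullet> b j = (if i = j then 1 else 0)" for i j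
  proof -
    have "b i \<in> T" "b j \<in> T" "b i = b j \<longleftrightarrow> i = j" using b by (auto simp: bij_betw_def inj_on_def)
    then show ?thesis using T(2,3) by (auto simp: pairwise_def orthogonal_def norm_eq_1)
  qed
  then have "transpose B ** B = mat 1"
    by (simp add: matrix_mult_transpose_dot_column col mat_def vec_eq_iff)
  moreover have "columns B = T"
    using b by (auto simp: columns_def col bij_betw_def)
  then have "range ((*v) B) = S"
    using T(6) linear_span_image[OF matrix_vector_mul_linear, of B Basis]
    by (simp add: columns_image_basis Basis_vec_axis[symmetric])
  ultimately show thesis using that by blast
qed

lemma dim_kernel_transpose:
  fixes A :: "real^'m^'d"
  assumes inj: "inj ((*v) A)"
  shows "subspace {v. transpose A *v v = 0}" "dim {v. transpose A *v v = 0} + CARD('m) = CARD('d)"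
proof -
  let ?N = "{v. transpose A *v v = 0}"
  show "subspace ?N"
    by (auto simp: subspace_def matrix_vector_right_distrib matrix_vector_mult_scaleR)
  have R: "subspace (range ((*v) A))"
    by (rule linear_subspace_image[OF matrix_vector_mul_linear subspace_UNIV])
  have N: "?N = {v. \<forall>w\<in>range ((*v) A). orthogonal w v}"
  proof -
    have "transpose A *v v = 0 \<longleftrightarrow> (\<forall>y. (A *v y) \<bullet> v = 0)" for v
      by (metis inner_commute inner_matrix_transpose inner_zero_left inner_eq_zero_iff)
    then show ?thesis by (auto simp: orthogonal_def)
  qed
  have "dim (range ((*v) A)) = CARD('m)"
    using dim_image_eq[OF matrix_vector_mul_linear, of A UNIV] inj by (simp add: span_UNIV)
  moreover have "dim {v \<in> UNIV. \<forall>w\<in>range ((*v) A). orthogonal w v} + dim (range ((*v) A)) = dim (UNIV :: (real^'d) set)"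
    by (rule dim_subspace_orthogonal_to_vectors[OF R subspace_UNIV subset_UNIV])
  ultimately show "dim ?N + CARD('m) = CARD('d)"
    unfolding N by simp
qed

lemma gram_invertible_imp_inj:
  assumes "invertible (gram M \<xi> q)"
  shows "inj ((*v) (nabla \<xi> q))"
  using inj_matrix_vector_mult[OF assms]
  by (auto simp: gram_def inj_on_def matrix_vector_mul_assoc[symmetric])

text \<open>Let the columns of \<open>B\<close> be an orthonormal basis of the tangent space at \<open>q0\<close>. The map \<open>F\<close> below is a local
  diffeomorphism at \<open>q0\<close>, and on the level set it equals \<open>B B\<^sup>T q\<close>; so \<open>\<phi> x = F\<^sup>-\<^sup>1(B x)\<close> is a chart with the
  linear inverse \<open>B\<^sup>T\<close>. Its derivative solves \<open>DF(\<phi> x) \<phi>' = B\<close>, and by Cramer's rule the solution is in the smooth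
  algebra of \<open>\<phi>\<close>. Linearity of the inverse is what makes the changes of charts easy to differentiate
  later on.\<close>

proposition level_set_chart:
  fixes \<xi> :: "real^'d \<Rightarrow> real^'m"
  assumes \<xi>: "smooth_on UNIV \<xi>" and q0: "q0 \<in> level_set \<xi>"
    and inj: "inj ((*v) (nabla \<xi> q0))" and dim: "CARD('k) + CARD('m) = CARD('d)"
  obtains U :: "(real^'k) set" and \<phi> and L :: "real^'d^'k" and W
  where "local_parametrization (level_set \<xi>) U \<phi>" "open W" "q0 \<in> W" "\<phi> ` U = level_set \<xi> \<inter> W"
    "\<And>x. x \<in> U \<Longrightarrow> L *v \<phi> x = x"
proof -
  let ?S = "level_set \<xi>"
  define A where "A = nabla \<xi> q0"
  have "dim {v. transpose A *v v = 0} = CARD('k)"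
    using dim_kernel_transpose(2)[OF inj] dim by (simp add: A_def)
  then obtain B :: "real^'k^'d" where B: "range ((*v) B) = {v. transpose A *v v = 0}" "transpose B ** B = mat 1"
    using orthonormal_frame_exists dim_kernel_transpose(1)[OF inj, folded A_def] by metis
  have BB: "transpose B *v (B *v x) = x" for x
    by (simp add: matrix_vector_mul_assoc B(2))
  have AB: "transpose A *v (B *v x) = 0" for x
    using B(1) by blast
  \<comment> \<open>the tangential part of \<open>q\<close>, with the constraint values in the normal directions\<close>
  define F where "F q = B *v (transpose B *v q) + A *v \<xi> q" for q
  define DF where "DF q = B ** transpose B + A ** transpose (nabla \<xi> q)" for q
  have F': "(F has_derivative (*v) (DF q)) (at q)" for q
  proof -
    have "(F has_derivative (\<lambda>v. B *v (transpose B *v v) + A *v (transpose (nabla \<xi> q) *v v))) (at q)"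
      unfolding F_def
      by (intro has_derivative_add bounded_linear.has_derivative[OF matrix_vector_mul_bounded_linear]
          has_derivative_nabla \<xi> has_derivative_ident)
    moreover have "(*v) (DF q) = (\<lambda>v. B *v (transpose B *v v) + A *v (transpose (nabla \<xi> q) *v v))"
      by (simp add: fun_eq_iff DF_def matrix_vector_mult_add_rdistrib matrix_vector_mul_assoc)
    ultimately show ?thesis by simp
  qed
  have DF_cont: "continuous_on UNIV DF"
    unfolding DF_def by (intro continuous_intros continuous_on_nabla \<xi>)
  define f' where "f' q = Blinfun ((*v) (DF q))" for q
  have f'_apply: "blinfun_apply (f' q) = (*v) (DF q)" for q
    unfolding f'_def by (rule bounded_linear_Blinfun_apply) (rule matrix_vector_mul_bounded_linear)
  have f'_der: "(F has_derivative blinfun_apply (f' q)) (at q)" for q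
    unfolding f'_apply by (rule F')
  have f'_cont: "continuous_on UNIV f'"
    by (rule continuous_on_blinfun_componentwise) (auto simp: f'_apply intro!: continuous_intros DF_cont)
  have "invertible (DF q0)"
  proof (rule invertible_injI)
    fix v assume "DF q0 *v v = 0"
    then have "0 = v \<bullet> (DF q0 *v v)" by simp
    also have "\<dots> = (transpose B *v v) \<bullet> (transpose B *v v) + (transpose A *v v) \<bullet> (transpose A *v v)"
      by (simp add: DF_def A_def[symmetric] matrix_vector_mult_add_rdistrib matrix_vector_mul_assoc[symmetric]
          inner_add_right inner_matrix_transpose)
    finally have "transpose B *v v = 0 \<and> transpose A *v v = 0"
      using inner_ge_zero[of "transpose B *v v"] inner_ge_zero[of "transpose A *v v"]
      by (simp add: add_nonneg_eq_0_iff)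
    then have "transpose B *v v = 0" "transpose A *v v = 0" by auto
    then obtain y where "v = B *v y" using B(1) by blast
    with \<open>transpose B *v v = 0\<close> show "v = 0" by (simp add: BB)
  qed
  then have inv_id: "Blinfun ((*v) (matrix_inv (DF q0))) o\<^sub>L f' q0 = id_blinfun"
    by (intro blinfun_eqI) (simp add: f'_apply bounded_linear_Blinfun_apply)
  obtain U' V g g' where *: "open U'" "q0 \<in> U'" "open V" "F q0 \<in> V" "homeomorphism U' V F g"
    "\<And>y. y \<in> V \<Longrightarrow> (g has_derivative g' y) (at y)"
    "\<And>y. y \<in> V \<Longrightarrow> g' y = inv (blinfun_apply (f' (g y)))"
    "\<And>y. y \<in> V \<Longrightarrow> bij (blinfun_apply (f' (g y)))"
    by (rule inverse_function_theorem[OF open_UNIV f'_der f'_cont UNIV_I inv_id]) (rule that)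
  define U where "U = (*v) B -` V"
  define \<phi> where "\<phi> x = g (B *v x)" for x
  have "continuous_on UNIV ((*v) B)" by (intro continuous_intros)
  then have openU: "open U"
    unfolding U_def using open_vimage[OF *(3)] by blast
  have UV: "x \<in> U \<longleftrightarrow> B *v x \<in> V" for x
    by (simp add: U_def)
  have F\<phi>: "F (\<phi> x) = B *v x" if "x \<in> U" for x
    using *(5) that by (simp add: \<phi>_def UV homeomorphism_def)
  have AA: "A *v z = 0 \<Longrightarrow> z = 0" for z
    using inj by (metis A_def injD matrix_vector_mult_0_right)
  have \<phi>S: "\<xi> (\<phi> x) = 0" and L\<phi>: "transpose B *v \<phi> x = x" if "x \<in> U" for x
  proof -
    have "transpose A *v F (\<phi> x) = transpose A *v (A *v \<xi> (\<phi> x))"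
      by (simp add: F_def matrix_vector_right_distrib AB)
    then have "(A *v \<xi> (\<phi> x)) \<bullet> (A *v \<xi> (\<phi> x)) = 0"
      by (simp add: F\<phi>[OF that] AB inner_matrix_transpose)
    then show 0: "\<xi> (\<phi> x) = 0" using AA by simp
    have "transpose B *v F (\<phi> x) = x"
      by (simp add: F\<phi>[OF that] BB)
    then show "transpose B *v \<phi> x = x"
      by (simp add: F_def 0 matrix_vector_right_distrib BB)
  qed
  have im: "\<phi> ` U = ?S \<inter> U'"
  proof (intro subset_antisym subsetI)
    fix q assume "q \<in> \<phi> ` U"
    then show "q \<in> ?S \<inter> U'"
      using \<phi>S *(5) by (auto simp: level_set_def \<phi>_def UV homeomorphism_def)
  next
    fix q assume q: "q \<in> ?S \<inter> U'"
    then have Fq: "F q = B *v (transpose B *v q)" by (simp add: F_def level_set_def)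
    moreover have "F q \<in> V" "g (F q) = q" using q *(5) by (auto simp: homeomorphism_def)
    ultimately show "q \<in> \<phi> ` U"
      by (intro image_eqI[of _ _ "transpose B *v q"]) (auto simp: \<phi>_def UV)
  qed
  have cont\<phi>: "continuous_on U \<phi>"
    unfolding \<phi>_def using *(5)
    by (intro continuous_on_compose2[of V g U "\<lambda>x. B *v x"] continuous_intros) (auto simp: homeomorphism_def UV)
  have hom: "homeomorphism U (\<phi> ` U) \<phi> ((*v) (transpose B))"
    using cont\<phi> L\<phi> by (auto simp: homeomorphism_def image_image intro!: continuous_intros)
  have detF: "det (DF (\<phi> x)) \<noteq> 0" if "x \<in> U" for x
    using *(8) that by (simp add: \<phi>_def UV f'_apply invertible_eq_bij[symmetric] invertible_det_nz)
  define \<phi>' where "\<phi>' x v = (\<chi> k. det (\<chi> i j. if j = k then (B *v v) $ i else DF (\<phi> x) $ i $ j) * (1 / det (DF (\<phi> x))))" for x v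
  have \<phi>': "(\<phi> has_derivative \<phi>' x) (at x)" if x: "x \<in> U" for x
  proof -
    have "(\<phi> has_derivative (\<lambda>v. g' (B *v x) (B *v v))) (at x)"
      unfolding \<phi>_def using *(6) x
      by (intro has_derivative_compose[of "\<lambda>x. B *v x", where g = g] bounded_linear_imp_has_derivative
          matrix_vector_mul_bounded_linear) (auto simp: UV)
    moreover have "g' (B *v x) (B *v v) = \<phi>' x v" for v
    proof -
      have "DF (\<phi> x) *v g' (B *v x) (B *v v) = B *v v"
        using *(7,8)[of "B *v x"] x by (simp add: UV f'_apply \<phi>_def bij_is_surj surj_f_inv_f)
      then show ?thesis
        using detF[OF x] by (simp add: cramer \<phi>'_def)
    qed
    ultimately show ?thesis by simp
  qed
  have algDF: "smooth_algebra U \<phi> (\<lambda>x. DF (\<phi> x) $ i $ j)" for i j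
    unfolding DF_def
    by (simp add: matrix_matrix_mult_def transpose_def)
       (intro smooth_algebra.add smooth_algebra_sum smooth_algebra.mult smooth_algebra.const
         smooth_algebra.comp[of "\<lambda>q. nabla \<xi> q $ a $ b" for a b] smooth_on_nabla \<xi>)
  have alg: "smooth_algebra U \<phi> (\<lambda>x. \<phi>' x v $ k)" for v k
  proof -
    have ent: "smooth_algebra U \<phi> (\<lambda>x. (\<chi> i j. if j = k then (B *v v) $ i else DF (\<phi> x) $ i $ j) $ i $ j)" for i j
      by (cases "j = k") (auto intro: algDF smooth_algebra.const)
    have "smooth_algebra U \<phi> (\<lambda>x. det (\<chi> i j. if j = k then (B *v v) $ i else DF (\<phi> x) $ i $ j))"
      by (rule smooth_algebra_det) (rule ent)
    then have "smooth_algebra U \<phi> (\<lambda>x. det (\<chi> i j. if j = k then (B *v v) $ i else DF (\<phi> x) $ i $ j) * (1 / det (DF (\<phi> x))))"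
      by (rule smooth_algebra.mult) (intro smooth_algebra.recip smooth_algebra_det algDF detF)
    then show ?thesis
      by (simp only: \<phi>'_def vec_lambda_beta)
  qed
  have "smooth_on U (\<lambda>x. \<phi> x $ i)" for i
  proof (rule smooth_coinduct[where C = "smooth_algebra U \<phi>", OF openU])
    show "smooth_algebra U \<phi> (\<lambda>x. \<phi> x $ i)"
      by (rule smooth_algebra.comp[OF smooth_on_nth])
  qed (rule smooth_algebra_derivative[OF \<phi>' alg])
  then have smooth: "smooth_on U \<phi>"
    unfolding smooth_on_def by (blast intro: Ck_on_componentI[OF openU])
  have "inj (frechet_derivative \<phi> (at x))" if x: "x \<in> U" for x
  proof -
    have "((\<lambda>x. transpose B *v \<phi> x) has_derivative (\<lambda>v. transpose B *v \<phi>' x v)) (at x)"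
      by (rule bounded_linear.has_derivative[OF matrix_vector_mul_bounded_linear \<phi>'[OF x]])
    then have "((\<lambda>x. x) has_derivative (\<lambda>v. transpose B *v \<phi>' x v)) (at x)"
      by (rule has_derivative_transform_within_open[OF _ openU x]) (rule L\<phi>)
    then have "(\<lambda>v. transpose B *v \<phi>' x v) = (\<lambda>v. v)"
      using has_derivative_unique[OF _ has_derivative_ident] by blast
    then have "inj (\<phi>' x)"
      by (metis inj_on_inverseI)
    then show ?thesis
      using frechet_derivative_at[OF \<phi>'[OF x]] by simp
  qed
  moreover have "openin (top_of_set ?S) (\<phi> ` U)"
    unfolding im using *(1) by (simp add: openin_open_Int)
  ultimately have "local_parametrization ?S U \<phi>"
    unfolding local_parametrization_def using openU smooth hom by blast
  then show thesis
    using that[of U \<phi> U' "transpose B"] *(1,2) im L\<phi> by blast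
qed

section \<open>The Riemannian measure of the constraint manifold\<close>

lemma Ck_on_empty: "Ck_on n {} f"
  by (induction n arbitrary: f) auto

lemma local_parametrizationD:
  fixes \<phi> :: "real^'k \<Rightarrow> real^'d"
  assumes "local_parametrization S U \<phi>"
  shows "open U" "continuous_on U \<phi>" "inj_on \<phi> U" "\<phi> ` U \<subseteq> S"
    "x \<in> U \<Longrightarrow> (\<phi> has_derivative (*v) (jacobian \<phi> (at x))) (at x)"
    "x \<in> U \<Longrightarrow> inj ((*v) (jacobian \<phi> (at x)))"
    "continuous_on U (\<lambda>x. jacobian \<phi> (at x))"
proof -
  have U: "open U" "smooth_on U \<phi>" "\<forall>x\<in>U. inj (frechet_derivative \<phi> (at x))"
      "openin (top_of_set S) (\<phi> ` U)" and hom: "\<exists>\<psi>. homeomorphism U (\<phi> ` U) \<phi> \<psi>"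
    using assms by (auto simp: local_parametrization_def)
  show "open U" "continuous_on U \<phi>" "\<phi> ` U \<subseteq> S"
    using U hom by (auto simp: homeomorphism_def dest: openin_imp_subset)
  show "inj_on \<phi> U"
    using hom by (auto simp: homeomorphism_def intro: inj_on_inverseI)
  show J: "x \<in> U \<Longrightarrow> (\<phi> has_derivative (*v) (jacobian \<phi> (at x))) (at x)" for x
    using smooth_on_imp_differentiable[OF U(2)] jacobian_works by blast
  show "inj ((*v) (jacobian \<phi> (at x)))" if "x \<in> U" for x
    using U(3) frechet_derivative_at[OF J[OF that]] that by auto
  have "continuous_on U (\<lambda>x. frechet_derivative \<phi> (at x) (axis j 1) $ i)" for i j
    by (rule smooth_on_imp_continuous_on[OF smooth_on_component[OF U(1) smooth_on_frechet_derivative[OF U(2)]]])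
  then show "continuous_on U (\<lambda>x. jacobian \<phi> (at x))"
    by (simp add: continuous_on_vec_iff jacobian_def matrix_def)
qed

lemma sqrt_det_congruence:
  fixes R :: "real^'k^'k" and G :: "real^'k^'k"
  shows "sqrt (det (transpose R ** G ** R)) = \<bar>det R\<bar> * sqrt (det G)"
  by (simp add: det_mul real_sqrt_mult)

text \<open>Domain, parametrization, a linear left inverse of it, and an ambient open set that cuts out its image.\<close>

type_synonym ('k, 'd) chart_data =
  "(real^'k) set \<times> (real^'k \<Rightarrow> real^'d) \<times> (real^'d^'k) \<times> (real^'d) set"

locale constraint_manifold =
  fixes M :: "real^'d^'d" and \<xi> :: "real^'d \<Rightarrow> real^'m" and kdim :: "'k::finite itself"
  assumes spd_M: "spd M" and smooth_\<xi>: "smooth_on UNIV \<xi>"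
    and gram_inv: "\<And>q. q \<in> level_set \<xi> \<Longrightarrow> invertible (gram M \<xi> q)"
    and card_dim: "CARD('k) + CARD('m) = CARD('d)"
begin

abbreviation "S \<equiv> level_set \<xi>"
abbreviation "Minv \<equiv> matrix_inv M"
abbreviation "\<sigma> \<equiv> riemannian_measure kdim M S"

lemma spd_Minv: "spd Minv"
  by (rule spd_matrix_inv[OF spd_M])

lemma invertible_M: "invertible M"
  by (rule spd_invertible[OF spd_M])

lemma Minv_M [simp]: "Minv *v (M *v x) = x" "M *v (Minv *v x) = x"
  using invertible_M by simp_all

lemma continuous_\<xi>: "continuous_on UNIV \<xi>"
  by (rule smooth_on_imp_continuous_on[OF smooth_\<xi>])

lemma closed_S: "closed S"
  using closed_vimage[OF closed_singleton continuous_\<xi>, of 0] by (simp add: level_set_def vimage_def)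

lemma S_borel [measurable]: "S \<in> sets borel"
  using closed_S by (rule borel_closed)

lemma inj_nabla: "q \<in> S \<Longrightarrow> inj ((*v) (nabla \<xi> q))"
  by (rule gram_invertible_imp_inj[OF gram_inv])

definition tangent :: "real^'d \<Rightarrow> (real^'d) set"
  where "tangent q = {v. transpose (nabla \<xi> q) *v v = 0}"

lemma cotangent_tangent: "p \<in> cotangent_space M \<xi> q \<longleftrightarrow> Minv *v p \<in> tangent q"
  by (simp add: cotangent_space_def tangent_def)

lemma subspace_tangent: "q \<in> S \<Longrightarrow> subspace (tangent q)"
  and dim_tangent: "q \<in> S \<Longrightarrow> dim (tangent q) = CARD('k)"
  using dim_kernel_transpose[OF inj_nabla[of q]] card_dim unfolding tangent_def by auto

lemma range_jacobian:
  fixes \<phi> :: "real^'k \<Rightarrow> real^'d"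
  assumes par: "local_parametrization S U \<phi>" and x: "x \<in> U"
  shows "range ((*v) (jacobian \<phi> (at x))) = tangent (\<phi> x)"
proof -
  let ?J = "jacobian \<phi> (at x)"
  note \<phi> = local_parametrizationD[OF par]
  have \<phi>x: "\<phi> x \<in> S" using \<phi>(4) x by auto
  have "((\<lambda>x. \<xi> (\<phi> x)) has_derivative (\<lambda>v. transpose (nabla \<xi> (\<phi> x)) *v (?J *v v))) (at x)"
    using diff_chain_at[OF \<phi>(5)[OF x] has_derivative_nabla[OF smooth_\<xi>]] by (simp add: o_def)
  moreover have "((\<lambda>x. \<xi> (\<phi> x)) has_derivative (\<lambda>v. 0)) (at x)"
    by (rule has_derivative_transform_within_open[OF has_derivative_const[of 0] \<phi>(1) x])
       (use \<phi>(4) in \<open>auto simp: level_set_def\<close>)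
  ultimately have "(\<lambda>v. transpose (nabla \<xi> (\<phi> x)) *v (?J *v v)) = (\<lambda>v. 0)"
    by (rule has_derivative_unique)
  then have "range ((*v) ?J) \<subseteq> tangent (\<phi> x)"
    by (auto simp: tangent_def fun_eq_iff)
  moreover have "dim (range ((*v) ?J)) = CARD('k)"
    using dim_image_eq[OF matrix_vector_mul_linear, of ?J UNIV] \<phi>(6)[OF x] by (simp add: span_UNIV)
  moreover have "subspace (range ((*v) ?J))"
    by (rule linear_subspace_image[OF matrix_vector_mul_linear subspace_UNIV])
  ultimately show ?thesis
    using subspace_tangent[OF \<phi>x] dim_tangent[OF \<phi>x] by (intro subspace_dim_equal) auto
qed

lemma continuous_on_volume_density:
  fixes \<phi> :: "real^'k \<Rightarrow> real^'d"
  assumes "local_parametrization S U \<phi>"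
  shows "continuous_on U (volume_density M \<phi>)"
  unfolding volume_density_def[abs_def] Let_def
  by (intro continuous_intros local_parametrizationD(7)[OF assms])

subsection \<open>A countable atlas\<close>

definition chart :: "('k, 'd) chart_data \<Rightarrow> bool"
  where "chart = (\<lambda>(U, \<phi>, L, W). local_parametrization S U \<phi> \<and> open W \<and> \<phi> ` U = S \<inter> W \<and>
    (\<forall>x\<in>U. L *v \<phi> x = x))"

lemma atlas_exists: "\<exists>a :: nat \<Rightarrow> ('k, 'd) chart_data. (\<forall>i. chart (a i)) \<and> S \<subseteq> (\<Union>i. snd (snd (snd (a i))))"
proof -
  let ?N = "\<lambda>c :: ('k, 'd) chart_data. snd (snd (snd c))"
  obtain \<W> where \<W>: "\<W> \<subseteq> ?N ` Collect chart" "countable \<W>" "\<Union>\<W> = \<Union>(?N ` Collect chart)"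
    by (rule Lindelof[of "?N ` Collect chart"]) (auto simp: chart_def)
  have "chart ({}, \<lambda>_. 0, 0, {})"
    by (auto simp: chart_def local_parametrization_def smooth_on_def Ck_on_empty homeomorphism_def)
  then have ne: "insert {} \<W> \<subseteq> ?N ` Collect chart"
    using \<W>(1) by (auto simp: image_iff)
  define w where "w = from_nat_into (insert {} \<W>)"
  have w: "range w = insert {} \<W>"
    unfolding w_def using \<W>(2) by (intro range_from_nat_into) auto
  have "\<exists>c. chart c \<and> ?N c = w i" for i
    using w ne by (metis (mono_tags, lifting) image_iff mem_Collect_eq rangeI subset_iff)
  then obtain a where a: "\<And>i. chart (a i)" "\<And>i. ?N (a i) = w i" by metis
  have "S \<subseteq> \<Union>\<W>"
    unfolding \<W>(3)
  proof
    fix q assume q: "q \<in> S"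
    obtain U :: "(real^'k) set" and \<phi> L W where "local_parametrization S U \<phi>" "open W" "q \<in> W" "\<phi> ` U = S \<inter> W"
        "\<And>x. x \<in> U \<Longrightarrow> L *v \<phi> x = x"
      using level_set_chart[OF smooth_\<xi> q inj_nabla[OF q] card_dim] by metis
    then have "chart (U, \<phi>, L, W)" "q \<in> W" by (auto simp: chart_def)
    then show "q \<in> \<Union>(?N ` Collect chart)" by force
  qed
  also have "\<Union>\<W> \<subseteq> (\<Union>i. ?N (a i))"
    unfolding a(2) using w by auto
  finally show ?thesis using a(1) by blast
qed

definition atlas :: "nat \<Rightarrow> ('k, 'd) chart_data"
  where "atlas = (SOME a. (\<forall>i. chart (a i)) \<and> S \<subseteq> (\<Union>i. snd (snd (snd (a i)))))"

definition "cdom i = fst (atlas i)"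
definition "par i = fst (snd (atlas i))"
definition "lin i = fst (snd (snd (atlas i)))"
definition "nbh i = snd (snd (snd (atlas i)))"

lemma par: "local_parametrization S (cdom i) (par i)"
  and open_nbh: "open (nbh i)"
  and par_image: "par i ` cdom i = S \<inter> nbh i"
  and lin_par: "x \<in> cdom i \<Longrightarrow> lin i *v par i x = x"
  and nbh_cover: "S \<subseteq> (\<Union>i. nbh i)"
  using someI_ex[OF atlas_exists, folded atlas_def]
  by (auto simp: chart_def cdom_def par_def lin_def nbh_def split_beta)

text \<open>Charts overlap. To integrate chart by chart, the manifold is partitioned into Borel cells, each inside
  the image of one chart.\<close>

definition idx :: "real^'d \<Rightarrow> nat" where "idx q = (LEAST i. q \<in> nbh i)"

definition cell :: "nat \<Rightarrow> (real^'d) set" where "cell i = {q \<in> S. idx q = i}"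

definition cell_dom :: "nat \<Rightarrow> (real^'k) set" where "cell_dom i = {x \<in> cdom i. par i x \<in> cell i}"

lemma idx_nbh: "q \<in> S \<Longrightarrow> q \<in> nbh (idx q)"
  unfolding idx_def using nbh_cover by (metis LeastI UN_iff subset_iff)

lemma cell_borel [measurable]: "cell i \<in> sets borel"
proof -
  have "cell i = S \<inter> (nbh i - (\<Union>j<i. nbh j))"
  proof (intro set_eqI iffI)
    fix q assume "q \<in> cell i"
    then have q: "q \<in> S" "idx q = i" by (auto simp: cell_def)
    have "q \<notin> nbh j" if "j < i" for j
      by (rule not_less_Least[of j "\<lambda>i. q \<in> nbh i"]) (use q(2) that in \<open>simp add: idx_def\<close>)
    then show "q \<in> S \<inter> (nbh i - (\<Union>j<i. nbh j))"
      using idx_nbh[OF q(1)] q by auto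
  next
    fix q assume *: "q \<in> S \<inter> (nbh i - (\<Union>j<i. nbh j))"
      have "idx q = i"
      unfolding idx_def by (rule Least_equality) (use * in \<open>auto simp: not_less[symmetric]\<close>)
    then show "q \<in> cell i" using * by (simp add: cell_def)
  qed
  then show ?thesis using open_nbh by (auto intro!: sets.Diff sets.Int)
qed

lemma cell_subset: "cell i \<subseteq> S" "cell i \<subseteq> par i ` cdom i"
  using idx_nbh by (auto simp: cell_def par_image)

lemma disjoint_cell: "disjoint_family cell"
  by (auto simp: disjoint_family_on_def cell_def)

lemma UN_cell: "(\<Union>i. cell i) = S"
  by (auto simp: cell_def)

lemma cell_dom_subset: "cell_dom i \<subseteq> cdom i"
  by (auto simp: cell_dom_def)

lemma par_vimage_borel:
  assumes "A \<in> sets borel"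
  shows "{x \<in> cdom i. par i x \<in> A} \<in> sets borel"
proof -
  have U: "cdom i \<in> sets borel" using local_parametrizationD(1)[OF par] by auto
  have "(\<lambda>x. if x \<in> cdom i then par i x else 0) \<in> borel_measurable borel"
    using U local_parametrizationD(2)[OF par] by (intro borel_measurable_continuous_on_if) auto
  from measurable_sets[OF this assms] U have "cdom i \<inter> (\<lambda>x. if x \<in> cdom i then par i x else 0) -` A \<in> sets borel"
    by auto
  also have "cdom i \<inter> (\<lambda>x. if x \<in> cdom i then par i x else 0) -` A = {x \<in> cdom i. par i x \<in> A}"
    by auto
  finally show ?thesis .
qed

lemma cell_dom_borel [measurable]: "cell_dom i \<in> sets borel"
  unfolding cell_dom_def by (rule par_vimage_borel) measurable

lemma par_cell_dom: "par i ` cell_dom i = cell i"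
  using cell_subset(2)[of i] by (auto simp: cell_dom_def)

lemma lin_cell:
  shows "q \<in> cell i \<Longrightarrow> lin i *v q \<in> cell_dom i" and "q \<in> cell i \<Longrightarrow> par i (lin i *v q) = q"
proof -
  assume "q \<in> cell i"
  then obtain x where x: "x \<in> cell_dom i" "q = par i x"
    using par_cell_dom by blast
  then have "lin i *v q = x" using lin_par cell_dom_subset by blast
  with x show "lin i *v q \<in> cell_dom i" "par i (lin i *v q) = q" by simp_all
qed

lemma measurable_par: "(\<lambda>x. if x \<in> cell_dom i then par i x else 0) \<in> borel_measurable borel"
  by (intro borel_measurable_continuous_on_if continuous_on_subset[OF local_parametrizationD(2)[OF par] cell_dom_subset])
     auto

lemma measurable_if_cell_dom:
  fixes f :: "real^'k \<Rightarrow> real"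
  assumes "continuous_on (cdom i) f"
  shows "(\<lambda>x. if x \<in> cell_dom i then f x else 0) \<in> borel_measurable borel"
  by (intro borel_measurable_continuous_on_if continuous_on_subset[OF assms cell_dom_subset]) auto

definition "vol i x = (if x \<in> cell_dom i then volume_density M (par i) x else 0)"

lemma measurable_vol [measurable]: "vol i \<in> borel_measurable borel"
  unfolding vol_def by (rule measurable_if_cell_dom[OF continuous_on_volume_density[OF par]])

text \<open>The derivatives of \<open>\<phi>\<close> and of the chart have the same range, the tangent space, so that the former is
  the latter composed with the derivative of \<open>lin i \<circ> \<phi>\<close>, the change of coordinates.\<close>

lemma volume_density_change_of_chart:
  fixes \<phi> :: "real^'k \<Rightarrow> real^'d"
  assumes \<phi>: "local_parametrization S U \<phi>" and x: "x \<in> U" and cell: "\<phi> x \<in> cell i"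
  shows "volume_density M \<phi> x = \<bar>det (lin i ** jacobian \<phi> (at x))\<bar> * vol i (lin i *v \<phi> x)"
proof -
  let ?y = "lin i *v \<phi> x" and ?J = "jacobian \<phi> (at x)"
  have y: "?y \<in> cell_dom i" "par i ?y = \<phi> x"
    using lin_cell[OF cell] by auto
  then have yU: "?y \<in> cdom i" using cell_dom_subset by auto
  let ?Ji = "jacobian (par i) (at ?y)"
  have "((\<lambda>y. lin i *v par i y) has_derivative (\<lambda>v. lin i *v (?Ji *v v))) (at ?y)"
    by (rule bounded_linear.has_derivative[OF matrix_vector_mul_bounded_linear local_parametrizationD(5)[OF par yU]])
  moreover have "((\<lambda>y. lin i *v par i y) has_derivative (\<lambda>v. v)) (at ?y)"
    by (rule has_derivative_transform_within_open[OF has_derivative_ident local_parametrizationD(1)[OF par] yU])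
       (simp add: lin_par)
  ultimately have "(\<lambda>v. lin i *v (?Ji *v v)) = (\<lambda>v. v)"
    by (rule has_derivative_unique)
  then have inv: "lin i *v (?Ji *v v) = v" for v by metis
  have "?J *v v = ?Ji *v (lin i *v (?J *v v))" for v
  proof -
    have "?J *v v \<in> range ((*v) ?Ji)"
      using range_jacobian[OF par yU] range_jacobian[OF \<phi> x] y(2) by auto
    then obtain w where "?J *v v = ?Ji *v w" by blast
    then show ?thesis by (simp add: inv)
  qed
  then have J: "?J = ?Ji ** (lin i ** ?J)"
    by (simp add: matrix_eq matrix_vector_mul_assoc)
  have "transpose ?J ** M ** ?J = transpose (lin i ** ?J) ** (transpose ?Ji ** M ** ?Ji) ** (lin i ** ?J)"
    by (subst (1 2) J) (simp only: matrix_transpose_mul matrix_mul_assoc)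
  then show ?thesis
    using y(1) by (simp add: volume_density_def Let_def vol_def sqrt_det_congruence)
qed

subsection \<open>Existence and uniqueness\<close>

text \<open>The sum over the cells of the push-forwards of the volume elements, written as a single push-forward
  from the product of counting and Lebesgue measure.\<close>

definition glued :: "(real^'d) measure"
  where "glued = restrict_space (distr (density (count_space UNIV \<Otimes>\<^sub>M lborel) (\<lambda>(i, x). ennreal (vol i x))) borel
    (\<lambda>(i, x). if x \<in> cell_dom i then par i x else 0)) S"

lemma sets_glued: "sets glued = sets (restrict_space borel S)"
  unfolding glued_def by (rule sets_restrict_space_cong) simp

lemma nn_integral_glued:
  assumes f: "f \<in> borel_measurable (restrict_space borel S)"
  shows "(\<integral>\<^sup>+q. f q \<partial>glued) = (\<Sum>i. \<integral>\<^sup>+x\<in>cell_dom i. ennreal (vol i x) * f (par i x) \<partial>lborel)"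
proof -
  let ?g = "\<lambda>(i, x). if x \<in> cell_dom i then par i x else 0"
  let ?f = "\<lambda>q. f q * indicator S q"
  have f' [measurable]: "?f \<in> borel_measurable borel"
    using f by (subst (asm) borel_measurable_restrict_space_iff_ennreal) auto
  have [measurable]: "?g \<in> borel_measurable (count_space UNIV \<Otimes>\<^sub>M lborel)"
    by (rule measurable_pair_measure_countable1) (auto simp: measurable_par)
  have [measurable]: "(\<lambda>(i, x). ennreal (vol i x)) \<in> borel_measurable (count_space UNIV \<Otimes>\<^sub>M lborel)"
    by (rule measurable_pair_measure_countable1) auto
  have "(\<integral>\<^sup>+q. f q \<partial>glued) = (\<integral>\<^sup>+z. (case z of (i, x) \<Rightarrow> ennreal (vol i x)) * ?f (?g z) \<partial>(count_space UNIV \<Otimes>\<^sub>M lborel))"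
    unfolding glued_def by (subst nn_integral_restrict_space) (auto simp: nn_integral_distr nn_integral_density)
  also have "\<dots> = (\<integral>\<^sup>+i. \<integral>\<^sup>+x. ennreal (vol i x) * ?f (?g (i, x)) \<partial>lborel \<partial>count_space UNIV)"
    by (subst lborel.nn_integral_fst[symmetric]) auto
  also have "\<dots> = (\<Sum>i. \<integral>\<^sup>+x\<in>cell_dom i. ennreal (vol i x) * f (par i x) \<partial>lborel)"
    unfolding nn_integral_count_space_nat
  proof (intro suminf_cong nn_integral_cong)
    fix i x
    show "ennreal (vol i x) * ?f (?g (i, x)) = ennreal (vol i x) * f (par i x) * indicator (cell_dom i) x"
      using par_cell_dom[of i] cell_subset(1)[of i] by (cases "x \<in> cell_dom i") (auto simp: indicator_def vol_def)
  qed
  finally show ?thesis .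
qed

lemma param_image_borel:
  fixes \<phi> :: "real^'k \<Rightarrow> real^'d"
  assumes \<phi>: "local_parametrization S U \<phi>" and E: "E \<in> sets borel" "E \<subseteq> U"
  shows "\<phi> ` E \<in> sets borel"
proof -
  obtain \<psi> where \<psi>: "homeomorphism U (\<phi> ` U) \<phi> \<psi>" and op: "openin (top_of_set S) (\<phi> ` U)"
    using \<phi> by (auto simp: local_parametrization_def)
  have im: "\<phi> ` U \<in> sets borel"
    using op S_borel by (auto simp: openin_open)
  have "(\<lambda>y. if y \<in> \<phi> ` U then \<psi> y else 0) \<in> borel_measurable borel"
    using im \<psi> by (intro borel_measurable_continuous_on_if) (auto simp: homeomorphism_def)
  from measurable_sets[OF this E(1)] im
  have "\<phi> ` U \<inter> (\<lambda>y. if y \<in> \<phi> ` U then \<psi> y else 0) -` E \<in> sets borel" by auto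
  also have "\<phi> ` U \<inter> (\<lambda>y. if y \<in> \<phi> ` U then \<psi> y else 0) -` E = \<phi> ` E"
    using \<psi> E(2) by (auto simp: homeomorphism_def image_iff) (metis subsetD)+
  finally show ?thesis .
qed

text \<open>On the part of \<open>E\<close> that \<open>\<phi>\<close> maps to the cell \<open>i\<close>, the map \<open>lin i \<circ> \<phi>\<close> changes coordinates to those of the
  chart \<open>i\<close>.\<close>

lemma emeasure_glued:
  fixes \<phi> :: "real^'k \<Rightarrow> real^'d"
  assumes \<phi>: "local_parametrization S U \<phi>" and E: "E \<in> sets borel" "E \<subseteq> U"
  shows "emeasure glued (\<phi> ` E) = (\<integral>\<^sup>+x\<in>E. ennreal (volume_density M \<phi> x) \<partial>lborel)"
proof -
  note D = local_parametrizationD[OF \<phi>]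
  define Ei where "Ei i = {x \<in> E. \<phi> x \<in> cell i}" for i
  have \<phi>E: "\<phi> ` E \<in> sets borel" by (rule param_image_borel[OF \<phi> E])
  have \<phi>E_sets: "\<phi> ` E \<in> sets (restrict_space borel S)"
    using \<phi>E D(4) E(2) by (subst sets_restrict_space_iff) auto
  have Ei: "Ei i \<in> sets borel" for i
  proof -
    have "(\<lambda>x. if x \<in> E then \<phi> x else 0) \<in> borel_measurable borel"
      by (intro borel_measurable_continuous_on_if E continuous_on_subset[OF D(2) E(2)]) auto
    from measurable_sets[OF this cell_borel[of i]] E(1)
    have "E \<inter> (\<lambda>x. if x \<in> E then \<phi> x else 0) -` cell i \<in> sets borel" by auto
    also have "E \<inter> (\<lambda>x. if x \<in> E then \<phi> x else 0) -` cell i = Ei i" by (auto simp: Ei_def)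
    finally show ?thesis .
  qed
  have piece: "(\<integral>\<^sup>+y\<in>cell_dom i. ennreal (vol i y) * indicator (\<phi> ` E) (par i y) \<partial>lborel)
     = (\<integral>\<^sup>+x. ennreal (volume_density M \<phi> x) * indicator (Ei i) x \<partial>lborel)" for i
  proof -
    let ?h = "\<lambda>x. lin i *v \<phi> x"
    let ?h' = "\<lambda>x v. lin i *v (jacobian \<phi> (at x) *v v)"
    have h': "(?h has_derivative ?h' x) (at x)" if "x \<in> Ei i" for x
      by (rule bounded_linear.has_derivative[OF matrix_vector_mul_bounded_linear D(5)])
         (use that E(2) in \<open>auto simp: Ei_def\<close>)
    have mat: "matrix (?h' x) = lin i ** jacobian \<phi> (at x)" for x
      by (simp add: matrix_vector_mul_assoc matrix_of_matrix_vector_mul)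
    have him: "?h ` Ei i = {y \<in> cell_dom i. par i y \<in> \<phi> ` E}"
    proof (intro subset_antisym subsetI)
      fix y assume "y \<in> ?h ` Ei i"
      then show "y \<in> {y \<in> cell_dom i. par i y \<in> \<phi> ` E}"
        using lin_cell by (auto simp: Ei_def)
    next
      fix y assume "y \<in> {y \<in> cell_dom i. par i y \<in> \<phi> ` E}"
      then obtain x where x: "x \<in> E" "par i y = \<phi> x" and y: "y \<in> cell_dom i" by auto
      moreover have "\<phi> x \<in> cell i" using x(2)[symmetric] y by (simp add: cell_dom_def)
      moreover have "y = ?h x" using x(2)[symmetric] y lin_par cell_dom_subset by (metis subsetD)
      ultimately show "y \<in> ?h ` Ei i" by (auto simp: Ei_def)
    qed
    have "(\<integral>\<^sup>+y\<in>?h ` Ei i. ennreal (vol i y) \<partial>lborel)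
        = (\<integral>\<^sup>+x\<in>Ei i. ennreal \<bar>det (matrix (?h' x))\<bar> * ennreal (vol i (?h x)) \<partial>lborel)"
    proof (rule nn_integral_differentiable_image[OF Ei _ h'])
      show "?h ` Ei i \<in> sets borel"
        unfolding him using sets.Int[OF cell_dom_borel par_vimage_borel[OF \<phi>E], of i i]
        by (rule back_subst[of "\<lambda>A. A \<in> sets borel"]) (auto simp: cell_dom_def)
      show "inj_on ?h (Ei i)"
      proof (rule inj_onI)
        fix x x' assume *: "x \<in> Ei i" "x' \<in> Ei i" "?h x = ?h x'"
        then have "\<phi> x = \<phi> x'" using lin_cell(2) by (metis (no_types, lifting) Ei_def mem_Collect_eq)
        then show "x = x'" using * D(3) E(2) by (auto simp: Ei_def inj_on_def)
      qed
      have c: "continuous_on U (\<lambda>x. \<bar>det (matrix (?h' x))\<bar>)"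
        unfolding mat by (intro continuous_intros D(7))
      have "Ei i \<subseteq> U" using E(2) by (auto simp: Ei_def)
      from borel_measurable_continuous_on_if[OF Ei continuous_on_subset[OF c this] continuous_on_const]
      show "(\<lambda>x. if x \<in> Ei i then \<bar>det (matrix (?h' x))\<bar> else 0) \<in> borel_measurable borel" .
    qed auto
    also have "\<dots> = (\<integral>\<^sup>+x. ennreal (volume_density M \<phi> x) * indicator (Ei i) x \<partial>lborel)"
    proof (intro nn_integral_cong)
      fix x
      show "ennreal \<bar>det (matrix (?h' x))\<bar> * ennreal (vol i (?h x)) * indicator (Ei i) x
          = ennreal (volume_density M \<phi> x) * indicator (Ei i) x"
        using volume_density_change_of_chart[OF \<phi>, of x i] E(2)
        by (auto simp: indicator_def Ei_def mat ennreal_mult')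
    qed
    also have "(\<integral>\<^sup>+y\<in>?h ` Ei i. ennreal (vol i y) \<partial>lborel)
      = (\<integral>\<^sup>+y\<in>cell_dom i. ennreal (vol i y) * indicator (\<phi> ` E) (par i y) \<partial>lborel)"
      unfolding him by (intro nn_integral_cong) (auto simp: indicator_def)
    finally show ?thesis .
  qed
  have "emeasure glued (\<phi> ` E) = (\<integral>\<^sup>+q. indicator (\<phi> ` E) q \<partial>glued)"
    using \<phi>E_sets by (simp add: sets_glued)
  also have "\<dots> = (\<Sum>i. \<integral>\<^sup>+y\<in>cell_dom i. ennreal (vol i y) * indicator (\<phi> ` E) (par i y) \<partial>lborel)"
    by (rule nn_integral_glued) (use \<phi>E_sets in measurable)
  also have "\<dots> = (\<integral>\<^sup>+x. (\<Sum>i. ennreal (volume_density M \<phi> x) * indicator (Ei i) x) \<partial>lborel)"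
    unfolding piece
  proof (rule nn_integral_suminf[symmetric])
    fix i
    have "(\<lambda>x. if x \<in> Ei i then volume_density M \<phi> x else 0) \<in> borel_measurable borel"
      using E(2) by (intro borel_measurable_continuous_on_if Ei continuous_on_subset[OF continuous_on_volume_density[OF \<phi>]])
        (auto simp: Ei_def)
    then have "(\<lambda>x. ennreal (if x \<in> Ei i then volume_density M \<phi> x else 0)) \<in> borel_measurable lborel"
      by measurable
    then show "(\<lambda>x. ennreal (volume_density M \<phi> x) * indicator (Ei i) x) \<in> borel_measurable lborel"
      by (rule measurable_cong[THEN iffD1, rotated]) (auto simp: indicator_def)
  qed
  also have "\<dots> = (\<integral>\<^sup>+x\<in>E. ennreal (volume_density M \<phi> x) \<partial>lborel)"
  proof (rule nn_integral_cong)
    fix x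
    have "disjoint_family Ei" using disjoint_cell by (auto simp: disjoint_family_on_def Ei_def)
    moreover have "(\<Union>i. Ei i) = E"
      using D(4) E(2) by (auto simp: Ei_def cell_def)
    ultimately have "(\<Sum>i. indicator (Ei i) x :: ennreal) = indicator E x"
      using suminf_indicator[of Ei x] by simp
    then show "(\<Sum>i. ennreal (volume_density M \<phi> x) * indicator (Ei i) x) = ennreal (volume_density M \<phi> x) * indicator E x"
      by (simp add: ennreal_suminf_cmult)
  qed
  finally show ?thesis .
qed

text \<open>Uniqueness holds because a Borel set is the disjoint union of its intersections with the cells, each of
  which is a parametrized set.\<close>

lemma riemannian_measure_eq_glued: "\<sigma> = glued"
  unfolding riemannian_measure_def
proof (rule the_equality)
  show "sets glued = sets (restrict_space borel S) \<and>
    (\<forall>(U :: (real^'k) set) \<phi> E. local_parametrization S U \<phi> \<and> E \<in> sets borel \<and> E \<subseteq> U \<longrightarrow>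
        emeasure glued (\<phi> ` E) = (\<integral>\<^sup>+x\<in>E. ennreal (volume_density M \<phi> x) \<partial>lborel))"
    using sets_glued emeasure_glued by blast
next
  fix \<tau> :: "(real^'d) measure"
  assume \<tau>: "sets \<tau> = sets (restrict_space borel S) \<and>
    (\<forall>(U :: (real^'k) set) \<phi> E. local_parametrization S U \<phi> \<and> E \<in> sets borel \<and> E \<subseteq> U \<longrightarrow>
        emeasure \<tau> (\<phi> ` E) = (\<integral>\<^sup>+x\<in>E. ennreal (volume_density M \<phi> x) \<partial>lborel))"
  show "\<tau> = glued"
  proof (rule measure_eqI)
    show "sets \<tau> = sets glued" using \<tau> sets_glued by simp
    fix A assume "A \<in> sets \<tau>"
    then have A: "A \<in> sets borel" "A \<subseteq> S" and A': "A \<in> sets (restrict_space borel S)"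
      using \<tau> by (auto simp: sets_restrict_space_iff)
    have Ac: "A \<inter> cell i \<in> sets (restrict_space borel S)" for i
      using A by (auto simp: sets_restrict_space_iff)
    have eq: "A \<inter> cell i = par i ` {x \<in> cdom i. par i x \<in> A \<inter> cell i}" for i
      using cell_subset(2)[of i] by auto
    have "emeasure \<tau> (A \<inter> cell i) = emeasure glued (A \<inter> cell i)" for i
    proof -
      have E: "{x \<in> cdom i. par i x \<in> A \<inter> cell i} \<in> sets borel"
        using A by (intro par_vimage_borel) auto
      have "emeasure \<tau> (par i ` {x \<in> cdom i. par i x \<in> A \<inter> cell i})
          = (\<integral>\<^sup>+x\<in>{x \<in> cdom i. par i x \<in> A \<inter> cell i}. ennreal (volume_density M (par i) x) \<partial>lborel)"
        by (rule \<tau>[THEN conjunct2, rule_format, of "cdom i" "par i"]) (use par E in blast)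
      also have "\<dots> = emeasure glued (par i ` {x \<in> cdom i. par i x \<in> A \<inter> cell i})"
        by (rule emeasure_glued[OF par E, symmetric]) blast
      finally show ?thesis by (simp only: eq[symmetric])
    qed
    moreover have "(\<Sum>i. emeasure N (A \<inter> cell i)) = emeasure N A" if N: "sets N = sets (restrict_space borel S)" for N
    proof -
      have *: "(\<Union>i. A \<inter> cell i) = A" "disjoint_family (\<lambda>i. A \<inter> cell i)"
        using A by (auto simp: disjoint_family_on_def cell_def)
      have "(\<Sum>i. emeasure N (A \<inter> cell i)) = emeasure N (\<Union>i. A \<inter> cell i)"
        by (rule suminf_emeasure) (use Ac N *(2) in auto)
      then show ?thesis unfolding *(1) .
    qed
    from this[of \<tau>] this[of glued]
    have "(\<Sum>i. emeasure \<tau> (A \<inter> cell i)) = emeasure \<tau> A" "(\<Sum>i. emeasure glued (A \<inter> cell i)) = emeasure glued A"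
      using \<tau> sets_glued by auto
    ultimately show "emeasure \<tau> A = emeasure glued A" by simp
  qed
qed

lemma sets_\<sigma> [measurable_cong]: "sets \<sigma> = sets (restrict_space borel S)"
  using sets_glued riemannian_measure_eq_glued by simp

lemma space_\<sigma>: "space \<sigma> = S"
  using sets_eq_imp_space_eq[OF sets_\<sigma>] by (simp add: space_restrict_space)

subsection \<open>A measurable frame of the cotangent spaces\<close>

text \<open>The columns of \<open>M J\<close>, where \<open>J\<close> is the Jacobian of the parametrization, span the cotangent space; the frame is
  Borel because it is continuous on every cell. It is not orthonormal, and \<open>frame_vol\<close>, the volume of
  the parallelepiped that it spans, corrects for this. The same number is the Riemannian volume element,
  as \<open>(M J)\<^sup>T M\<^sup>-\<^sup>1 (M J) = J\<^sup>T M J\<close>.\<close>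

definition frame :: "real^'d \<Rightarrow> real^'k^'d"
  where "frame q = M ** jacobian (par (idx q)) (at (lin (idx q) *v q))"

definition frame_vol :: "real^'d \<Rightarrow> real"
  where "frame_vol q = sqrt (det (transpose (frame q) ** Minv ** frame q))"

lemma frame_cell: "q \<in> cell i \<Longrightarrow> frame q = M ** jacobian (par i) (at (lin i *v q))"
  by (simp add: frame_def cell_def)

lemma frame_par: "x \<in> cell_dom i \<Longrightarrow> frame (par i x) = M ** jacobian (par i) (at x)"
  using frame_cell[of "par i x" i] lin_par[of x i] by (simp add: cell_dom_def)

lemma Minv_frame_par: "x \<in> cell_dom i \<Longrightarrow> Minv ** frame (par i x) = jacobian (par i) (at x)"
  by (simp add: frame_par matrix_mul_assoc matrix_inv[OF invertible_M])

lemma frame_vol_par: "x \<in> cell_dom i \<Longrightarrow> frame_vol (par i x) = vol i x"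
  by (simp add: frame_vol_def vol_def volume_density_def Let_def frame_par matrix_transpose_mul spdD(1)[OF spd_M]
      matrix_mul_assoc[symmetric])
     (simp add: matrix_mul_assoc matrix_inv[OF invertible_M])

lemma nn_integral_\<sigma>:
  assumes f: "f \<in> borel_measurable (restrict_space borel S)"
  shows "(\<integral>\<^sup>+q. f q \<partial>\<sigma>) = (\<Sum>i. \<integral>\<^sup>+x\<in>cell_dom i. ennreal (frame_vol (par i x)) * f (par i x) \<partial>lborel)"
  unfolding riemannian_measure_eq_glued nn_integral_glued[OF f]
  by (intro suminf_cong nn_integral_cong) (auto simp: indicator_def frame_vol_par)

lemma range_frame: 
  assumes q: "q \<in> S"
  shows "range ((*v) (frame q)) = cotangent_space M \<xi> q"
proof -
  let ?i = "idx q" and ?x = "lin (idx q) *v q"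
  have c: "q \<in> cell ?i" using q by (simp add: cell_def)
  have x: "?x \<in> cdom ?i" using lin_cell(1)[OF c] cell_dom_subset by auto
  have R: "range ((*v) (jacobian (par ?i) (at ?x))) = tangent q"
    using range_jacobian[OF par x] lin_cell(2)[OF c] by simp
  have fr: "frame q *v y = M *v (jacobian (par ?i) (at ?x) *v y)" for y
    by (simp add: frame_def matrix_vector_mul_assoc)
  show ?thesis
  proof (intro subset_antisym subsetI)
    fix p assume "p \<in> range ((*v) (frame q))"
    then show "p \<in> cotangent_space M \<xi> q"
      using R by (auto simp: cotangent_tangent fr)
  next
    fix p assume "p \<in> cotangent_space M \<xi> q"
    then obtain y where "Minv *v p = jacobian (par ?i) (at ?x) *v y"
      using R by (auto simp: cotangent_tangent)
    then have "p = frame q *v y" by (metis fr Minv_M(2))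
    then show "p \<in> range ((*v) (frame q))" by blast
  qed
qed

lemma inj_frame:
  assumes q: "q \<in> S"
  shows "inj ((*v) (frame q))"
proof -
  let ?i = "idx q" and ?x = "lin (idx q) *v q"
  have c: "q \<in> cell ?i" using q by (simp add: cell_def)
  have x: "?x \<in> cdom ?i" using lin_cell(1)[OF c] cell_dom_subset by auto
  have "inj ((*v) (jacobian (par ?i) (at ?x)))" by (rule local_parametrizationD(6)[OF par x])
  then show ?thesis
    unfolding inj_on_def frame_def matrix_vector_mul_assoc[symmetric] by (metis Minv_M(1))
qed

lemma frame_vol_pos: "q \<in> S \<Longrightarrow> frame_vol q > 0"
  unfolding frame_vol_def using spd_det_pos[OF spd_congruence[OF spd_Minv inj_frame]] by simp

lemma frame_measurable [measurable]: "frame \<in> borel_measurable (restrict_space borel S)"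
proof (rule measurable_piecewise_restrict[of "range cell"])
  fix \<Omega> assume "\<Omega> \<in> range cell"
  then obtain i where i: "\<Omega> = cell i" by blast
  show "\<Omega> \<inter> space (restrict_space borel S) \<in> sets (restrict_space borel S)"
    unfolding i by (auto simp: sets_restrict_space_iff space_restrict_space)
  have "continuous_on (cell i) (\<lambda>q. M ** jacobian (par i) (at (lin i *v q)))"
    by (intro continuous_intros continuous_on_compose2[OF local_parametrizationD(7)[OF par]])
       (use lin_cell(1) cell_dom_subset in blast)+
  then have "continuous_on (cell i) frame"
    by (rule continuous_on_eq) (simp add: frame_cell)
  moreover have "S \<inter> cell i = cell i" using cell_subset(1) by blast
  ultimately show "frame \<in> borel_measurable (restrict_space (restrict_space borel S) \<Omega>)"
    unfolding i by (simp add: restrict_restrict_space borel_measurable_continuous_on_restrict)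
qed (auto simp: space_restrict_space UN_cell)

lemma frame_vol_measurable [measurable]: "frame_vol \<in> borel_measurable (restrict_space borel S)"
proof -
  have "(\<lambda>A :: real^'k^'d. sqrt (det (transpose A ** Minv ** A))) \<in> borel_measurable borel"
    by (intro borel_measurable_continuous_onI continuous_intros)
  from measurable_compose[OF frame_measurable this] show ?thesis
    by (simp add: frame_vol_def[abs_def])
qed

lemma \<sigma>_measurableI: "f \<in> restrict_space borel S \<rightarrow>\<^sub>M N \<Longrightarrow> f \<in> \<sigma> \<rightarrow>\<^sub>M N"
  by (subst measurable_cong_sets[OF sets_\<sigma> refl])

lemma id_\<sigma>: "(\<lambda>q. q) \<in> \<sigma> \<rightarrow>\<^sub>M borel"
  and frame_\<sigma>: "frame \<in> \<sigma> \<rightarrow>\<^sub>M borel"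
  and frame_vol_\<sigma>: "frame_vol \<in> \<sigma> \<rightarrow>\<^sub>M borel"
  by (rule \<sigma>_measurableI, rule measurable_restrict_space1, simp)
     (rule \<sigma>_measurableI, rule frame_measurable, rule \<sigma>_measurableI, rule frame_vol_measurable)

text \<open>The density is the Jacobian of the map with respect to the Riemannian measure: the derivative along the
  manifold is \<open>K J\<close> with \<open>J = M\<^sup>-\<^sup>1 frame\<close>. The Borel left inverse \<open>h\<close> makes the images of the cells Borel.\<close>

proposition area_formula:
  fixes K :: "real^'d^'k"
  assumes E: "E \<in> sets borel" "E \<subseteq> S"
    and Y: "(\<lambda>q. K *v q + c) ` E = Y" "Y \<in> sets borel"
    and h: "h \<in> borel_measurable (restrict_space borel Y)" "\<And>q. q \<in> E \<Longrightarrow> h (K *v q + c) = q"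
  shows "emeasure lborel Y = (\<integral>\<^sup>+q\<in>E. ennreal (\<bar>det (K ** Minv ** frame q)\<bar> / frame_vol q) \<partial>\<sigma>)"
proof -
  define Ei where "Ei i = {x \<in> cdom i. par i x \<in> E \<inter> cell i}" for i
  define g where "g i x = K *v par i x + c" for i x
  have Ei: "Ei i \<in> sets borel" for i
    unfolding Ei_def using E by (intro par_vimage_borel) auto
  have Ei': "Ei i \<subseteq> cell_dom i" for i by (auto simp: Ei_def cell_dom_def)
  have gEi: "g i ` Ei i = {y \<in> Y. h y \<in> cell i}" for i
  proof (intro subset_antisym subsetI)
    fix y assume "y \<in> g i ` Ei i"
    then show "y \<in> {y \<in> Y. h y \<in> cell i}" using h(2) Y(1) by (auto simp: g_def Ei_def)
  next
    fix y assume y: "y \<in> {y \<in> Y. h y \<in> cell i}"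
    then obtain q where q: "q \<in> E" "y = K *v q + c" using Y(1) by blast
    then have "q \<in> cell i" using y h(2) by simp
    then have "lin i *v q \<in> Ei i" "y = g i (lin i *v q)"
      using lin_cell[of q i] cell_dom_subset q by (auto simp: Ei_def g_def)
    then show "y \<in> g i ` Ei i" by blast
  qed
  have gEi_borel: "g i ` Ei i \<in> sets borel" for i
  proof -
    have "h -` cell i \<inter> space (restrict_space borel Y) \<in> sets (restrict_space borel Y)"
      using h(1) cell_borel by (rule measurable_sets)
    then show ?thesis
      unfolding gEi using Y(2) by (auto simp: sets_restrict_space_iff space_restrict_space vimage_def Int_def conj_commute)
  qed
  have piece: "emeasure lborel (g i ` Ei i) = (\<integral>\<^sup>+x\<in>Ei i. ennreal \<bar>det (K ** jacobian (par i) (at x))\<bar> \<partial>lborel)" for i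
  proof -
    let ?g' = "\<lambda>x v. K *v (jacobian (par i) (at x) *v v)"
    have mat: "matrix (?g' x) = K ** jacobian (par i) (at x)" for x
      by (simp add: matrix_vector_mul_assoc matrix_of_matrix_vector_mul)
    have "emeasure lborel (g i ` Ei i) = (\<integral>\<^sup>+x\<in>Ei i. ennreal \<bar>det (matrix (?g' x))\<bar> \<partial>lborel)"
    proof (rule emeasure_differentiable_image[OF Ei gEi_borel])
      fix x assume "x \<in> Ei i"
      then have "x \<in> cdom i" by (simp add: Ei_def)
      then have "((\<lambda>x. K *v par i x) has_derivative ?g' x) (at x)"
        by (intro bounded_linear.has_derivative[OF matrix_vector_mul_bounded_linear] local_parametrizationD(5)[OF par])
      then show "(g i has_derivative ?g' x) (at x)"
        unfolding g_def[abs_def] using has_derivative_add_const by blast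
    next
      show "inj_on (g i) (Ei i)"
      proof (rule inj_onI)
        fix x x' assume *: "x \<in> Ei i" "x' \<in> Ei i" "g i x = g i x'"
        then have "par i x = par i x'" using h(2) by (metis (no_types, lifting) Ei_def Int_iff g_def mem_Collect_eq)
        then show "x = x'" using * local_parametrizationD(3)[OF par] by (auto simp: Ei_def inj_on_def)
      qed
      have c: "continuous_on (cdom i) (\<lambda>x. \<bar>det (matrix (?g' x))\<bar>)"
        unfolding mat by (intro continuous_intros local_parametrizationD(7)[OF par])
      have "Ei i \<subseteq> cdom i" by (auto simp: Ei_def)
      from borel_measurable_continuous_on_if[OF Ei continuous_on_subset[OF c this] continuous_on_const]
      show "(\<lambda>x. if x \<in> Ei i then \<bar>det (matrix (?g' x))\<bar> else 0) \<in> borel_measurable borel" .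
    qed
    then show ?thesis by (simp only: mat)
  qed
  let ?w = "\<lambda>q. ennreal (\<bar>det (K ** Minv ** frame q)\<bar> / frame_vol q)"
  have UNgEi: "(\<Union>i. g i ` Ei i) = Y"
    unfolding gEi using Y(1) h(2) E(2) by (auto simp: cell_def)
  have "disjoint_family (\<lambda>i. g i ` Ei i)"
    unfolding gEi using disjoint_cell by (auto simp: disjoint_family_on_def)
  then have "emeasure lborel Y = (\<Sum>i. emeasure lborel (g i ` Ei i))"
    using gEi_borel by (subst suminf_emeasure) (auto simp: UNgEi)
  also have "\<dots> = (\<Sum>i. \<integral>\<^sup>+x\<in>cell_dom i. ennreal (frame_vol (par i x)) * (?w (par i x) * indicator E (par i x)) \<partial>lborel)"
    unfolding piece
  proof (intro suminf_cong nn_integral_cong)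
    fix i x
    show "ennreal \<bar>det (K ** jacobian (par i) (at x))\<bar> * indicator (Ei i) x
      = ennreal (frame_vol (par i x)) * (?w (par i x) * indicator E (par i x)) * indicator (cell_dom i) x"
    proof (cases "x \<in> Ei i")
      case True
      then have x: "x \<in> cell_dom i" "par i x \<in> E" using Ei' by (auto simp: Ei_def)
      then have pos: "frame_vol (par i x) > 0" using E(2) frame_vol_pos by auto
      have "K ** Minv ** frame (par i x) = K ** jacobian (par i) (at x)"
        using Minv_frame_par[OF x(1)] by (simp add: matrix_mul_assoc[symmetric])
      then show ?thesis
        using True x pos by (simp add: ennreal_mult'[symmetric] less_imp_le)
    next
      case False
      then show ?thesis by (auto simp: Ei_def cell_dom_def indicator_def)
    qed
  qed
  also have "\<dots> = (\<integral>\<^sup>+q\<in>E. ?w q \<partial>\<sigma>)"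
  proof (rule nn_integral_\<sigma>[symmetric])
    have "(\<lambda>A :: real^'k^'d. \<bar>det (K ** Minv ** A)\<bar>) \<in> borel_measurable borel"
      by (intro borel_measurable_continuous_onI continuous_intros)
    from measurable_compose[OF frame_measurable this]
    have "(\<lambda>q. \<bar>det (K ** Minv ** frame q)\<bar>) \<in> borel_measurable (restrict_space borel S)" .
    moreover have "indicator E \<in> borel_measurable (restrict_space borel S)"
      using E(1) by (intro measurable_restrict_space1) simp
    ultimately show "(\<lambda>q. ?w q * indicator E q) \<in> borel_measurable (restrict_space borel S)"
      by measurable
  qed
  finally show ?thesis .
qed

end

section \<open>The Liouville measure and the target measure\<close>

subsection \<open>Lebesgue measure on a subspace in an arbitrary frame\<close>

text \<open>An orthonormal frame is \<open>C G\<^sup>-\<^sup>1\<^sup>/\<^sup>2\<close> with the Gram matrix \<open>G = C\<^sup>T Q C\<close>.\<close>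

lemma subspace_lebesgue_orthonormal:
  fixes C :: "real^'k^'d" and kdim :: "'k::finite itself"
  assumes Q: "spd Q" and C: "range ((*v) C) = E" "inj ((*v) C)"
  obtains B :: "real^'k^'d" where "range ((*v) B) = E" "transpose B ** Q ** B = mat 1"
    "subspace_lebesgue kdim Q E = distr lborel (restrict_space borel E) ((*v) B)"
proof -
  let ?G = "transpose C ** Q ** C"
  note s = spd_sqrt[OF spd_congruence[OF Q C(2)]]
  let ?s = "spd_sqrt ?G" and ?r = "matrix_inv (spd_sqrt ?G)"
  have inv: "invertible ?s" by (rule spd_invertible[OF s(1)])
  have rr: "?s ** ?r = mat 1" "?r ** ?s = mat 1" using matrix_inv[OF inv] by auto
  have "range ((*v) (C ** ?r)) = E"
  proof -
    have "range ((*v) (C ** ?r)) = (*v) C ` range ((*v) ?r)"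
      by (simp add: image_image matrix_vector_mul_assoc)
    also have "range ((*v) ?r) = UNIV"
      by (metis inv matrix_inv_vec(2) surjI)
    finally show ?thesis using C(1) by simp
  qed
  moreover have "transpose (C ** ?r) ** Q ** (C ** ?r) = mat 1"
  proof -
    have "transpose (C ** ?r) ** Q ** (C ** ?r) = transpose ?r ** ?G ** ?r"
      by (simp only: matrix_transpose_mul matrix_mul_assoc)
    also have "\<dots> = transpose ?r ** (?s ** ?s) ** ?r" by (simp only: s(2))
    also have "\<dots> = (?r ** ?s) ** (?s ** ?r)"
      by (simp only: spdD(1)[OF spd_matrix_inv[OF s(1)]] matrix_mul_assoc)
    finally show ?thesis by (simp add: rr)
  qed
  ultimately have "\<exists>B :: real^'k^'d. range ((*v) B) = E \<and> transpose B ** Q ** B = mat 1"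
    by blast
  from someI_ex[OF this] show thesis
    by (intro that[of "SOME B :: real^'k^'d. range ((*v) B) = E \<and> transpose B ** Q ** B = mat 1"])
       (auto simp: subspace_lebesgue_def Let_def)
qed

text \<open>The frames are related by \<open>C = B R\<close>, and \<open>R\<^sup>T R = C\<^sup>T Q C\<close> gives \<open>|det R|\<close>.\<close>

lemma nn_integral_frame_change:
  fixes B C :: "real^'k^'d"
  assumes B: "range ((*v) B) = E" "transpose B ** Q ** B = mat 1" and Q: "spd Q"
    and C: "range ((*v) C) = E" "inj ((*v) C)"
    and f: "(\<lambda>y. f (B *v y)) \<in> borel_measurable borel"
  shows "(\<integral>\<^sup>+y. ennreal (sqrt (det (transpose C ** Q ** C))) * f (C *v y) \<partial>lborel) = (\<integral>\<^sup>+y. f (B *v y) \<partial>lborel)"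
proof -
  define R where "R = transpose B ** Q ** C"
  have CB: "C *v y = B *v (R *v y)" for y
  proof -
    obtain z where z: "C *v y = B *v z" using B(1) C(1) by (metis rangeE rangeI)
    have "R *v y = transpose B ** Q *v (C *v y)" by (simp add: R_def matrix_vector_mul_assoc)
    also have "\<dots> = (transpose B ** Q ** B) *v z" by (simp add: z matrix_vector_mul_assoc)
    finally show ?thesis using z B(2) by simp
  qed
  then have C_eq: "C = B ** R" by (simp add: matrix_eq matrix_vector_mul_assoc)
  have "transpose C ** Q ** C = transpose R ** (transpose B ** Q ** B) ** R"
    unfolding C_eq by (simp only: matrix_transpose_mul matrix_mul_assoc)
  then have detC: "sqrt (det (transpose C ** Q ** C)) = \<bar>det R\<bar>"
    using sqrt_det_congruence[of R "mat 1"] B(2) by simp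
  have "sqrt (det (transpose C ** Q ** C)) > 0"
    using spd_det_pos[OF spd_congruence[OF Q C(2)]] by simp
  then have R: "det R \<noteq> 0" unfolding detC by simp
  have [measurable]: "(*v) R \<in> borel_measurable borel"
    by (intro borel_measurable_continuous_onI continuous_intros)
  note [measurable] = f
  have "(\<integral>\<^sup>+y. f (B *v y) \<partial>lborel) = (\<integral>\<^sup>+y. ennreal (\<bar>det R\<bar> * (1 / \<bar>det R\<bar>)) * f (B *v y) \<partial>lborel)"
    using R by simp
  also have "\<dots> = (\<integral>\<^sup>+y. ennreal (1 / \<bar>det R\<bar>) * (ennreal \<bar>det R\<bar> * f (B *v y)) \<partial>lborel)"
  proof -
    have "ennreal (\<bar>det R\<bar> * (1 / \<bar>det R\<bar>)) = ennreal \<bar>det R\<bar> * ennreal (1 / \<bar>det R\<bar>)"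
      by (rule ennreal_mult') simp
    then show ?thesis by (simp only: mult_ac)
  qed
  also have "\<dots> = (\<integral>\<^sup>+y. ennreal \<bar>det R\<bar> * f (B *v y) \<partial>density lborel (\<lambda>_. ennreal (1 / \<bar>det R\<bar>)))"
    using f by (subst nn_integral_density) auto
  also have "\<dots> = (\<integral>\<^sup>+y. ennreal \<bar>det R\<bar> * f (B *v (R *v y)) \<partial>lborel)"
    unfolding distr_lborel_matrix[OF R, symmetric] by (subst nn_integral_distr) auto
  finally show ?thesis by (simp add: CB detC)
qed

subsection \<open>The standard Gaussian measure\<close>

definition gauss_const :: "'n::finite itself \<Rightarrow> real"
  where "gauss_const n = (1 / sqrt (2 * pi)) ^ CARD('n)"

lemma gauss_const_pos: "gauss_const n > 0"
  by (simp add: gauss_const_def)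

lemma std_gaussian_density:
  "(\<Prod>i\<in>UNIV. std_normal_density (x $ i)) = gauss_const TYPE('n) * exp (- (x \<bullet> x / 2))" for x :: "real^'n"
proof -
  have "(\<Prod>i\<in>UNIV. std_normal_density (x $ i)) = (\<Prod>i\<in>(UNIV :: 'n set). 1 / sqrt (2 * pi)) * (\<Prod>i\<in>UNIV. exp (- (x $ i)\<^sup>2 / 2))"
    by (simp only: std_normal_density_def prod.distrib)
  also have "(\<Prod>i\<in>UNIV. exp (- (x $ i)\<^sup>2 / 2)) = exp (\<Sum>i\<in>UNIV. - (x $ i)\<^sup>2 / 2)"
    by (simp add: exp_sum)
  also have "(\<Sum>i\<in>UNIV. - (x $ i)\<^sup>2 / 2) = - (x \<bullet> x / 2)"
    by (simp add: inner_vec_def power2_eq_square sum_negf sum_divide_distrib)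
  finally show ?thesis by (simp add: gauss_const_def)
qed

lemma std_gaussian_eq:
  "(std_gaussian :: (real^'n) measure) = density lborel (\<lambda>x. ennreal (gauss_const TYPE('n) * exp (- (x \<bullet> x / 2))))"
  by (simp add: std_gaussian_def std_gaussian_density)

lemma sets_std_gaussian [measurable_cong, simp]: "sets std_gaussian = sets borel"
  and space_std_gaussian [simp]: "space std_gaussian = UNIV"
  by (simp_all add: std_gaussian_def)

lemma nn_integral_gauss:
  "(\<integral>\<^sup>+x. ennreal (gauss_const TYPE('n) * exp (- (x \<bullet> x / 2))) \<partial>(lborel :: (real^'n) measure)) = 1"
proof -
  have "(\<integral>\<^sup>+x. ennreal (gauss_const TYPE('n) * exp (- (x \<bullet> x / 2))) \<partial>(lborel :: (real^'n) measure))
     = (\<integral>\<^sup>+x. (\<Prod>b\<in>Basis. ennreal (std_normal_density (x \<bullet> b))) \<partial>(lborel :: (real^'n) measure))"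
    by (simp add: std_gaussian_density[symmetric] prod_Basis_vec inner_axis prod_ennreal)
  also have "\<dots> = (\<Prod>b\<in>(Basis :: (real^'n) set). \<integral>\<^sup>+x. ennreal (std_normal_density x) \<partial>lborel)"
    by (rule nn_integral_lborel_prod) auto
  also have "(\<integral>\<^sup>+x. ennreal (std_normal_density x) \<partial>lborel) = 1"
  proof -
    interpret prob_space "density lborel std_normal_density" by (rule prob_space_normal_density) simp
    show ?thesis using emeasure_space_1 by (simp add: emeasure_density)
  qed
  finally show ?thesis by simp
qed

lemma prob_space_std_gaussian: "prob_space (std_gaussian :: (real^'n) measure)"
  by (rule prob_spaceI) (simp add: std_gaussian_eq emeasure_density nn_integral_gauss)

context constraint_manifold
begin

subsection \<open>The Liouville measure\<close>

abbreviation "TS \<equiv> cotangent_bundle M \<xi>"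
abbreviation "phase \<equiv> phase_space M \<xi>"

lemma continuous_on_nabla_compose [continuous_intros]:
  "continuous_on X f \<Longrightarrow> continuous_on X (\<lambda>x. nabla \<xi> (f x))"
  by (rule continuous_on_compose2[OF continuous_on_nabla[OF smooth_\<xi>]]) auto

lemma TS_iff: "(q, p) \<in> TS \<longleftrightarrow> q \<in> S \<and> p \<in> cotangent_space M \<xi> q"
  by (simp add: cotangent_bundle_def)

lemma closed_TS: "closed TS"
proof -
  have "TS = {x. \<xi> (fst x) = 0} \<inter> {x. transpose (nabla \<xi> (fst x)) *v (Minv *v snd x) = 0}"
    by (auto simp: cotangent_bundle_def level_set_def cotangent_space_def)
  moreover have "closed {x :: (real^'d) \<times> (real^'d). \<xi> (fst x) = 0}"
    by (intro closed_Collect_eq continuous_on_compose2[OF continuous_\<xi>] continuous_intros) auto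
  moreover have "closed {x :: (real^'d) \<times> (real^'d). transpose (nabla \<xi> (fst x)) *v (Minv *v snd x) = 0}"
    by (intro closed_Collect_eq continuous_intros)
  ultimately show ?thesis by (simp add: closed_Int)
qed

lemma TS_borel [measurable]: "TS \<in> sets borel"
  using closed_TS by (rule borel_closed)

lemma space_phase: "space phase = TS"
  by (simp add: space_restrict_space)

lemma sets_phase_iff: "A \<in> sets phase \<longleftrightarrow> A \<subseteq> TS \<and> A \<in> sets borel"
  by (simp add: sets_restrict_space_iff)

lemma measurable_phaseI:
  assumes "f \<in> N \<rightarrow>\<^sub>M borel" "\<And>x. x \<in> space N \<Longrightarrow> f x \<in> TS"
  shows "f \<in> N \<rightarrow>\<^sub>M phase"
  using assms by (intro measurable_restrict_space2) auto

lemma frame_in: "q \<in> S \<Longrightarrow> (q, frame q *v y) \<in> TS"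
  using range_frame[of q] by (auto simp: TS_iff)

lemma measurable_frame_map: "(\<lambda>(q, y). (q, frame q *v y)) \<in> \<sigma> \<Otimes>\<^sub>M lborel \<rightarrow>\<^sub>M phase"
proof (rule measurable_phaseI)
  have mv: "(\<lambda>z :: (real^'k^'d) \<times> (real^'k). fst z *v snd z) \<in> borel_measurable (borel \<Otimes>\<^sub>M borel)"
    by (subst borel_prod) (intro borel_measurable_continuous_onI continuous_intros)
  have "(\<lambda>z. (frame (fst z), snd z)) \<in> \<sigma> \<Otimes>\<^sub>M lborel \<rightarrow>\<^sub>M borel \<Otimes>\<^sub>M borel"
    by (intro measurable_Pair measurable_compose[OF measurable_fst frame_\<sigma>]) simp
  from measurable_compose[OF this mv]
  have "(\<lambda>z. frame (fst z) *v snd z) \<in> borel_measurable (\<sigma> \<Otimes>\<^sub>M lborel)" by simp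
  moreover have "fst \<in> \<sigma> \<Otimes>\<^sub>M lborel \<rightarrow>\<^sub>M borel"
    by (rule measurable_compose[OF measurable_fst id_\<sigma>])
  ultimately show "(\<lambda>(q, y). (q, frame q *v y)) \<in> borel_measurable (\<sigma> \<Otimes>\<^sub>M lborel)"
    unfolding split_beta by (intro borel_measurable_Pair) auto
qed (auto simp: space_pair_measure space_\<sigma> frame_in)

lemma measurable_frame_vol_fst [measurable]: "(\<lambda>(q, y). ennreal (frame_vol q)) \<in> borel_measurable (\<sigma> \<Otimes>\<^sub>M lborel)"
  using frame_vol_\<sigma> by measurable

lemma section_measurable:
  assumes f: "f \<in> borel_measurable phase" and q: "q \<in> S"
    and R: "range ((*v) B) \<subseteq> cotangent_space M \<xi> q"
  shows "(\<lambda>y. f (q, B *v y)) \<in> borel_measurable borel"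
proof -
  have "(\<lambda>y. (q, B *v y)) \<in> borel \<rightarrow>\<^sub>M phase"
    by (rule measurable_phaseI)
       (use R q in \<open>auto simp: TS_iff intro!: borel_measurable_continuous_onI continuous_intros\<close>)
  from measurable_compose[OF this f] show ?thesis .
qed

lemma subspace_lebesgue_cotangent:
  assumes q: "q \<in> S" and A: "A \<in> sets phase"
  shows "emeasure (subspace_lebesgue kdim Minv (cotangent_space M \<xi> q)) {p. (q, p) \<in> A}
    = (\<integral>\<^sup>+y. ennreal (frame_vol q) * indicator A (q, frame q *v y) \<partial>lborel)"
proof -
  let ?T = "cotangent_space M \<xi> q"
  obtain B :: "real^'k^'d" where B: "range ((*v) B) = ?T" "transpose B ** Minv ** B = mat 1"
    "subspace_lebesgue kdim Minv ?T = distr lborel (restrict_space borel ?T) ((*v) B)"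
    using subspace_lebesgue_orthonormal[OF spd_Minv range_frame[OF q] inj_frame[OF q]] by metis
  have T: "?T \<in> sets borel"
  proof -
    have "closed ?T" unfolding cotangent_space_def by (intro closed_Collect_eq continuous_intros)
    then show ?thesis by simp
  qed
  have pair: "Pair q \<in> borel \<rightarrow>\<^sub>M borel"
    by (intro borel_measurable_continuous_onI continuous_intros)
  have Aq: "{p. (q, p) \<in> A} \<in> sets (restrict_space borel ?T)"
  proof -
    have "{p. (q, p) \<in> A} = Pair q -` A \<inter> space borel" by auto
    also have "\<dots> \<in> sets borel"
      using A by (intro measurable_sets[OF pair]) (simp add: sets_phase_iff)
    finally show ?thesis
      using A T by (auto simp: sets_restrict_space_iff sets_phase_iff TS_iff)
  qed
  have Bm: "(*v) B \<in> lborel \<rightarrow>\<^sub>M restrict_space borel ?T"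
    using B(1) by (intro measurable_restrict_space2)
      (auto intro!: borel_measurable_continuous_onI continuous_intros)
  have sec: "(\<lambda>y. indicator A (q, B *v y) :: ennreal) \<in> borel_measurable borel"
    using A B(1) q by (intro section_measurable) auto
  have "emeasure (subspace_lebesgue kdim Minv ?T) {p. (q, p) \<in> A}
     = emeasure lborel ((*v) B -` {p. (q, p) \<in> A} \<inter> space lborel)"
    unfolding B(3) by (rule emeasure_distr[OF Bm Aq])
  also have "\<dots> = (\<integral>\<^sup>+y. indicator ((*v) B -` {p. (q, p) \<in> A} \<inter> space lborel) y \<partial>lborel)"
    using measurable_sets[OF Bm Aq] by simp
  also have "\<dots> = (\<integral>\<^sup>+y. indicator A (q, B *v y) \<partial>lborel)"
    by (intro nn_integral_cong) (auto simp: indicator_def)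
  also have "\<dots> = (\<integral>\<^sup>+y. ennreal (frame_vol q) * indicator A (q, frame q *v y) \<partial>lborel)"
    unfolding frame_vol_def
    by (rule nn_integral_frame_change[OF B(1,2) spd_Minv range_frame[OF q] inj_frame[OF q],
          of "\<lambda>p. indicator A (q, p)", symmetric]) (rule sec)
  finally show ?thesis .
qed

abbreviation "\<L> \<equiv> liouville kdim M \<xi>"

text \<open>In the Borel frame the fiber measures become one Lebesgue measure on \<open>real^'k\<close>. This shows that the inner
  integral in the definition is a measurable function of the base point, and reduces integrals over
  the cotangent bundle to Fubini's theorem.\<close>

lemma liouville_eq_distr:
  "\<L> = distr (density (\<sigma> \<Otimes>\<^sub>M lborel) (\<lambda>(q, y). ennreal (frame_vol q))) phase (\<lambda>(q, y). (q, frame q *v y))"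
  (is "_ = ?D")
proof -
  have em: "(\<integral>\<^sup>+q. emeasure (subspace_lebesgue kdim Minv (cotangent_space M \<xi> q)) {p. (q, p) \<in> A} \<partial>\<sigma>) = emeasure ?D A"
    if A: "A \<in> sets phase" for A
  proof -
    note [measurable] = measurable_frame_map A
    have "emeasure ?D A = (\<integral>\<^sup>+x. indicator A x \<partial>?D)"
      using A by simp
    also have "\<dots> = (\<integral>\<^sup>+z. (case z of (q, y) \<Rightarrow> ennreal (frame_vol q)) * indicator A (case z of (q, y) \<Rightarrow> (q, frame q *v y)) \<partial>(\<sigma> \<Otimes>\<^sub>M lborel))"
      by (subst nn_integral_distr) (auto intro!: nn_integral_density)
    also have "\<dots> = (\<integral>\<^sup>+q. \<integral>\<^sup>+y. ennreal (frame_vol q) * indicator A (q, frame q *v y) \<partial>lborel \<partial>\<sigma>)"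
      by (subst lborel.nn_integral_fst[symmetric]) auto
    also have "\<dots> = (\<integral>\<^sup>+q. emeasure (subspace_lebesgue kdim Minv (cotangent_space M \<xi> q)) {p. (q, p) \<in> A} \<partial>\<sigma>)"
      by (rule nn_integral_cong) (rule subspace_lebesgue_cotangent[OF _ A, symmetric], simp add: space_\<sigma>)
    finally show ?thesis by (rule sym)
  qed
  have "\<L> = measure_of TS (sets phase) (emeasure ?D)"
    unfolding liouville_def
  proof (rule measure_of_eq)
    show "sets phase \<subseteq> Pow TS" by (auto simp: sets_phase_iff)
    fix A assume "A \<in> sigma_sets TS (sets phase)"
    then have "A \<in> sets phase"
      using sets.sigma_sets_eq[of phase] by (simp add: space_phase)
    then show "(\<integral>\<^sup>+q. emeasure (subspace_lebesgue kdim Minv (cotangent_space M \<xi> q)) {p. (q, p) \<in> A} \<partial>\<sigma>) = emeasure ?D A"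
      by (rule em)
  qed
  also have "\<dots> = ?D"
    using measure_of_of_measure[of ?D] by (simp add: space_phase)
  finally show ?thesis .
qed

lemma sets_liouville [measurable_cong]: "sets \<L> = sets phase"
  by (simp add: liouville_eq_distr)

lemma space_liouville: "space \<L> = TS"
  by (simp add: liouville_eq_distr space_phase)

lemma nn_integral_liouville_frame:
  assumes f: "f \<in> borel_measurable phase"
  shows "(\<integral>\<^sup>+x. f x \<partial>\<L>) = (\<integral>\<^sup>+q. \<integral>\<^sup>+y. ennreal (frame_vol q) * f (q, frame q *v y) \<partial>lborel \<partial>\<sigma>)"
proof -
  note [measurable] = measurable_frame_map f
  have "(\<integral>\<^sup>+x. f x \<partial>\<L>) = (\<integral>\<^sup>+z. (case z of (q, y) \<Rightarrow> ennreal (frame_vol q)) * f (case z of (q, y) \<Rightarrow> (q, frame q *v y)) \<partial>(\<sigma> \<Otimes>\<^sub>M lborel))"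
    unfolding liouville_eq_distr by (subst nn_integral_distr) (auto intro!: nn_integral_density)
  also have "\<dots> = (\<integral>\<^sup>+q. \<integral>\<^sup>+y. ennreal (frame_vol q) * f (q, frame q *v y) \<partial>lborel \<partial>\<sigma>)"
    by (subst lborel.nn_integral_fst[symmetric]) auto
  finally show ?thesis .
qed

text \<open>Chosen separately at every point and hence used only within a single fiber, where it turns the kinetic
  energy into \<open>|y|\<^sup>2 / 2\<close>.\<close>

definition oframe :: "real^'d \<Rightarrow> real^'k^'d"
  where "oframe q = (SOME B. range ((*v) B) = cotangent_space M \<xi> q \<and> transpose B ** Minv ** B = mat 1)"

lemma oframe:
  assumes q: "q \<in> S"
  shows "range ((*v) (oframe q)) = cotangent_space M \<xi> q" "transpose (oframe q) ** Minv ** oframe q = mat 1"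
proof -
  have "\<exists>B :: real^'k^'d. range ((*v) B) = cotangent_space M \<xi> q \<and> transpose B ** Minv ** B = mat 1"
    using subspace_lebesgue_orthonormal[OF spd_Minv range_frame[OF q] inj_frame[OF q]] by metis
  from someI_ex[OF this, folded oframe_def]
  show "range ((*v) (oframe q)) = cotangent_space M \<xi> q" "transpose (oframe q) ** Minv ** oframe q = mat 1" by auto
qed

lemma nn_integral_liouville:
  assumes f: "f \<in> borel_measurable phase"
  shows "(\<integral>\<^sup>+x. f x \<partial>\<L>) = (\<integral>\<^sup>+q. \<integral>\<^sup>+y. f (q, oframe q *v y) \<partial>lborel \<partial>\<sigma>)"
  unfolding nn_integral_liouville_frame[OF f]
proof (rule nn_integral_cong)
  fix q assume "q \<in> space \<sigma>"
  then have q: "q \<in> S" by (simp add: space_\<sigma>)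
  show "(\<integral>\<^sup>+y. ennreal (frame_vol q) * f (q, frame q *v y) \<partial>lborel) = (\<integral>\<^sup>+y. f (q, oframe q *v y) \<partial>lborel)"
    unfolding frame_vol_def
    by (rule nn_integral_frame_change[OF oframe[OF q] spd_Minv range_frame[OF q] inj_frame[OF q], of "\<lambda>p. f (q, p)"])
       (rule section_measurable[OF f q], simp add: oframe[OF q])
qed

lemma oframe_inner:
  assumes q: "q \<in> S"
  shows "(oframe q *v y) \<bullet> (Minv *v (oframe q *v z)) = y \<bullet> z"
proof -
  have "(oframe q *v y) \<bullet> (Minv *v (oframe q *v z)) = y \<bullet> ((transpose (oframe q) ** Minv ** oframe q) *v z)"
    by (simp add: matrix_vector_mul_assoc[symmetric] inner_matrix_transpose)
  then show ?thesis by (simp add: oframe(2)[OF q])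
qed

end

subsection \<open>The target measure\<close>

locale constrained_target = constraint_manifold M \<xi> kdim
  for M :: "real^'d^'d" and \<xi> :: "real^'d \<Rightarrow> real^'m" and kdim :: "'k::finite itself" +
  fixes V :: "real^'d \<Rightarrow> real"
  assumes smooth_V: "smooth_on UNIV V"
    and Z_pos: "0 < Z_nu kdim M \<xi> V" and Z_fin: "Z_nu kdim M \<xi> V < \<infinity>"
begin

abbreviation "H \<equiv> hamiltonian M V"
abbreviation "\<mu> \<equiv> target_measure kdim M \<xi> V"
abbreviation "Z \<equiv> Z_mu kdim M \<xi> V"

lemma continuous_on_V [continuous_intros]: "continuous_on X f \<Longrightarrow> continuous_on X (\<lambda>x. V (f x))"
  by (rule continuous_on_compose2[OF smooth_on_imp_continuous_on[OF smooth_V]]) auto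

lemma continuous_on_grad_V [continuous_intros]: "continuous_on X f \<Longrightarrow> continuous_on X (\<lambda>x. grad V (f x))"
  by (rule continuous_on_compose2[OF continuous_on_grad[OF smooth_V]]) auto

lemma V_measurable [measurable]: "V \<in> borel_measurable \<sigma>"
  by (intro \<sigma>_measurableI measurable_restrict_space1 borel_measurable_continuous_onI continuous_intros)

text \<open>The sublevel sets of \<open>V\<close> have finite measure, because \<open>e\<^sup>-\<^sup>V\<close> is integrable.\<close>

sublocale \<sigma>: sigma_finite_measure \<sigma>
proof
  define A where "A n = {q \<in> space \<sigma>. V q \<le> real n}" for n :: nat
  have A [measurable]: "A n \<in> sets \<sigma>" for n
    unfolding A_def by measurable
  have fin: "emeasure \<sigma> (A n) \<noteq> \<infinity>" for n
  proof -
    have "ennreal (exp (- real n)) * emeasure \<sigma> (A n) = (\<integral>\<^sup>+q. ennreal (exp (- real n)) * indicator (A n) q \<partial>\<sigma>)"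
      by (simp add: nn_integral_cmult)
    also have "\<dots> \<le> (\<integral>\<^sup>+q. ennreal (exp (- V q)) \<partial>\<sigma>)"
      by (rule nn_integral_mono) (auto simp: A_def indicator_def)
    also have "\<dots> < \<infinity>"
      using Z_fin by (simp add: Z_nu_def)
    finally show ?thesis
      by (auto simp: ennreal_mult_less_top)
  qed
  have "(\<Union>n. A n) = space \<sigma>"
    unfolding A_def using real_arch_simple by blast
  then show "\<exists>F. countable F \<and> F \<subseteq> sets \<sigma> \<and> \<Union>F = space \<sigma> \<and> (\<forall>a\<in>F. emeasure \<sigma> a \<noteq> \<infinity>)"
    using fin by (intro exI[of _ "range A"]) auto
qed

lemma continuous_on_H: "continuous_on UNIV H"
proof -
  have "continuous_on UNIV (\<lambda>x. V (fst x) + 1/2 * (snd x \<bullet> (Minv *v snd x)))"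
    by (intro continuous_intros)
  then show ?thesis by (simp add: hamiltonian_def split_beta)
qed

lemma H_measurable [measurable]: "H \<in> borel_measurable phase"
  by (intro measurable_restrict_space1 borel_measurable_continuous_onI continuous_on_H)

lemma H_oframe: "q \<in> S \<Longrightarrow> H (q, oframe q *v y) = V q + (y \<bullet> y) / 2"
  by (simp add: hamiltonian_def oframe_inner)

text \<open>The momenta contribute the Gaussian integral over \<open>real^'k\<close> in every fiber.\<close>

lemma Z_eq: "ennreal (gauss_const kdim) * Z = Z_nu kdim M \<xi> V"
proof -
  let ?c = "gauss_const kdim"
  have c: "?c > 0" by (rule gauss_const_pos)
  have kd: "gauss_const kdim = gauss_const TYPE('k)" by (simp add: gauss_const_def)
  have m: "(\<lambda>x. ennreal (exp (- H x))) \<in> borel_measurable phase" by measurable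
  have inner: "(\<integral>\<^sup>+y. ennreal (exp (- H (q, oframe q *v y))) \<partial>lborel) = ennreal (exp (- V q)) * ennreal (1 / ?c)"
    if "q \<in> S" for q
  proof -
    have "(\<integral>\<^sup>+y. ennreal (exp (- H (q, oframe q *v y))) \<partial>lborel)
       = (\<integral>\<^sup>+y. ennreal (exp (- V q) * (1 / ?c)) * ennreal (?c * exp (- (y \<bullet> y / 2))) \<partial>(lborel :: (real^'k) measure))"
    proof (rule nn_integral_cong)
      fix y :: "real^'k"
      have "exp (- V q - y \<bullet> y / 2) = exp (- V q) * exp (- (y \<bullet> y / 2))"
        by (simp add: exp_add[symmetric])
      then have "exp (- H (q, oframe q *v y)) = (exp (- V q) * (1 / ?c)) * (?c * exp (- (y \<bullet> y / 2)))"
        using that c by (simp add: H_oframe)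
      then show "ennreal (exp (- H (q, oframe q *v y)))
          = ennreal (exp (- V q) * (1 / ?c)) * ennreal (?c * exp (- (y \<bullet> y / 2)))"
        using c by (simp only: ennreal_mult'[symmetric] zero_le_mult_iff) (simp add: ennreal_mult'[symmetric])
    qed
    also have "\<dots> = ennreal (exp (- V q) * (1 / ?c))"
      by (subst nn_integral_cmult) (use nn_integral_gauss[where 'n='k] kd in \<open>auto simp del: mult_minus_left\<close>)
    also have "\<dots> = ennreal (exp (- V q)) * ennreal (1 / ?c)"
      by (rule ennreal_mult') simp
    finally show ?thesis .
  qed
  have "Z = (\<integral>\<^sup>+q. ennreal (exp (- V q)) * ennreal (1 / ?c) \<partial>\<sigma>)"
    unfolding Z_mu_def nn_integral_liouville[OF m]
    by (intro nn_integral_cong) (simp add: space_\<sigma> inner)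
  also have "\<dots> = Z_nu kdim M \<xi> V * ennreal (1 / ?c)"
    unfolding Z_nu_def by (subst nn_integral_multc) auto
  finally have "ennreal ?c * Z = Z_nu kdim M \<xi> V * (ennreal ?c * ennreal (1 / ?c))"
    by (simp add: mult_ac)
  also have "ennreal ?c * ennreal (1 / ?c) = 1"
    using c by (simp add: ennreal_mult[symmetric] less_imp_le)
  finally show ?thesis by simp
qed

lemma Z_mu_pos: "Z \<noteq> 0" and Z_mu_fin: "Z \<noteq> \<infinity>"
proof -
  show "Z \<noteq> 0" using Z_eq Z_pos by auto
  show "Z \<noteq> \<infinity>"
  proof
    assume "Z = \<infinity>"
    then have "Z_nu kdim M \<xi> V = \<infinity>" using Z_eq gauss_const_pos[of kdim] by (simp add: ennreal_mult_top)
    then show False using Z_fin by simp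
  qed
qed

lemma sets_\<mu> [measurable_cong]: "sets \<mu> = sets phase"
  and space_\<mu>: "space \<mu> = TS"
  by (simp_all add: target_measure_def sets_liouville space_liouville)

lemma nn_integral_\<mu>:
  assumes f: "f \<in> borel_measurable phase"
  shows "(\<integral>\<^sup>+x. f x \<partial>\<mu>) = (\<integral>\<^sup>+x. ennreal (exp (- H x)) * f x \<partial>\<L>) / Z"
proof -
  have w: "(\<lambda>x. ennreal (exp (- H x)) / Z) \<in> borel_measurable \<L>"
    by (subst measurable_cong_sets[OF sets_liouville refl]) measurable
  have f': "f \<in> borel_measurable \<L>" "(\<lambda>x. ennreal (exp (- H x)) * f x) \<in> borel_measurable \<L>"
    using f by (subst measurable_cong_sets[OF sets_liouville refl]; measurable)+
  have "(\<integral>\<^sup>+x. f x \<partial>\<mu>) = (\<integral>\<^sup>+x. ennreal (exp (- H x)) / Z * f x \<partial>\<L>)"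
    unfolding target_measure_def by (rule nn_integral_density[OF w f'(1)])
  also have "\<dots> = (\<integral>\<^sup>+x. ennreal (exp (- H x)) * f x / Z \<partial>\<L>)"
    by (simp add: ennreal_times_divide mult.commute)
  also have "\<dots> = (\<integral>\<^sup>+x. ennreal (exp (- H x)) * f x \<partial>\<L>) / Z"
    by (rule nn_integral_divide[OF f'(2)])
  finally show ?thesis .
qed

lemma prob_space_\<mu>: "prob_space \<mu>"
proof (rule prob_spaceI)
  have "emeasure \<mu> (space \<mu>) = (\<integral>\<^sup>+x. 1 \<partial>\<mu>)" by simp
  also have "\<dots> = Z / Z" by (subst nn_integral_\<mu>) (auto simp: Z_mu_def)
  also have "\<dots> = 1" using Z_mu_pos Z_mu_fin by (simp add: less_top ennreal_divide_self)
  finally show "emeasure \<mu> (space \<mu>) = 1" .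
qed

end

section \<open>The momentum update\<close>

lemma matrix_vector_mult_minus_right: "A *v (- x) = - (A *v x)" for A :: "real^'n^'m"
  using matrix_vector_mult_scaleR[of A "-1" x] by simp

text \<open>A norm preserving linear map preserves the standard Gaussian measure of the product, so the first
  component of the image of a standard Gaussian vector is again standard Gaussian.\<close>

lemma nn_integral_gaussian_rotation:
  fixes R :: "(real^'k) \<times> (real^'d) \<Rightarrow> (real^'k) \<times> (real^'d)"
  assumes R: "linear R" "\<And>z. norm (R z) = norm z" and F [measurable]: "F \<in> borel_measurable borel"
  shows "(\<integral>\<^sup>+y. ennreal (exp (- (y \<bullet> y / 2))) * (\<integral>\<^sup>+g. F (fst (R (y, g))) \<partial>std_gaussian) \<partial>lborel)
    = (\<integral>\<^sup>+y. ennreal (exp (- (y \<bullet> y / 2))) * F y \<partial>lborel)"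
proof -
  let ?c = "gauss_const TYPE('d)"
  let ?w = "\<lambda>z :: (real^'k) \<times> (real^'d). ennreal (?c * exp (- (z \<bullet> z / 2)))"
  have w: "?w (y, g) = ennreal (exp (- (y \<bullet> y / 2))) * ennreal (?c * exp (- (g \<bullet> g / 2)))" for y g
  proof -
    have "exp (- ((y, g) \<bullet> (y, g) / 2)) = exp (- (y \<bullet> y / 2)) * exp (- (g \<bullet> g / 2))"
      by (simp add: exp_add[symmetric] add_divide_distrib)
    then show ?thesis
      by (simp only: ennreal_mult'[symmetric] exp_ge_zero) (simp add: mult_ac)
  qed
  have Rc: "continuous_on UNIV R"
    using R(1) by (simp add: linear_continuous_on linear_conv_bounded_linear)
  then have Rm [measurable]: "R \<in> borel \<rightarrow>\<^sub>M borel"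
    by (rule borel_measurable_continuous_onI)
  have R1 [measurable]: "(\<lambda>z. fst (R z)) \<in> borel_measurable borel"
    by (intro borel_measurable_continuous_onI continuous_intros Rc)
  have fst_m [measurable]: "fst \<in> borel_measurable (borel :: ((real^'k) \<times> (real^'d)) measure)"
    by (intro borel_measurable_continuous_onI continuous_intros)
  have wm [measurable]: "?w \<in> borel_measurable borel"
    by (intro measurable_compose[OF _ measurable_ennreal] borel_measurable_continuous_onI continuous_intros) auto
  have marg: "(\<integral>\<^sup>+z. ?w z * G z \<partial>lborel) = (\<integral>\<^sup>+y. ennreal (exp (- (y \<bullet> y / 2))) * (\<integral>\<^sup>+g. G (y, g) \<partial>std_gaussian) \<partial>lborel)"
    if G [measurable]: "G \<in> borel_measurable borel" for G
  proof -
    have "(\<integral>\<^sup>+z. ?w z * G z \<partial>lborel) = (\<integral>\<^sup>+z. ?w z * G z \<partial>(lborel \<Otimes>\<^sub>M lborel))"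
      by (simp only: lborel_prod)
    also have "\<dots> = (\<integral>\<^sup>+y. \<integral>\<^sup>+g. ?w (y, g) * G (y, g) \<partial>lborel \<partial>lborel)"
      by (rule lborel.nn_integral_fst[symmetric]) (simp add: lborel_prod)
    also have "\<dots> = (\<integral>\<^sup>+y. ennreal (exp (- (y \<bullet> y / 2))) * (\<integral>\<^sup>+g. G (y, g) \<partial>std_gaussian) \<partial>lborel)"
    proof (rule nn_integral_cong)
      fix y :: "real^'k"
      have "Pair y \<in> borel \<rightarrow>\<^sub>M borel"
        by (intro borel_measurable_continuous_onI continuous_intros)
      then have [measurable]: "(\<lambda>g. G (y, g)) \<in> borel_measurable borel"
        by (rule measurable_compose) fact
      have gm [measurable]: "(\<lambda>g :: real^'d. ?c * exp (- (g \<bullet> g / 2))) \<in> borel_measurable borel"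
        by (intro borel_measurable_continuous_onI continuous_intros) auto
      have "(\<integral>\<^sup>+g. ?w (y, g) * G (y, g) \<partial>lborel)
        = (\<integral>\<^sup>+g. ennreal (exp (- (y \<bullet> y / 2))) * (ennreal (?c * exp (- (g \<bullet> g / 2))) * G (y, g)) \<partial>lborel)"
        by (simp only: w mult.assoc)
      also have "\<dots> = ennreal (exp (- (y \<bullet> y / 2))) * (\<integral>\<^sup>+g. ennreal (?c * exp (- (g \<bullet> g / 2))) * G (y, g) \<partial>lborel)"
        by (rule nn_integral_cmult) measurable
      also have "(\<integral>\<^sup>+g. ennreal (?c * exp (- (g \<bullet> g / 2))) * G (y, g) \<partial>lborel) = (\<integral>\<^sup>+g. G (y, g) \<partial>std_gaussian)"
        unfolding std_gaussian_eq by (rule nn_integral_density[symmetric]) measurable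
      finally show "(\<integral>\<^sup>+g. ?w (y, g) * G (y, g) \<partial>lborel) = ennreal (exp (- (y \<bullet> y / 2))) * (\<integral>\<^sup>+g. G (y, g) \<partial>std_gaussian)" .
    qed
    finally show ?thesis .
  qed
  have "(\<integral>\<^sup>+y. ennreal (exp (- (y \<bullet> y / 2))) * (\<integral>\<^sup>+g. F (fst (R (y, g))) \<partial>std_gaussian) \<partial>lborel)
     = (\<integral>\<^sup>+z. ?w z * F (fst (R z)) \<partial>lborel)"
    by (subst marg) auto
  also have "\<dots> = (\<integral>\<^sup>+z. ?w (R z) * F (fst (R z)) \<partial>lborel)"
    using R(2) by (simp add: power2_norm_eq_inner[symmetric])
  also have "\<dots> = (\<integral>\<^sup>+z. ?w z * F (fst z) \<partial>distr lborel borel R)"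
    by (subst nn_integral_distr) auto
  also have "\<dots> = (\<integral>\<^sup>+z. ?w z * F (fst z) \<partial>lborel)"
    by (simp only: distr_lborel_isometry[OF R])
  also have "\<dots> = (\<integral>\<^sup>+y. ennreal (exp (- (y \<bullet> y / 2))) * (\<integral>\<^sup>+g. F y \<partial>(std_gaussian :: (real^'d) measure)) \<partial>lborel)"
    by (subst marg) auto
  also have "\<dots> = (\<integral>\<^sup>+y. ennreal (exp (- (y \<bullet> y / 2))) * F y \<partial>lborel)"
    using prob_space.emeasure_space_1[OF prob_space_std_gaussian[where 'n='d]] by simp
  finally show ?thesis .
qed

context constraint_manifold
begin

text \<open>The solution \<open>l\<close> of the constraint \<open>\<nabla>\<xi>(q)\<^sup>T W (r + \<nabla>\<xi>(q) l) = 0\<close>. The momentum update uses the weight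
  \<open>W = (M + dt/4 \<gamma>)\<^sup>-\<^sup>1\<close>, the RATTLE map the weight \<open>M\<^sup>-\<^sup>1\<close>.\<close>

definition multiplier :: "real^'d^'d \<Rightarrow> real^'d \<Rightarrow> real^'d \<Rightarrow> real^'m"
  where "multiplier W q r =
    - (matrix_inv (transpose (nabla \<xi> q) ** W ** nabla \<xi> q) *v (transpose (nabla \<xi> q) *v (W *v r)))"

lemma invertible_projected_gram: "q \<in> S \<Longrightarrow> spd W \<Longrightarrow> invertible (transpose (nabla \<xi> q) ** W ** nabla \<xi> q)"
  by (rule spd_invertible[OF spd_congruence[OF _ inj_nabla]])

lemma multiplier_iff:
  assumes q: "q \<in> S" and W: "spd W"
  shows "transpose (nabla \<xi> q) *v (W *v (r + nabla \<xi> q *v l)) = 0 \<longleftrightarrow> l = multiplier W q r"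
proof -
  let ?G = "transpose (nabla \<xi> q) ** W ** nabla \<xi> q" and ?b = "transpose (nabla \<xi> q) *v (W *v r)"
  have "transpose (nabla \<xi> q) *v (W *v (r + nabla \<xi> q *v l)) = ?b + ?G *v l"
    by (simp add: matrix_vector_right_distrib matrix_vector_mul_assoc matrix_mul_assoc)
  also have "\<dots> = 0 \<longleftrightarrow> ?G *v l = - ?b"
    by (metis add.commute add.inverse_inverse add_eq_0_iff)
  also have "\<dots> \<longleftrightarrow> l = matrix_inv ?G *v (- ?b)"
    using matrix_inv_vec[OF invertible_projected_gram[OF q W]] by metis
  finally show ?thesis by (simp add: multiplier_def matrix_vector_mult_minus_right)
qed

end

locale constrained_langevin = constrained_target M \<xi> kdim V
  for M :: "real^'d^'d" and \<xi> :: "real^'d \<Rightarrow> real^'m" and kdim :: "'k::finite itself" and V +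
  fixes dt :: real and \<gamma> :: "real^'d^'d"
  assumes dt: "dt > 0" and spd_\<gamma>: "spd \<gamma>"
begin

abbreviation "pu \<equiv> momentum_update M \<xi> \<gamma> dt"

definition "Wm = matrix_inv (M + (dt/4) *\<^sub>R \<gamma>)"
definition "noise = spd_sqrt (dt *\<^sub>R \<gamma>)"

text \<open>The velocity \<open>M\<^sup>-\<^sup>1 p'\<close> solves a linear system with the matrix \<open>M + dt/4 \<gamma>\<close> and this right-hand side, up to
  the constraint force.\<close>

definition "rhs p g = p - (dt/4) *\<^sub>R (\<gamma> *v (Minv *v p)) + noise *v g"
definition "pu_expl q p g = M *v (Wm *v (rhs p g + nabla \<xi> q *v multiplier Wm q (rhs p g)))"

lemma spd_friction: "spd (M + (dt/4) *\<^sub>R \<gamma>)"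
  using dt by (intro spd_add spd_M spd_scaleR spd_\<gamma>) auto

lemma spd_Wm: "spd Wm"
  unfolding Wm_def by (rule spd_matrix_inv[OF spd_friction])

lemma Wm [simp]: "(M + (dt/4) *\<^sub>R \<gamma>) *v (Wm *v z) = z" "Wm *v ((M + (dt/4) *\<^sub>R \<gamma>) *v z) = z"
  unfolding Wm_def using spd_invertible[OF spd_friction] by simp_all

lemma noise: "transpose noise = noise" "noise *v (noise *v x) = dt *\<^sub>R (\<gamma> *v x)"
proof -
  have "spd (dt *\<^sub>R \<gamma>)" using dt by (intro spd_scaleR spd_\<gamma>)
  note s = spd_sqrt[OF this, folded noise_def]
  show "transpose noise = noise" by (rule spdD(1)[OF s(1)])
  show "noise *v (noise *v x) = dt *\<^sub>R (\<gamma> *v x)"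
    by (simp add: matrix_vector_mul_assoc s(2) scaleR_matrix_vector_assoc)
qed

lemma momentum_equation_iff:
  "p' = p - (dt/4) *\<^sub>R (\<gamma> *v (Minv *v (p + p'))) + noise *v g + nabla \<xi> q *v l
    \<longleftrightarrow> p' = M *v (Wm *v (rhs p g + nabla \<xi> q *v l))" (is "?L \<longleftrightarrow> ?R")
proof -
  have "?L \<longleftrightarrow> p' + (dt/4) *\<^sub>R (\<gamma> *v (Minv *v p')) = rhs p g + nabla \<xi> q *v l"
    unfolding rhs_def by (simp add: matrix_vector_right_distrib scaleR_right_distrib algebra_simps)
  also have "p' + (dt/4) *\<^sub>R (\<gamma> *v (Minv *v p')) = (M + (dt/4) *\<^sub>R \<gamma>) *v (Minv *v p')"
    by (simp add: matrix_vector_mult_add_rdistrib scaleR_matrix_vector_assoc[symmetric])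
  also have "\<dots> = rhs p g + nabla \<xi> q *v l \<longleftrightarrow> Minv *v p' = Wm *v (rhs p g + nabla \<xi> q *v l)"
    by (metis Wm)
  also have "\<dots> \<longleftrightarrow> ?R" by (metis Minv_M)
  finally show ?thesis .
qed

lemma momentum_update_explicit:
  assumes q: "q \<in> S"
  shows "pu q p g = pu_expl q p g"
  unfolding momentum_update_def noise_def[symmetric] momentum_equation_iff
proof (rule the_equality)
  show "(\<exists>l. pu_expl q p g = M *v (Wm *v (rhs p g + nabla \<xi> q *v l))) \<and>
    transpose (nabla \<xi> q) *v (Minv *v pu_expl q p g) = 0"
    using multiplier_iff[OF q spd_Wm, of "rhs p g" "multiplier Wm q (rhs p g)"] by (auto simp: pu_expl_def)
next
  fix p'
  assume *: "(\<exists>l. p' = M *v (Wm *v (rhs p g + nabla \<xi> q *v l))) \<and> transpose (nabla \<xi> q) *v (Minv *v p') = 0"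
  then obtain l where l: "p' = M *v (Wm *v (rhs p g + nabla \<xi> q *v l))" by blast
  then have "l = multiplier Wm q (rhs p g)" using multiplier_iff[OF q spd_Wm, of "rhs p g" l] * by simp
  with l show "p' = pu_expl q p g" by (simp add: pu_expl_def)
qed

lemma momentum_update_properties:
  assumes q: "q \<in> S"
  shows "pu q p g \<in> cotangent_space M \<xi> q"
    and "\<exists>l. pu q p g = p - (dt/4) *\<^sub>R (\<gamma> *v (Minv *v (p + pu q p g))) + noise *v g + nabla \<xi> q *v l"
  unfolding momentum_equation_iff
  unfolding momentum_update_explicit[OF q] cotangent_space_def
  using multiplier_iff[OF q spd_Wm, of "rhs p g" "multiplier Wm q (rhs p g)"] by (auto simp: pu_expl_def)

lemma linear_momentum_update: "q \<in> S \<Longrightarrow> linear (\<lambda>(p, g). pu q p g)"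
  unfolding momentum_update_explicit pu_expl_def multiplier_def rhs_def split_beta
  by (intro linearI)
     (simp_all add: matrix_vector_right_distrib matrix_vector_mult_scaleR matrix_vector_mult_diff_distrib
       matrix_vector_mult_minus_right algebra_simps)

lemma continuous_on_momentum_update:
  "continuous_on (S \<times> UNIV \<times> UNIV) (\<lambda>(q, p, g). pu q p g)"
proof -
  have "continuous_on (S \<times> UNIV \<times> UNIV) (\<lambda>x. pu_expl (fst x) (fst (snd x)) (snd (snd x)))"
    unfolding pu_expl_def multiplier_def rhs_def
    by (intro continuous_intros invertible_projected_gram[OF _ spd_Wm]) auto
  then show ?thesis
    by (rule continuous_on_eq) (auto simp: momentum_update_explicit)
qed

text \<open>If the noise is updated as well, to \<open>g'\<close>, the quantity \<open>p\<^sup>T M\<^sup>-\<^sup>1 p + |g|\<^sup>2\<close> is conserved. With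
  \<open>u = M\<^sup>-\<^sup>1 (p + p')\<close>, the kinetic term changes by \<open>u \<bullet> (p' - p) = u \<bullet> (noise g) - dt/4 u \<bullet> (\<gamma> u)\<close>, as the
  constraint force is orthogonal to \<open>u\<close>; and \<open>noise noise\<^sup>T = dt \<gamma>\<close>, the fluctuation-dissipation relation,
  makes \<open>|g|\<^sup>2\<close> change by the opposite amount.\<close>

lemma momentum_update_energy:
  fixes p g :: "real^'d"
  assumes q: "q \<in> S" and p: "p \<in> cotangent_space M \<xi> q"
  defines "p' \<equiv> pu q p g" and "g' \<equiv> g - (1/2) *\<^sub>R (noise *v (Minv *v (p + pu q p g)))"
  shows "p' \<bullet> (Minv *v p') + g' \<bullet> g' = p \<bullet> (Minv *v p) + g \<bullet> g"
proof -
  define u where "u = Minv *v (p + p')"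
  obtain l where l: "p' = p - (dt/4) *\<^sub>R (\<gamma> *v u) + noise *v g + nabla \<xi> q *v l"
    using momentum_update_properties(2)[OF q, of p g] unfolding p'_def u_def by blast
  have T: "transpose (nabla \<xi> q) *v u = 0"
    using p momentum_update_properties(1)[OF q, of p g]
    by (simp add: u_def p'_def cotangent_space_def matrix_vector_right_distrib)
  then have Nl: "u \<bullet> (nabla \<xi> q *v l) = 0"
    by (simp add: inner_matrix_transpose)
  have "p' \<bullet> (Minv *v p') - p \<bullet> (Minv *v p) = u \<bullet> (p' - p)"
    using spd_inner_swap[OF spd_Minv, of p p'] inner_commute[of u "p' - p"] inner_commute[of "Minv *v p" p']
    by (simp add: u_def matrix_vector_right_distrib inner_add_right inner_diff_left)
  also have "p' - p = noise *v g + nabla \<xi> q *v l - (dt/4) *\<^sub>R (\<gamma> *v u)"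
    by (subst l) simp
  also have "u \<bullet> \<dots> = u \<bullet> (noise *v g) - (dt/4) * (u \<bullet> (\<gamma> *v u))"
    by (simp add: inner_add_right inner_diff_right Nl)
  finally have 1: "p' \<bullet> (Minv *v p') - p \<bullet> (Minv *v p) = u \<bullet> (noise *v g) - (dt/4) * (u \<bullet> (\<gamma> *v u))" .
  have "(noise *v u) \<bullet> (noise *v u) = dt * (u \<bullet> (\<gamma> *v u))"
    by (metis inner_matrix_transpose inner_scaleR_right noise inner_commute)
  moreover have "(noise *v u) \<bullet> g = u \<bullet> (noise *v g)"
    by (metis inner_matrix_transpose noise(1))
  ultimately have "g' \<bullet> g' = g \<bullet> g - u \<bullet> (noise *v g) + (dt/4) * (u \<bullet> (\<gamma> *v u))"
    unfolding g'_def p'_def[symmetric] u_def[symmetric]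
    by (simp add: inner_diff_left inner_diff_right inner_commute algebra_simps)
  with 1 show ?thesis by simp
qed

lemma oframe_coords:
  assumes q: "q \<in> S" and p: "p \<in> cotangent_space M \<xi> q"
  shows "oframe q *v (transpose (oframe q) *v (Minv *v p)) = p"
proof -
  obtain y where y: "p = oframe q *v y" using oframe(1)[OF q] p by blast
  have "transpose (oframe q) *v (Minv *v p) = (transpose (oframe q) ** Minv ** oframe q) *v y"
    by (simp add: y matrix_vector_mul_assoc matrix_mul_assoc)
  then show ?thesis by (simp add: oframe(2)[OF q] y)
qed

text \<open>In an orthonormal frame the conserved quantity is the squared norm of \<open>(y, g)\<close>, so that \<open>(y, g) \<mapsto> (y', g')\<close>
  is a linear isometry of \<open>real^'k \<times> real^'d\<close>. The sign \<open>s\<close> covers the reversal of the momentum that precedes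
  the second update.\<close>

lemma fiber_invariance:
  fixes s :: real
  assumes q: "q \<in> S" and s: "\<bar>s\<bar> = 1"
    and F: "(\<lambda>y. f (q, oframe q *v y)) \<in> borel_measurable borel"
  shows "(\<integral>\<^sup>+y. ennreal (exp (- (y \<bullet> y / 2))) * (\<integral>\<^sup>+g. f (q, pu q (s *\<^sub>R (oframe q *v y)) g) \<partial>std_gaussian) \<partial>lborel)
    = (\<integral>\<^sup>+y. ennreal (exp (- (y \<bullet> y / 2))) * f (q, oframe q *v y) \<partial>lborel)"
proof -
  let ?B = "oframe q"
  define P where "P y g = pu q (s *\<^sub>R (?B *v y)) g" for y g
  define R where "R = (\<lambda>(y, g). (transpose ?B *v (Minv *v P y g),
      g - (1/2) *\<^sub>R (noise *v (Minv *v (s *\<^sub>R (?B *v y) + P y g)))))"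
  have P: "P (y + y') (g + g') = P y g + P y' g'" "P (c *\<^sub>R y) (c *\<^sub>R g) = c *\<^sub>R P y g" for y y' g g' c
    using linear_add[OF linear_momentum_update[OF q], of "(s *\<^sub>R (?B *v y), g)" "(s *\<^sub>R (?B *v y'), g')"]
      linear_cmul[OF linear_momentum_update[OF q], of c "(s *\<^sub>R (?B *v y), g)"]
    by (simp_all add: P_def matrix_vector_right_distrib scaleR_right_distrib matrix_vector_mult_scaleR mult.commute)
  have lin: "linear R"
    unfolding R_def split_beta
    by (intro linearI) (simp_all add: P matrix_vector_right_distrib matrix_vector_mult_scaleR algebra_simps)
  have T: "s *\<^sub>R (?B *v y) \<in> cotangent_space M \<xi> q" for y
    using oframe(1)[OF q] by (metis matrix_vector_mult_scaleR rangeI)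
  have BP: "?B *v (transpose ?B *v (Minv *v P y g)) = P y g" for y g
    unfolding P_def by (rule oframe_coords[OF q momentum_update_properties(1)[OF q]])
  have norm: "norm (R z) = norm z" for z
  proof -
    obtain y g where z: "z = (y, g)" by fastforce
    let ?y' = "transpose ?B *v (Minv *v P y g)"
    have "s * s = 1" using s by (metis abs_mult_self_eq mult_1)
    then have 1: "(s *\<^sub>R (?B *v y)) \<bullet> (Minv *v (s *\<^sub>R (?B *v y))) = y \<bullet> y"
      using oframe_inner[OF q, of y y] by (simp add: matrix_vector_mult_scaleR mult.assoc[symmetric])
    have 2: "P y g \<bullet> (Minv *v P y g) = ?y' \<bullet> ?y'"
      using oframe_inner[OF q, of ?y' ?y'] by (simp add: BP)
    have "R z \<bullet> R z = z \<bullet> z"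
      using momentum_update_energy[OF q T[of y], of g, folded P_def]
      unfolding 1 2 z R_def by (simp only: inner_Pair prod.case)
    then show ?thesis by (simp add: norm_eq_sqrt_inner)
  qed
  have "(\<integral>\<^sup>+y. ennreal (exp (- (y \<bullet> y / 2))) * (\<integral>\<^sup>+g. f (q, ?B *v fst (R (y, g))) \<partial>std_gaussian) \<partial>lborel)
    = (\<integral>\<^sup>+y. ennreal (exp (- (y \<bullet> y / 2))) * f (q, ?B *v y) \<partial>lborel)"
    by (rule nn_integral_gaussian_rotation[OF lin norm F])
  then show ?thesis
    by (simp add: R_def BP) (simp add: P_def)
qed

lemma measurable_momentum_step:
  "(\<lambda>(x, g). (fst x, pu (fst x) (s *\<^sub>R snd x) g)) \<in> phase \<Otimes>\<^sub>M borel \<rightarrow>\<^sub>M phase"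
proof (rule measurable_phaseI)
  have "continuous_on (TS \<times> UNIV) (\<lambda>z. (fst (fst z), pu (fst (fst z)) (s *\<^sub>R snd (fst z)) (snd z)))"
    by (intro continuous_intros
        continuous_on_compose2[OF continuous_on_momentum_update, of _ "\<lambda>z. (fst (fst z), s *\<^sub>R snd (fst z), snd z)", simplified])
       (auto simp: TS_iff)
  from borel_measurable_continuous_on_restrict[OF this]
  have m: "(\<lambda>(x, g). (fst x, pu (fst x) (s *\<^sub>R snd x) g)) \<in> borel_measurable (restrict_space borel (TS \<times> (UNIV :: (real^'d) set)))"
    by (simp add: split_beta)
  have "fst \<in> phase \<Otimes>\<^sub>M (borel :: (real^'d) measure) \<rightarrow>\<^sub>M borel"
    by (rule measurable_compose[OF measurable_fst]) (rule measurable_restrict_space1, simp)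
  then have "(\<lambda>z. (fst z, snd z)) \<in> borel_measurable (phase \<Otimes>\<^sub>M (borel :: (real^'d) measure))"
    by (intro borel_measurable_Pair measurable_snd)
  then have "(\<lambda>z. z) \<in> phase \<Otimes>\<^sub>M (borel :: (real^'d) measure) \<rightarrow>\<^sub>M restrict_space borel (TS \<times> UNIV)"
    by (intro measurable_restrict_space2) (auto simp: space_pair_measure space_phase)
  from measurable_compose[OF this m]
  show "(\<lambda>(x, g). (fst x, pu (fst x) (s *\<^sub>R snd x) g)) \<in> borel_measurable (phase \<Otimes>\<^sub>M borel)" .
next
  fix z assume "z \<in> space (phase \<Otimes>\<^sub>M (borel :: (real^'d) measure))"
  then show "(case z of (x, g) \<Rightarrow> (fst x, pu (fst x) (s *\<^sub>R snd x) g)) \<in> TS"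
    using momentum_update_properties(1) by (auto simp: space_pair_measure space_phase TS_iff)
qed

proposition momentum_step_invariant:
  fixes s :: real
  assumes s: "\<bar>s\<bar> = 1" and f [measurable]: "f \<in> borel_measurable phase"
  shows "(\<integral>\<^sup>+x. \<integral>\<^sup>+g. f (fst x, pu (fst x) (s *\<^sub>R snd x) g) \<partial>std_gaussian \<partial>\<mu>) = (\<integral>\<^sup>+x. f x \<partial>\<mu>)"
proof -
  interpret G: prob_space "std_gaussian :: (real^'d) measure" by (rule prob_space_std_gaussian)
  let ?h = "\<lambda>x. \<integral>\<^sup>+g. f (fst x, pu (fst x) (s *\<^sub>R snd x) g) \<partial>std_gaussian"
  have m: "(\<lambda>(x, g). f (fst x, pu (fst x) (s *\<^sub>R snd x) g)) \<in> borel_measurable (phase \<Otimes>\<^sub>M std_gaussian)"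
    using measurable_compose[OF measurable_momentum_step[of s] f]
    by (simp add: split_beta cong: measurable_cong_sets sets_pair_measure_cong)
  have h [measurable]: "?h \<in> borel_measurable phase"
    using G.borel_measurable_nn_integral[OF m] by simp
  have fiber: "(\<integral>\<^sup>+y. ennreal (exp (- H (q, oframe q *v y))) * k (q, oframe q *v y) \<partial>lborel)
     = ennreal (exp (- V q)) * (\<integral>\<^sup>+y. ennreal (exp (- (y \<bullet> y / 2))) * k (q, oframe q *v y) \<partial>lborel)"
    if q: "q \<in> S" and k: "k \<in> borel_measurable phase" for q k
  proof -
    have [measurable]: "(\<lambda>y. k (q, oframe q *v y)) \<in> borel_measurable borel"
      by (rule section_measurable[OF k q]) (simp add: oframe[OF q])
    have "(\<integral>\<^sup>+y. ennreal (exp (- H (q, oframe q *v y))) * k (q, oframe q *v y) \<partial>lborel)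
      = (\<integral>\<^sup>+y. ennreal (exp (- V q)) * (ennreal (exp (- (y \<bullet> y / 2))) * k (q, oframe q *v y)) \<partial>lborel)"
    proof (rule nn_integral_cong)
      fix y :: "real^'k"
      have "exp (- H (q, oframe q *v y)) = exp (- V q) * exp (- (y \<bullet> y / 2))"
        by (simp add: H_oframe[OF q] exp_add[symmetric])
      then show "ennreal (exp (- H (q, oframe q *v y))) * k (q, oframe q *v y)
        = ennreal (exp (- V q)) * (ennreal (exp (- (y \<bullet> y / 2))) * k (q, oframe q *v y))"
        by (simp add: ennreal_mult' mult.assoc)
    qed
    also have "\<dots> = ennreal (exp (- V q)) * (\<integral>\<^sup>+y. ennreal (exp (- (y \<bullet> y / 2))) * k (q, oframe q *v y) \<partial>lborel)"
      by (rule nn_integral_cmult) measurable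
    finally show ?thesis .
  qed
  have "(\<integral>\<^sup>+x. ennreal (exp (- H x)) * ?h x \<partial>\<L>) = (\<integral>\<^sup>+x. ennreal (exp (- H x)) * f x \<partial>\<L>)"
  proof -
    have "(\<integral>\<^sup>+x. ennreal (exp (- H x)) * ?h x \<partial>\<L>)
      = (\<integral>\<^sup>+q. \<integral>\<^sup>+y. ennreal (exp (- H (q, oframe q *v y))) * ?h (q, oframe q *v y) \<partial>lborel \<partial>\<sigma>)"
      by (rule nn_integral_liouville) measurable
    also have "\<dots> = (\<integral>\<^sup>+q. \<integral>\<^sup>+y. ennreal (exp (- H (q, oframe q *v y))) * f (q, oframe q *v y) \<partial>lborel \<partial>\<sigma>)"
    proof (rule nn_integral_cong)
      fix q assume "q \<in> space \<sigma>"
      then have q: "q \<in> S" by (simp add: space_\<sigma>)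
      have "(\<lambda>y. f (q, oframe q *v y)) \<in> borel_measurable borel"
        by (rule section_measurable[OF f q]) (simp add: oframe[OF q])
      from fiber_invariance[OF q s this]
      show "(\<integral>\<^sup>+y. ennreal (exp (- H (q, oframe q *v y))) * ?h (q, oframe q *v y) \<partial>lborel)
        = (\<integral>\<^sup>+y. ennreal (exp (- H (q, oframe q *v y))) * f (q, oframe q *v y) \<partial>lborel)"
        unfolding fiber[OF q h] fiber[OF q f] by simp
    qed
    also have "\<dots> = (\<integral>\<^sup>+x. ennreal (exp (- H x)) * f x \<partial>\<L>)"
      by (rule nn_integral_liouville[symmetric]) measurable
    finally show ?thesis .
  qed
  then show ?thesis
    by (simp add: nn_integral_\<mu>[OF h] nn_integral_\<mu>[OF f])
qed

end

section \<open>The RATTLE map\<close>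

lemma C1_on_subset_imp_continuous_on:
  assumes "C1_on_subset D f"
  shows "continuous_on D f"
proof (rule continuous_on_eq_continuous_within[THEN iffD2], rule ballI)
  fix x assume x: "x \<in> D"
  then obtain W F where W: "open W" "x \<in> W" "Ck_on 1 W F" "\<forall>y\<in>W \<inter> D. F y = f y"
    using assms unfolding C1_on_subset_def by blast
  have "F differentiable (at x)" using W(2,3) by simp
  then have "continuous (at x within D) F"
    by (simp add: differentiable_imp_continuous_within continuous_at_imp_continuous_at_within)
  moreover obtain e where "e > 0" "ball x e \<subseteq> W"
    using W(1,2) open_contains_ball by blast
  ultimately show "continuous (at x within D) f"
    using W(4) x by (intro continuous_transform_within[of x D F e f]) (auto simp: dist_commute subset_iff)
qed

locale constrained_ghmc = constrained_langevin M \<xi> kdim V dt \<gamma>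
  for M :: "real^'d^'d" and \<xi> :: "real^'d \<Rightarrow> real^'m" and kdim :: "'k::finite itself" and V dt \<gamma> +
  fixes D :: "((real^'d) \<times> (real^'d)) set" and \<Lambda> :: "(real^'d) \<times> (real^'d) \<Rightarrow> real^'m"
  assumes adm: "admissible M \<xi> D \<Lambda>"
begin

abbreviation "\<Psi> \<equiv> rattle M \<xi> V \<Lambda> dt"
abbreviation "A \<equiv> rattle_domain M \<xi> V D dt"
abbreviation "B \<equiv> reversible_domain M \<xi> V D \<Lambda> dt"
abbreviation "\<Phi> \<equiv> rattle_rev M \<xi> V D \<Lambda> dt"

lemma D_borel: "D \<in> sets borel"
  and continuous_\<Lambda>: "continuous_on D \<Lambda>"
  and projection: "(q, q') \<in> D \<Longrightarrow> q' + Minv *v (nabla \<xi> q *v \<Lambda> (q, q')) \<in> S"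
proof -
  have "openin (top_of_set (S \<times> UNIV)) D"
    using adm by (simp add: admissible_def)
  then obtain T where "open T" "D = (S \<times> UNIV) \<inter> T" by (auto simp: openin_open)
  moreover have "closed (S \<times> (UNIV :: (real^'d) set))" by (intro closed_Times closed_S closed_UNIV)
  ultimately show "D \<in> sets borel" by (auto intro: sets.Int)
  show "continuous_on D \<Lambda>" "(q, q') \<in> D \<Longrightarrow> q' + Minv *v (nabla \<xi> q *v \<Lambda> (q, q')) \<in> S"
    using adm by (auto simp: admissible_def Let_def intro: C1_on_subset_imp_continuous_on)
qed

subsection \<open>The generating map on pairs of positions\<close>

text \<open>The phase space point at \<open>q\<close> from which RATTLE moves to \<open>q1\<close>. In canonical coordinates its momentum is
  the derivative \<open>-\<partial>S/\<partial>q\<close> of the discrete action \<open>S(q, q1) = |q1 - q|\<^sub>M\<^sup>2 / (2 dt) - dt/2 (V q + V q1)\<close>. The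
  symmetry of \<open>S\<close> lies behind \<open>rattle_transition\<close>: if \<open>x = transition q q1\<close> then \<open>\<Psi> x = transition q1 q\<close>.\<close>

definition "proj q r = r + nabla \<xi> q *v multiplier Minv q r"

definition transition :: "real^'d \<Rightarrow> real^'d \<Rightarrow> (real^'d) \<times> (real^'d)"
  where "transition q q1 = (q, proj q ((1/dt) *\<^sub>R (M *v (q1 - q)) + (dt/2) *\<^sub>R grad V q))"

lemma proj_cotangent: "q \<in> S \<Longrightarrow> proj q r \<in> cotangent_space M \<xi> q"
  using multiplier_iff[OF _ spd_Minv, of q r "multiplier Minv q r"] by (simp add: proj_def cotangent_space_def)

lemma proj_normal:
  assumes q: "q \<in> S" and p: "p \<in> cotangent_space M \<xi> q"
  shows "proj q (p + nabla \<xi> q *v l) = p"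
proof -
  have "transpose (nabla \<xi> q) *v (Minv *v ((p + nabla \<xi> q *v l) + nabla \<xi> q *v (- l))) = 0"
    using p by (simp add: cotangent_space_def matrix_vector_mult_minus_right)
  then have "multiplier Minv q (p + nabla \<xi> q *v l) = - l"
    using multiplier_iff[OF q spd_Minv] by metis
  then show ?thesis by (simp add: proj_def matrix_vector_mult_minus_right)
qed

lemma proj_minus: "proj q (- r) = - proj q r"
  by (simp add: proj_def multiplier_def matrix_vector_mult_minus_right)

lemma rattle_transition:
  assumes x: "(q, p) \<in> A"
  defines "q1 \<equiv> unconstrained_position M V dt (q, p)
    + Minv *v (nabla \<xi> q *v \<Lambda> (q, unconstrained_position M V dt (q, p)))"
  shows "q \<in> S" "q1 \<in> S" "(q, p) = transition q q1" "\<Psi> (q, p) = transition q1 q" "fst (\<Psi> (q, p)) = q1"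
proof -
  let ?u = "unconstrained_position M V dt (q, p)"
  have xT: "q \<in> S" "p \<in> cotangent_space M \<xi> q" and D: "(q, ?u) \<in> D"
    using x by (auto simp: rattle_domain_def cotangent_bundle_def)
  then show q: "q \<in> S" by simp
  show q1: "q1 \<in> S" unfolding q1_def by (rule projection[OF D])
  define ph where "ph = p - (dt/2) *\<^sub>R grad V q + nabla \<xi> q *v ((1/dt) *\<^sub>R \<Lambda> (q, ?u))"
  have q1_ph: "q1 = q + dt *\<^sub>R (Minv *v ph)"
    using dt by (simp add: q1_def ph_def unconstrained_position_def matrix_vector_right_distrib
        matrix_vector_mult_diff_distrib matrix_vector_mult_scaleR algebra_simps)
  then have ph: "(1/dt) *\<^sub>R (M *v (q1 - q)) = ph"
    using dt by (simp add: matrix_vector_mult_scaleR)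
  have ph': "(1/dt) *\<^sub>R (M *v (q - q1)) = - ph"
    using ph by (metis matrix_vector_mult_minus_right minus_diff_eq scaleR_minus_right)
  have "(1/dt) *\<^sub>R (M *v (q1 - q)) + (dt/2) *\<^sub>R grad V q = p + nabla \<xi> q *v ((1/dt) *\<^sub>R \<Lambda> (q, ?u))"
    unfolding ph by (simp add: ph_def)
  then show "(q, p) = transition q q1"
    by (simp add: transition_def proj_normal[OF xT])
  define r where "r = ph - (dt/2) *\<^sub>R grad V q1"
  have "(THE l. transpose (nabla \<xi> q1) *v (Minv *v (r + nabla \<xi> q1 *v l)) = 0) = multiplier Minv q1 r"
    by (rule the_equality) (simp_all add: multiplier_iff[OF q1 spd_Minv])
  moreover have "\<Psi> (q, p) = (q1, - (r + nabla \<xi> q1 *v (THE l. transpose (nabla \<xi> q1) *v (Minv *v (r + nabla \<xi> q1 *v l)) = 0)))"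
    by (simp only: rattle_def Let_def prod.case ph_def[symmetric] q1_ph[symmetric] r_def)
  ultimately have "\<Psi> (q, p) = (q1, - proj q1 r)"
    by (simp only: proj_def)
  also have "- proj q1 r = proj q1 ((1/dt) *\<^sub>R (M *v (q - q1)) + (dt/2) *\<^sub>R grad V q1)"
    unfolding proj_minus[symmetric] ph' by (simp add: r_def)
  finally show "\<Psi> (q, p) = transition q1 q" by (simp add: transition_def)
  then show "fst (\<Psi> (q, p)) = q1" by (simp add: transition_def)
qed

lemma continuous_on_transition: "continuous_on (S \<times> UNIV) (\<lambda>(q, q1). transition q q1)"
  unfolding split_beta transition_def proj_def multiplier_def
  by (intro continuous_intros invertible_projected_gram[OF _ spd_Minv]) auto

lemma A_subset: "A \<subseteq> TS" by (auto simp: rattle_domain_def)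

lemma continuous_unconstrained: "continuous_on X (\<lambda>x. unconstrained_position M V dt x)"
  unfolding unconstrained_position_def split_beta by (intro continuous_intros)

lemma A_borel [measurable]: "A \<in> sets borel"
proof -
  have "(\<lambda>x. (fst x, unconstrained_position M V dt x)) \<in> borel \<rightarrow>\<^sub>M borel"
    by (intro borel_measurable_continuous_onI continuous_intros continuous_unconstrained)
  from measurable_sets[OF this D_borel]
  have "TS \<inter> ((\<lambda>x. (fst x, unconstrained_position M V dt x)) -` D) \<in> sets borel" by simp
  also have "TS \<inter> ((\<lambda>x. (fst x, unconstrained_position M V dt x)) -` D) = A"
    by (auto simp: rattle_domain_def)
  finally show ?thesis .
qed

lemma continuous_\<Psi>: "continuous_on A \<Psi>"
proof -
  let ?u = "unconstrained_position M V dt"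
  let ?q1 = "\<lambda>x. ?u x + Minv *v (nabla \<xi> (fst x) *v \<Lambda> (fst x, ?u x))"
  have "continuous_on A ?q1"
    by (intro continuous_intros continuous_unconstrained continuous_on_compose2[OF continuous_\<Lambda>])
       (auto simp: rattle_domain_def)
  then have "continuous_on A (\<lambda>x. (?q1 x, fst x))"
    by (rule continuous_on_Pair) (intro continuous_intros)
  then have "continuous_on A (\<lambda>x. case (?q1 x, fst x) of (q, q1) \<Rightarrow> transition q q1)"
    by (rule continuous_on_compose2[OF continuous_on_transition])
       (use rattle_transition(2) in auto)
  then show ?thesis
    by (rule continuous_on_eq) (auto simp: rattle_transition(4))
qed

text \<open>Nothing is known about \<open>\<Lambda>\<close> outside \<open>D\<close>, so \<open>\<Psi>\<close> is replaced by the identity outside \<open>A\<close> to get a Borel map.\<close>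

definition "\<Psi>' x = (if x \<in> A then \<Psi> x else x)"

lemma \<Psi>'_borel: "\<Psi>' \<in> borel \<rightarrow>\<^sub>M borel"
  unfolding \<Psi>'_def by (intro borel_measurable_continuous_on_if A_borel continuous_\<Psi> continuous_intros)

lemma B_borel [measurable]: "B \<in> sets borel"
proof -
  note [measurable] = \<Psi>'_borel
  have "{x \<in> space borel. x \<in> A \<and> \<Psi>' x \<in> A \<and> \<Psi>' (\<Psi>' x) = x} \<in> sets borel"
    by measurable
  also have "{x \<in> space borel. x \<in> A \<and> \<Psi>' x \<in> A \<and> \<Psi>' (\<Psi>' x) = x} = B"
    by (auto simp: reversible_domain_def \<Psi>'_def)
  finally show ?thesis .
qed

lemma B_subset: "B \<subseteq> A" "B \<subseteq> TS"
  using A_subset by (auto simp: reversible_domain_def)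

lemma B_sets: "B \<in> sets phase"
  using B_subset B_borel by (simp add: sets_phase_iff)

lemma \<Psi>_B: "x \<in> B \<Longrightarrow> \<Psi> x \<in> B" "x \<in> B \<Longrightarrow> \<Psi> (\<Psi> x) = x"
  by (auto simp: reversible_domain_def)

lemma \<Phi>_involution: "\<Phi> (\<Phi> x) = x"
  using \<Psi>_B by (simp add: rattle_rev_def)

lemma measurable_\<Phi> [measurable]: "\<Phi> \<in> phase \<rightarrow>\<^sub>M phase"
proof (rule measurable_phaseI)
  note [measurable] = \<Psi>'_borel
  have "(\<lambda>x. if x \<in> B then \<Psi>' x else x) \<in> borel \<rightarrow>\<^sub>M borel" by measurable
  moreover have "(\<lambda>x. if x \<in> B then \<Psi>' x else x) = \<Phi>"
    using B_subset by (auto simp: rattle_rev_def \<Psi>'_def fun_eq_iff)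
  ultimately show "\<Phi> \<in> borel_measurable phase"
    by (simp add: measurable_restrict_space1)
  show "x \<in> space phase \<Longrightarrow> \<Phi> x \<in> TS" for x
    using subsetD[OF B_subset(2) \<Psi>_B(1)[of x]] by (simp add: rattle_rev_def space_phase)
qed

subsection \<open>Preservation of the Liouville measure\<close>

text \<open>For \<open>X \<subseteq> A\<close>, \<open>transition\<close> maps these pairs bijectively onto \<open>X\<close>: the constraint equation may have several
  solutions \<open>q1\<close>, and the last condition selects the one given by \<open>\<Lambda>\<close>.\<close>

definition links :: "((real^'d) \<times> (real^'d)) set \<Rightarrow> ((real^'d) \<times> (real^'d)) set"
  where "links X = {(q, q1). q \<in> S \<and> q1 \<in> S \<and> transition q q1 \<in> X \<and> fst (\<Psi>' (transition q q1)) = q1}"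

text \<open>The density of the Liouville measure in the parametrization by pairs of positions: the absolute
  determinant of the mixed second derivative of the discrete action, in the frames at the two points
  and normalized by their volumes.\<close>

definition link_density :: "real^'d \<Rightarrow> real^'d \<Rightarrow> real"
  where "link_density q q1 = \<bar>det (mat (1/dt) :: real^'k^'k)\<bar>
    * \<bar>det (transpose (frame q) ** Minv ** frame q1)\<bar> / (frame_vol q * frame_vol q1)"

lemma link_density_sym: "link_density q q1 = link_density q1 q"
proof -
  have "transpose (frame q ) ** Minv ** frame q1 = transpose (transpose (frame q1) ** Minv ** frame q)"
    by (simp add: matrix_transpose_mul spdD(1)[OF spd_Minv] matrix_mul_assoc)
  then show ?thesis
    by (simp add: link_density_def mult.commute)
qed

lemma id_pair_\<sigma>: "(\<lambda>z. z) \<in> \<sigma> \<Otimes>\<^sub>M \<sigma> \<rightarrow>\<^sub>M restrict_space borel (S \<times> S)"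
proof (rule measurable_restrict_space2)
  have "(\<lambda>z. (fst z, snd z)) \<in> borel_measurable (\<sigma> \<Otimes>\<^sub>M \<sigma>)"
    by (intro borel_measurable_Pair measurable_compose[OF measurable_fst id_\<sigma>] measurable_compose[OF measurable_snd id_\<sigma>])
  then show "(\<lambda>z. z) \<in> borel_measurable (\<sigma> \<Otimes>\<^sub>M \<sigma>)" by simp
qed (auto simp: space_pair_measure space_\<sigma>)

lemma measurable_transition: "(\<lambda>(q, q1). transition q q1) \<in> \<sigma> \<Otimes>\<^sub>M \<sigma> \<rightarrow>\<^sub>M borel"
proof -
  have "continuous_on (S \<times> S) (\<lambda>(q, q1). transition q q1)"
    by (rule continuous_on_subset[OF continuous_on_transition]) auto
  from measurable_compose[OF id_pair_\<sigma> borel_measurable_continuous_on_restrict[OF this]]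
  show ?thesis by simp
qed

lemma measurable_link_density: "(\<lambda>(q, q1). link_density q q1) \<in> borel_measurable (\<sigma> \<Otimes>\<^sub>M \<sigma>)"
proof -
  note [measurable] = frame_vol_\<sigma>
  have c: "(\<lambda>z :: (real^'k^'d) \<times> (real^'k^'d). \<bar>det (transpose (fst z) ** Minv ** snd z)\<bar>) \<in> borel_measurable borel"
    by (intro borel_measurable_continuous_onI continuous_intros)
  have "(\<lambda>z. (frame (fst z), frame (snd z))) \<in> borel_measurable (\<sigma> \<Otimes>\<^sub>M \<sigma>)"
    by (intro borel_measurable_Pair measurable_compose[OF measurable_fst frame_\<sigma>] measurable_compose[OF measurable_snd frame_\<sigma>])
  from measurable_compose[OF this c]
  have [measurable]: "(\<lambda>z. \<bar>det (transpose (frame (fst z)) ** Minv ** frame (snd z))\<bar>) \<in> borel_measurable (\<sigma> \<Otimes>\<^sub>M \<sigma>)"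
    by simp
  show ?thesis
    unfolding link_density_def split_beta by measurable
qed

lemma links_measurable:
  assumes X: "X \<in> sets phase"
  shows "links X \<in> sets (\<sigma> \<Otimes>\<^sub>M \<sigma>)"
proof -
  have X' [measurable]: "X \<in> sets borel" using X by (simp add: sets_phase_iff)
  have t [measurable]: "(\<lambda>z. transition (fst z) (snd z)) \<in> \<sigma> \<Otimes>\<^sub>M \<sigma> \<rightarrow>\<^sub>M borel"
    using measurable_transition by (simp add: split_beta)
  have f: "(\<lambda>x. fst (\<Psi>' x)) \<in> borel \<rightarrow>\<^sub>M borel"
    by (rule measurable_compose[OF \<Psi>'_borel]) (intro borel_measurable_continuous_onI continuous_intros)
  have f' [measurable]: "(\<lambda>z. fst (\<Psi>' (transition (fst z) (snd z)))) \<in> \<sigma> \<Otimes>\<^sub>M \<sigma> \<rightarrow>\<^sub>M borel"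
    by (rule measurable_compose[OF t f])
  have s [measurable]: "snd \<in> \<sigma> \<Otimes>\<^sub>M \<sigma> \<rightarrow>\<^sub>M (borel :: (real^'d) measure)"
    by (rule measurable_compose[OF measurable_snd id_\<sigma>])
  have "{z \<in> space (\<sigma> \<Otimes>\<^sub>M \<sigma>). transition (fst z) (snd z) \<in> X \<and> fst (\<Psi>' (transition (fst z) (snd z))) = snd z} \<in> sets (\<sigma> \<Otimes>\<^sub>M \<sigma>)"
    by measurable
  also have "{z \<in> space (\<sigma> \<Otimes>\<^sub>M \<sigma>). transition (fst z) (snd z) \<in> X \<and> fst (\<Psi>' (transition (fst z) (snd z))) = snd z} = links X"
    by (auto simp: links_def space_pair_measure space_\<sigma>)
  finally show ?thesis .
qed

lemma mat_vector_mult: "mat c *v x = c *\<^sub>R x" for x :: "real^'n"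
  by (simp add: vec_eq_iff matrix_vector_mult_def mat_def if_distrib if_distribR cong: if_cong)

text \<open>For fixed \<open>q\<close>, the coordinates of the momentum in the frame at \<open>q\<close> are an affine function of \<open>q1\<close>, because
  the projection onto the cotangent space only removes a multiple of \<open>\<nabla>\<xi>(q)\<close>, which \<open>coord\<close> annihilates. The
  area formula applies, with \<open>q1\<close> recovered from the momentum by the RATTLE map itself.\<close>

lemma fiber_area:
  assumes X: "X \<in> sets phase" "X \<subseteq> A" and q: "q \<in> S"
  shows "(\<integral>\<^sup>+y. ennreal (frame_vol q) * indicator X (q, frame q *v y) \<partial>lborel)
    = (\<integral>\<^sup>+q1. indicator (links X) (q, q1) * ennreal (link_density q q1) \<partial>\<sigma>)"
proof -
  let ?C = "frame q"
  let ?G = "transpose ?C ** Minv ** ?C"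
  have G: "invertible ?G" by (rule spd_invertible[OF spd_congruence[OF spd_Minv inj_frame[OF q]]])
  define K where "K = mat (1/dt) ** (matrix_inv ?G ** transpose ?C)"
  define coord where "coord p = matrix_inv ?G *v (transpose ?C *v (Minv *v p))" for p
  define c where "c = coord ((dt/2) *\<^sub>R grad V q) - K *v q"
  define Y where "Y = {y. (q, ?C *v y) \<in> X}"
  define E where "E = {q1. (q, q1) \<in> links X}"
  define h where "h y = fst (\<Psi>' (q, ?C *v y))" for y
  have coord_frame: "coord (?C *v y) = y" for y
  proof -
    have "transpose ?C *v (Minv *v (?C *v y)) = ?G *v y"
      by (simp add: matrix_vector_mul_assoc matrix_mul_assoc)
    then show ?thesis using G by (simp add: coord_def)
  qed
  have frame_coord: "?C *v coord p = p" if "p \<in> cotangent_space M \<xi> q" for p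
    using that range_frame[OF q] coord_frame by (metis rangeE)
  have coord_add: "coord (a + b) = coord a + coord b" for a b
    by (simp add: coord_def matrix_vector_right_distrib)
  have normal: "coord (nabla \<xi> q *v l) = 0" for l
  proof -
    have "y \<bullet> (transpose ?C *v (Minv *v (nabla \<xi> q *v l))) = 0" for y
    proof -
      have "?C *v y \<in> cotangent_space M \<xi> q" using range_frame[OF q] by blast
      then have "transpose (nabla \<xi> q) *v (Minv *v (?C *v y)) = 0" by (simp add: cotangent_space_def)
      then have "(Minv *v (?C *v y)) \<bullet> (nabla \<xi> q *v l) = 0"
        by (simp add: inner_matrix_transpose)
      then show ?thesis
        by (simp add: inner_matrix_transpose[of y "transpose ?C"] transpose_transpose spd_inner_swap[OF spd_Minv])
    qed
    then have "transpose ?C *v (Minv *v (nabla \<xi> q *v l)) = 0"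
      by (metis inner_eq_zero_iff)
    then show ?thesis by (simp add: coord_def)
  qed
  have affine: "coord (snd (transition q q1)) = K *v q1 + c" for q1
  proof -
    have "coord (snd (transition q q1)) = coord ((1/dt) *\<^sub>R (M *v (q1 - q))) + coord ((dt/2) *\<^sub>R grad V q)"
      by (simp add: transition_def proj_def coord_add normal)
    also have "coord ((1/dt) *\<^sub>R (M *v (q1 - q))) = K *v (q1 - q)"
      by (simp add: coord_def K_def matrix_vector_mul_assoc[symmetric] mat_vector_mult matrix_vector_mult_scaleR)
    finally show ?thesis
      by (simp add: c_def matrix_vector_mult_diff_distrib)
  qed
  have transition_eq: "(q, ?C *v (K *v q1 + c)) = transition q q1" for q1
    using frame_coord[of "snd (transition q q1)"] proj_cotangent[OF q]
    by (simp add: affine[symmetric]) (simp add: transition_def)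
  have hE: "h (K *v q1 + c) = q1" if "q1 \<in> E" for q1
    using that by (simp add: h_def transition_eq E_def links_def)
  have YE: "(\<lambda>q1. K *v q1 + c) ` E = Y"
  proof (intro subset_antisym subsetI)
    fix y assume "y \<in> (\<lambda>q1. K *v q1 + c) ` E"
    then show "y \<in> Y" by (auto simp: Y_def E_def links_def transition_eq)
  next
    fix y assume y: "y \<in> Y"
    then have xA: "(q, ?C *v y) \<in> A" using X(2) by (auto simp: Y_def)
    obtain q1 where q1: "q1 \<in> S" "(q, ?C *v y) = transition q q1" "fst (\<Psi> (q, ?C *v y)) = q1"
      using rattle_transition[OF xA] by blast
    then have "q1 \<in> E"
      using y q xA by (auto simp: E_def links_def Y_def \<Psi>'_def)
    moreover have "K *v q1 + c = y"
      unfolding affine[symmetric] q1(2)[symmetric] by (simp add: coord_frame)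
    ultimately show "y \<in> (\<lambda>q1. K *v q1 + c) ` E" by blast
  qed
  have pairC: "(\<lambda>y. (q, ?C *v y)) \<in> borel \<rightarrow>\<^sub>M borel"
    by (intro borel_measurable_continuous_onI continuous_intros)
  have Ym: "Y \<in> sets borel"
    using measurable_sets[OF pairC, of X] X(1) by (simp add: Y_def sets_phase_iff vimage_def)
  have hm: "h \<in> borel_measurable borel"
    unfolding h_def
    by (rule measurable_compose[OF measurable_compose[OF pairC \<Psi>'_borel]])
       (intro borel_measurable_continuous_onI continuous_intros)
  have E: "E \<in> sets \<sigma>"
    using sets_Pair1[OF links_measurable[OF X(1)], of q] by (simp add: E_def vimage_def)
  then have Eb: "E \<in> sets borel" "E \<subseteq> S"
    by (auto simp: sets_\<sigma> sets_restrict_space_iff)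
  have "(\<integral>\<^sup>+y. ennreal (frame_vol q) * indicator X (q, ?C *v y) \<partial>lborel) = ennreal (frame_vol q) * emeasure lborel Y"
  proof -
    have "(\<integral>\<^sup>+y. ennreal (frame_vol q) * indicator X (q, ?C *v y) \<partial>lborel) = (\<integral>\<^sup>+y. ennreal (frame_vol q) * indicator Y y \<partial>lborel)"
      by (intro nn_integral_cong) (auto simp: Y_def indicator_def)
    then show ?thesis using Ym by (simp add: nn_integral_cmult)
  qed
  also have "emeasure lborel Y = (\<integral>\<^sup>+q1\<in>E. ennreal (\<bar>det (K ** Minv ** frame q1)\<bar> / frame_vol q1) \<partial>\<sigma>)"
    by (rule area_formula[OF Eb YE Ym]) (use hm hE in \<open>auto intro: measurable_restrict_space1\<close>)
  also have "ennreal (frame_vol q) * \<dots> = (\<integral>\<^sup>+q1. ennreal (frame_vol q) * (ennreal (\<bar>det (K ** Minv ** frame q1)\<bar> / frame_vol q1) * indicator E q1) \<partial>\<sigma>)"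
  proof (rule nn_integral_cmult[symmetric])
    have "(\<lambda>F :: real^'k^'d. \<bar>det (K ** Minv ** F)\<bar>) \<in> borel_measurable borel"
      by (intro borel_measurable_continuous_onI continuous_intros)
    from measurable_compose[OF frame_\<sigma> this]
    have "(\<lambda>q1. \<bar>det (K ** Minv ** frame q1)\<bar>) \<in> borel_measurable \<sigma>" .
    then show "(\<lambda>q1. ennreal (\<bar>det (K ** Minv ** frame q1)\<bar> / frame_vol q1) * indicator E q1) \<in> borel_measurable \<sigma>"
      using frame_vol_\<sigma> E by measurable
  qed
  also have "\<dots> = (\<integral>\<^sup>+q1. indicator (links X) (q, q1) * ennreal (link_density q q1) \<partial>\<sigma>)"
  proof (rule nn_integral_cong)
    fix q1 assume "q1 \<in> space \<sigma>"
    then have q1: "q1 \<in> S" by (simp add: space_\<sigma>)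
    have pos: "frame_vol q > 0" "frame_vol q1 > 0" using frame_vol_pos q q1 by auto
    have "det ?G > 0" by (rule spd_det_pos[OF spd_congruence[OF spd_Minv inj_frame[OF q]]])
    then have detG: "det ?G = (frame_vol q)^2"
      by (simp add: frame_vol_def)
    have "det ?G * det (matrix_inv ?G) = 1"
      using matrix_inv(1)[OF G] by (metis det_I det_mul)
    then have "det (matrix_inv ?G) = 1 / (frame_vol q)^2"
      unfolding detG using pos by (simp add: field_simps)
    moreover have "K ** Minv ** frame q1 = mat (1/dt) ** matrix_inv ?G ** (transpose ?C ** Minv ** frame q1)"
      by (simp only: K_def matrix_mul_assoc)
    ultimately have "\<bar>det (K ** Minv ** frame q1)\<bar>
        = \<bar>det (mat (1/dt) :: real^'k^'k)\<bar> * (1 / (frame_vol q)^2) * \<bar>det (transpose ?C ** Minv ** frame q1)\<bar>"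
      by (simp only: det_mul abs_mult) simp
    then have "frame_vol q * (\<bar>det (K ** Minv ** frame q1)\<bar> / frame_vol q1) = link_density q q1"
      using pos by (simp add: link_density_def field_simps power2_eq_square)
    then have "ennreal (frame_vol q) * ennreal (\<bar>det (K ** Minv ** frame q1)\<bar> / frame_vol q1) = ennreal (link_density q q1)"
      using pos by (simp add: ennreal_mult'[symmetric])
    then show "ennreal (frame_vol q) * (ennreal (\<bar>det (K ** Minv ** frame q1)\<bar> / frame_vol q1) * indicator E q1)
      = indicator (links X) (q, q1) * ennreal (link_density q q1)"
      by (simp add: mult.assoc[symmetric] E_def indicator_def)
  qed
  finally show ?thesis .
qed

lemma emeasure_liouville_links:
  assumes X: "X \<in> sets phase" "X \<subseteq> A"
  shows "emeasure \<L> X = (\<integral>\<^sup>+q. \<integral>\<^sup>+q1. indicator (links X) (q, q1) * ennreal (link_density q q1) \<partial>\<sigma> \<partial>\<sigma>)"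
proof -
  have "emeasure \<L> X = (\<integral>\<^sup>+x. indicator X x \<partial>\<L>)"
    using X(1) by (simp add: sets_liouville)
  also have "\<dots> = (\<integral>\<^sup>+q. \<integral>\<^sup>+y. ennreal (frame_vol q) * indicator X (q, frame q *v y) \<partial>lborel \<partial>\<sigma>)"
    using X(1) by (intro nn_integral_liouville_frame) simp
  also have "\<dots> = (\<integral>\<^sup>+q. \<integral>\<^sup>+q1. indicator (links X) (q, q1) * ennreal (link_density q q1) \<partial>\<sigma> \<partial>\<sigma>)"
    by (rule nn_integral_cong) (rule fiber_area[OF X], simp add: space_\<sigma>)
  finally show ?thesis .
qed

text \<open>On \<open>B\<close> the RATTLE map is an involution, and in terms of links it exchanges the two positions.\<close>

lemma links_image:
  assumes X: "X \<subseteq> B" and z: "(q, q1) \<in> links X"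
  shows "(q1, q) \<in> links (\<Psi> ` X)"
proof -
  let ?x = "transition q q1"
  have x: "q \<in> S" "q1 \<in> S" "?x \<in> X" "fst (\<Psi>' ?x) = q1" using z by (auto simp: links_def)
  then have xA: "?x \<in> A" "?x \<in> B" using X B_subset by auto
  obtain p where p: "?x = (q, p)" by (simp add: transition_def)
  have "fst (\<Psi> ?x) = q1" using x(4) xA(1) by (simp add: \<Psi>'_def)
  with rattle_transition[OF xA(1)[unfolded p]] p
  have t: "\<Psi> ?x = transition q1 q" by metis
  have "\<Psi> ?x \<in> A" "\<Psi> (\<Psi> ?x) = ?x" using subsetD[OF B_subset(1) \<Psi>_B(1)[OF xA(2)]] \<Psi>_B(2)[OF xA(2)] by auto
  then have "fst (\<Psi>' (transition q1 q)) = q" unfolding t[symmetric] by (simp add: \<Psi>'_def p)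
  moreover have "transition q1 q \<in> \<Psi> ` X" unfolding t[symmetric] using x(3) by blast
  ultimately show ?thesis using x(1,2) by (simp add: links_def)
qed

text \<open>The link density is symmetric, so exchanging the two positions preserves the measure, by Tonelli's
  theorem.\<close>

lemma emeasure_liouville_image:
  assumes X: "X \<in> sets phase" "X \<subseteq> B" and X': "\<Psi> ` X \<in> sets phase"
  shows "emeasure \<L> (\<Psi> ` X) = emeasure \<L> X"
proof -
  interpret pair_sigma_finite \<sigma> \<sigma> ..
  have XA: "X \<subseteq> A" "\<Psi> ` X \<subseteq> A" "\<Psi> ` X \<subseteq> B"
    using X(2) B_subset \<Psi>_B(1) by blast+
  have "\<Psi> ` \<Psi> ` X = X"
    using X(2) \<Psi>_B(2) by (force simp: image_image)
  then have swap: "(q1, q) \<in> links (\<Psi> ` X) \<longleftrightarrow> (q, q1) \<in> links X" for q q1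
    using links_image[OF X(2)] links_image[OF XA(3)] by metis
  have "emeasure \<L> (\<Psi> ` X) = (\<integral>\<^sup>+q. \<integral>\<^sup>+q1. indicator (links (\<Psi> ` X)) (q, q1) * ennreal (link_density q q1) \<partial>\<sigma> \<partial>\<sigma>)"
    by (rule emeasure_liouville_links[OF X' XA(2)])
  also have "\<dots> = (\<integral>\<^sup>+q. \<integral>\<^sup>+q1. indicator (links X) (q1, q) * ennreal (link_density q1 q) \<partial>\<sigma> \<partial>\<sigma>)"
    using swap by (intro nn_integral_cong) (auto simp: indicator_def link_density_sym)
  also have "\<dots> = (\<integral>\<^sup>+q1. \<integral>\<^sup>+q. indicator (links X) (q1, q) * ennreal (link_density q1 q) \<partial>\<sigma> \<partial>\<sigma>)"
  proof (rule Fubini')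
    have "(\<lambda>z. indicator (links X) z * ennreal (case z of (q1, q) \<Rightarrow> link_density q1 q)) \<in> borel_measurable (\<sigma> \<Otimes>\<^sub>M \<sigma>)"
      using links_measurable[OF X(1)] measurable_link_density by measurable
    then show "(\<lambda>(q1, q). indicator (links X) (q1, q) * ennreal (link_density q1 q)) \<in> borel_measurable (\<sigma> \<Otimes>\<^sub>M \<sigma>)"
      by (simp add: case_prod_beta')
  qed
  also have "\<dots> = emeasure \<L> X"
    by (rule emeasure_liouville_links[OF X(1) XA(1), symmetric])
  finally show ?thesis .
qed

lemma distr_\<Phi>: "distr \<L> phase \<Phi> = \<L>"
proof (rule measure_eqI)
  have \<Phi>_m: "\<Phi> \<in> \<L> \<rightarrow>\<^sub>M phase"
    by (subst measurable_cong_sets[OF sets_liouville refl]) simp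
  fix X assume "X \<in> sets (distr \<L> phase \<Phi>)"
  then have X: "X \<in> sets phase" by simp
  have XT: "X \<subseteq> TS" using X by (simp add: sets_phase_iff)
  have im: "\<Psi> ` (X \<inter> B) = \<Phi> -` X \<inter> TS \<inter> B"
  proof (intro subset_antisym subsetI)
    fix y assume "y \<in> \<Psi> ` (X \<inter> B)"
    then show "y \<in> \<Phi> -` X \<inter> TS \<inter> B"
      using \<Psi>_B B_subset by (auto simp: rattle_rev_def)
  next
    fix y assume y: "y \<in> \<Phi> -` X \<inter> TS \<inter> B"
    then have "\<Psi> y \<in> X \<inter> B" "y = \<Psi> (\<Psi> y)" using \<Psi>_B by (auto simp: rattle_rev_def)
    then show "y \<in> \<Psi> ` (X \<inter> B)" by blast
  qed
  have pre: "\<Phi> -` X \<inter> TS \<in> sets phase"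
    using measurable_sets[OF measurable_\<Phi> X] by (simp add: space_phase)
  have Bs: "B \<in> sets phase" by (rule B_sets)
  have imm: "\<Psi> ` (X \<inter> B) \<in> sets phase" unfolding im using pre Bs by blast
  have "emeasure (distr \<L> phase \<Phi>) X = emeasure \<L> (\<Phi> -` X \<inter> TS)"
    using emeasure_distr[OF \<Phi>_m X] by (simp add: space_liouville)
  also have "\<Phi> -` X \<inter> TS = \<Psi> ` (X \<inter> B) \<union> (X - B)"
    unfolding im
  proof (rule set_eqI)
    fix x show "x \<in> \<Phi> -` X \<inter> TS \<longleftrightarrow> x \<in> \<Phi> -` X \<inter> TS \<inter> B \<union> (X - B)"
      using XT by (cases "x \<in> B") (auto simp: rattle_rev_def)
  qed
  also have "emeasure \<L> \<dots> = emeasure \<L> (\<Psi> ` (X \<inter> B)) + emeasure \<L> (X - B)"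
    using imm X Bs \<Psi>_B(1) by (intro plus_emeasure[symmetric]) (auto simp: sets_liouville)
  also have "emeasure \<L> (\<Psi> ` (X \<inter> B)) = emeasure \<L> (X \<inter> B)"
    by (rule emeasure_liouville_image) (use X Bs imm in auto)
  also have "emeasure \<L> (X \<inter> B) + emeasure \<L> (X - B) = emeasure \<L> ((X \<inter> B) \<union> (X - B))"
    using X Bs by (intro plus_emeasure) (auto simp: sets_liouville)
  also have "(X \<inter> B) \<union> (X - B) = X" by auto
  finally show "emeasure (distr \<L> phase \<Phi>) X = emeasure \<L> X" .
qed (simp add: sets_liouville)

lemma nn_integral_\<Phi>:
  assumes f: "f \<in> borel_measurable phase"
  shows "(\<integral>\<^sup>+x. f (\<Phi> x) \<partial>\<L>) = (\<integral>\<^sup>+x. f x \<partial>\<L>)"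
proof -
  have \<Phi>_m: "\<Phi> \<in> \<L> \<rightarrow>\<^sub>M phase"
    by (subst measurable_cong_sets[OF sets_liouville refl]) simp
  have "(\<integral>\<^sup>+x. f x \<partial>distr \<L> phase \<Phi>) = (\<integral>\<^sup>+x. f (\<Phi> x) \<partial>\<L>)"
    using f by (intro nn_integral_distr[OF \<Phi>_m]) simp
  then show ?thesis by (simp add: distr_\<Phi>)
qed

section \<open>The Metropolis step\<close>

definition mh_step :: "(real^'d) \<times> (real^'d) \<Rightarrow> real \<Rightarrow> (real^'d) \<times> (real^'d)"
  where "mh_step x u = (if u \<le> exp (- H (\<Phi> x) + H x) then \<Phi> x else x)"

abbreviation "unif \<equiv> uniform_measure lborel {0<..<1::real}"

lemma prob_space_unif: "prob_space unif"
  by (rule prob_space_uniform_measure) auto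

lemma measurable_mh_step: "(\<lambda>(x, u). mh_step x u) \<in> phase \<Otimes>\<^sub>M borel \<rightarrow>\<^sub>M phase"
  unfolding mh_step_def split_beta by measurable

lemma nn_integral_unif_threshold:
  assumes t: "t > 0"
  shows "(\<integral>\<^sup>+u. (if u \<le> t then a else b) \<partial>unif) = ennreal (min 1 t) * a + ennreal (1 - min 1 t) * b"
proof -
  have eq: "(if u \<le> t then a else b) = a * indicator {..t} u + b * indicator {t<..} u" for u
    by (auto simp: indicator_def)
  have 1: "{0<..<1} \<inter> {..t} = (if t < 1 then {0<..t} else {0<..<1})"
    and 2: "{0<..<1} \<inter> {t<..} = (if t < 1 then {t<..<1} else {})"
    using t by auto
  have "emeasure unif {..t} = ennreal (min 1 t)" "emeasure unif {t<..} = ennreal (1 - min 1 t)"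
    using t by (simp_all add: emeasure_uniform_measure 1 2 divide_ennreal_def)
  then show ?thesis
    unfolding eq by (subst nn_integral_add) (auto simp: nn_integral_cmult mult.commute)
qed

text \<open>The weight \<open>e\<^sup>-\<^sup>H\<close> times the acceptance probability is \<open>min (e\<^sup>-\<^sup>H) (e\<^sup>-\<^sup>H \<circ> \<Phi>)\<close>, which is invariant under \<open>\<Phi>\<close>.
  As \<open>\<Phi>\<close> preserves the Liouville measure, the accepted mass leaving a region is compensated by that
  entering it.\<close>

proposition mh_step_invariant:
  assumes f [measurable]: "f \<in> borel_measurable phase"
  shows "(\<integral>\<^sup>+x. \<integral>\<^sup>+u. f (mh_step x u) \<partial>unif \<partial>\<mu>) = (\<integral>\<^sup>+x. f x \<partial>\<mu>)"
proof -
  interpret U: prob_space unif by (rule prob_space_unif)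
  let ?t = "\<lambda>x. exp (- H (\<Phi> x) + H x)"
  let ?m = "\<lambda>x. min (exp (- H x)) (exp (- H (\<Phi> x)))"
  let ?h = "\<lambda>x. \<integral>\<^sup>+u. f (mh_step x u) \<partial>unif"
  have m: "(\<lambda>(x, u). f (mh_step x u)) \<in> borel_measurable (phase \<Otimes>\<^sub>M unif)"
    using measurable_compose[OF measurable_mh_step f]
    by (simp add: split_beta cong: measurable_cong_sets sets_pair_measure_cong)
  have h [measurable]: "?h \<in> borel_measurable phase"
    using U.borel_measurable_nn_integral[OF m] by simp
  have H\<Phi> [measurable]: "(\<lambda>x. H (\<Phi> x)) \<in> borel_measurable phase" "(\<lambda>x. f (\<Phi> x)) \<in> borel_measurable phase"
    by (rule measurable_compose[OF measurable_\<Phi>], measurable)+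
  have mt: "exp (- H x) * min 1 (?t x) = ?m x" "exp (- H x) * (1 - min 1 (?t x)) = exp (- H x) - ?m x" for x
  proof -
    have "exp (- H x) * ?t x = exp (- H (\<Phi> x))" by (simp add: exp_add[symmetric])
    then have "exp (- H x) * min 1 (?t x) = ?m x"
      by (simp add: min_mult_distrib_left)
    then show "exp (- H x) * min 1 (?t x) = ?m x" "exp (- H x) * (1 - min 1 (?t x)) = exp (- H x) - ?m x"
      by (simp_all add: right_diff_distrib)
  qed
  have scale: "ennreal e * (ennreal a * X + ennreal b * Y) = ennreal (e * a) * X + ennreal (e * b) * Y"
    if "e \<ge> 0" for e a b X Y
    using that by (simp add: distrib_left ennreal_mult' mult.assoc)
  have step: "ennreal (exp (- H x)) * ?h x = ennreal (?m x) * f (\<Phi> x) + ennreal (exp (- H x) - ?m x) * f x" for x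
  proof -
    have "?h x = (\<integral>\<^sup>+u. (if u \<le> ?t x then f (\<Phi> x) else f x) \<partial>unif)"
      unfolding mh_step_def by (intro nn_integral_cong) auto
    also have "\<dots> = ennreal (min 1 (?t x)) * f (\<Phi> x) + ennreal (1 - min 1 (?t x)) * f x"
      by (rule nn_integral_unif_threshold) simp
    finally show ?thesis
      by (simp only: scale[OF exp_ge_zero] mt)
  qed
  have borel_L: "g \<in> borel_measurable \<L>" if "g \<in> borel_measurable phase" for g :: "_ \<Rightarrow> ennreal"
    using that by (subst measurable_cong_sets[OF sets_liouville refl])
  have "(\<integral>\<^sup>+x. ennreal (exp (- H x)) * ?h x \<partial>\<L>)
      = (\<integral>\<^sup>+x. ennreal (?m x) * f (\<Phi> x) \<partial>\<L>) + (\<integral>\<^sup>+x. ennreal (exp (- H x) - ?m x) * f x \<partial>\<L>)"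
    unfolding step by (rule nn_integral_add) (rule borel_L, measurable)+
  also have "(\<integral>\<^sup>+x. ennreal (?m x) * f (\<Phi> x) \<partial>\<L>) = (\<integral>\<^sup>+x. ennreal (?m x) * f x \<partial>\<L>)"
    using nn_integral_\<Phi>[of "\<lambda>x. ennreal (?m x) * f x"] by (simp add: \<Phi>_involution min.commute)
  also have "\<dots> + (\<integral>\<^sup>+x. ennreal (exp (- H x) - ?m x) * f x \<partial>\<L>)
      = (\<integral>\<^sup>+x. ennreal (?m x) * f x + ennreal (exp (- H x) - ?m x) * f x \<partial>\<L>)"
    by (rule nn_integral_add[symmetric]) (rule borel_L, measurable)+
  also have "\<dots> = (\<integral>\<^sup>+x. ennreal (exp (- H x)) * f x \<partial>\<L>)"
    by (intro nn_integral_cong) (simp add: distrib_right[symmetric] ennreal_plus[symmetric] del: ennreal_plus)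
  finally show ?thesis
    by (simp add: nn_integral_\<mu>[OF h] nn_integral_\<mu>[OF f])
qed

end

section \<open>The Markov chain\<close>

context constrained_ghmc
begin

definition momentum_step :: "real \<Rightarrow> (real^'d) \<times> (real^'d) \<Rightarrow> real^'d \<Rightarrow> (real^'d) \<times> (real^'d)"
  where "momentum_step s x g = (fst x, pu (fst x) (s *\<^sub>R snd x) g)"

definition step :: "(real^'d) \<times> (real^'d) \<Rightarrow> (real^'d) \<times> real \<times> (real^'d) \<Rightarrow> (real^'d) \<times> (real^'d)"
  where "step x = (\<lambda>(g, u, g'). momentum_step (-1) (mh_step (momentum_step 1 x g) u) g')"

abbreviation noise_space :: "((real^'d) \<times> real \<times> (real^'d)) measure"
  where "noise_space \<equiv> borel \<Otimes>\<^sub>M (borel \<Otimes>\<^sub>M borel)"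

abbreviation noise_law :: "((real^'d) \<times> real \<times> (real^'d)) measure"
  where "noise_law \<equiv> std_gaussian \<Otimes>\<^sub>M (unif \<Otimes>\<^sub>M std_gaussian)"

lemma ghmc_step_eq: "ghmc_step M \<xi> V D \<Lambda> dt \<gamma> g u g' x = step x (g, u, g')"
  by (cases x) (simp add: ghmc_step_def step_def momentum_step_def mh_step_def Let_def split_beta)

lemma measurable_step: "(\<lambda>(x, n). step x n) \<in> phase \<Otimes>\<^sub>M noise_space \<rightarrow>\<^sub>M phase"
proof -
  have mom: "(\<lambda>z. momentum_step s (f z) (g z)) \<in> N \<rightarrow>\<^sub>M phase"
    if "f \<in> N \<rightarrow>\<^sub>M phase" "g \<in> N \<rightarrow>\<^sub>M borel" for s f g and N :: "'z measure"
    using measurable_compose[OF measurable_Pair[OF that] measurable_momentum_step[of s]]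
    by (simp add: momentum_step_def)
  have mh: "(\<lambda>z. mh_step (f z) (u z)) \<in> N \<rightarrow>\<^sub>M phase"
    if "f \<in> N \<rightarrow>\<^sub>M phase" "u \<in> N \<rightarrow>\<^sub>M borel" for f u and N :: "'z measure"
    using measurable_compose[OF measurable_Pair[OF that] measurable_mh_step] by simp
  show ?thesis
    unfolding step_def split_beta by (intro mom mh) measurable
qed

lemma prob_space_noise_law: "prob_space noise_law"
  by (intro prob_space_pair prob_space_std_gaussian prob_space_unif)

lemma sets_noise_law [measurable_cong]: "sets noise_law = sets noise_space"
  by (intro sets_pair_measure_cong) auto

text \<open>The three parts of a step are integrated out one after the other.\<close>

proposition step_invariant:
  assumes f: "f \<in> borel_measurable phase"
  shows "(\<integral>\<^sup>+x. \<integral>\<^sup>+n. f (step x n) \<partial>noise_law \<partial>\<mu>) = (\<integral>\<^sup>+x. f x \<partial>\<mu>)"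
proof -
  interpret G: prob_space "std_gaussian :: (real^'d) measure" by (rule prob_space_std_gaussian)
  interpret U: prob_space unif by (rule prob_space_unif)
  interpret UG: prob_space "unif \<Otimes>\<^sub>M (std_gaussian :: (real^'d) measure)"
    by (intro prob_space_pair prob_space_std_gaussian prob_space_unif)
  define k2 where "k2 x = (\<integral>\<^sup>+g. f (momentum_step (-1) x g) \<partial>std_gaussian)" for x
  define k1 where "k1 x = (\<integral>\<^sup>+u. k2 (mh_step x u) \<partial>unif)" for x
  have mom: "(\<lambda>(x, g). k (momentum_step s x g)) \<in> borel_measurable (phase \<Otimes>\<^sub>M std_gaussian)"
    if "k \<in> borel_measurable phase" for k s
    using measurable_compose[OF measurable_momentum_step[of s] that]
    by (simp add: momentum_step_def split_beta cong: measurable_cong_sets sets_pair_measure_cong)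
  have mh: "(\<lambda>(x, u). k (mh_step x u)) \<in> borel_measurable (phase \<Otimes>\<^sub>M unif)"
    if "k \<in> borel_measurable phase" for k
    using measurable_compose[OF measurable_mh_step that]
    by (simp add: split_beta cong: measurable_cong_sets sets_pair_measure_cong)
  have k2: "k2 \<in> borel_measurable phase"
    unfolding k2_def using G.borel_measurable_nn_integral[OF mom[OF f]] by simp
  have k1: "k1 \<in> borel_measurable phase"
    unfolding k1_def using U.borel_measurable_nn_integral[OF mh[OF k2]] by simp
  have iter: "(\<integral>\<^sup>+n. f (step x n) \<partial>noise_law) = (\<integral>\<^sup>+g. k1 (momentum_step 1 x g) \<partial>std_gaussian)"
    if x: "x \<in> space phase" for x
  proof -
    have s: "(\<lambda>n. f (step x n)) \<in> borel_measurable noise_law"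
      using measurable_compose[OF measurable_Pair1'[OF x] measurable_compose[OF measurable_step f]]
      by (subst measurable_cong_sets[OF sets_noise_law refl]) simp
    have "(\<integral>\<^sup>+n. f (step x n) \<partial>noise_law) = (\<integral>\<^sup>+g. \<integral>\<^sup>+m. f (step x (g, m)) \<partial>(unif \<Otimes>\<^sub>M std_gaussian) \<partial>std_gaussian)"
      by (rule UG.nn_integral_fst[OF s, symmetric])
    also have "\<dots> = (\<integral>\<^sup>+g. k1 (momentum_step 1 x g) \<partial>std_gaussian)"
    proof (rule nn_integral_cong)
      fix g :: "real^'d" assume g: "g \<in> space std_gaussian"
      have "(\<lambda>m. f (step x (g, m))) \<in> borel_measurable (unif \<Otimes>\<^sub>M std_gaussian)"
        by (rule measurable_compose[OF measurable_Pair1'[OF g] s])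
      then have "(\<integral>\<^sup>+m. f (step x (g, m)) \<partial>(unif \<Otimes>\<^sub>M std_gaussian)) = (\<integral>\<^sup>+u. \<integral>\<^sup>+g'. f (step x (g, u, g')) \<partial>std_gaussian \<partial>unif)"
        by (rule G.nn_integral_fst[symmetric])
      then show "(\<integral>\<^sup>+m. f (step x (g, m)) \<partial>(unif \<Otimes>\<^sub>M std_gaussian)) = k1 (momentum_step 1 x g)"
        by (simp add: step_def k1_def k2_def)
    qed
    finally show ?thesis .
  qed
  have "(\<integral>\<^sup>+x. \<integral>\<^sup>+n. f (step x n) \<partial>noise_law \<partial>\<mu>) = (\<integral>\<^sup>+x. \<integral>\<^sup>+g. k1 (momentum_step 1 x g) \<partial>std_gaussian \<partial>\<mu>)"
    by (rule nn_integral_cong) (simp add: iter space_phase space_\<mu>)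
  also have "\<dots> = (\<integral>\<^sup>+x. k1 x \<partial>\<mu>)"
    unfolding momentum_step_def by (rule momentum_step_invariant[OF _ k1]) simp
  also have "\<dots> = (\<integral>\<^sup>+x. k2 x \<partial>\<mu>)"
    unfolding k1_def by (rule mh_step_invariant[OF k2])
  also have "\<dots> = (\<integral>\<^sup>+x. f x \<partial>\<mu>)"
    unfolding k2_def momentum_step_def by (rule momentum_step_invariant[OF _ f]) simp
  finally show ?thesis .
qed

lemma measurable_step_section: "x \<in> space phase \<Longrightarrow> step x \<in> noise_law \<rightarrow>\<^sub>M phase"
  using measurable_compose[OF measurable_Pair1' measurable_step, of x]
  by (subst measurable_cong_sets[OF sets_noise_law refl]) simp

lemma distr_step: "distr (\<mu> \<Otimes>\<^sub>M noise_law) phase (\<lambda>(x, n). step x n) = \<mu>"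
proof (rule measure_eqI)
  interpret N: prob_space noise_law by (rule prob_space_noise_law)
  have m: "(\<lambda>(x, n). step x n) \<in> \<mu> \<Otimes>\<^sub>M noise_law \<rightarrow>\<^sub>M phase"
    using measurable_step
    by (subst measurable_cong_sets[OF sets_pair_measure_cong[OF sets_\<mu> sets_noise_law] refl])
  fix A assume "A \<in> sets (distr (\<mu> \<Otimes>\<^sub>M noise_law) phase (\<lambda>(x, n). step x n))"
  then have A: "A \<in> sets phase" by simp
  have iA: "indicator A \<in> borel_measurable phase" using A by simp
  have "emeasure (distr (\<mu> \<Otimes>\<^sub>M noise_law) phase (\<lambda>(x, n). step x n)) A
    = (\<integral>\<^sup>+z. indicator A z \<partial>distr (\<mu> \<Otimes>\<^sub>M noise_law) phase (\<lambda>(x, n). step x n))"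
    using A by simp
  also have "\<dots> = (\<integral>\<^sup>+z. indicator A (case z of (x, n) \<Rightarrow> step x n) \<partial>(\<mu> \<Otimes>\<^sub>M noise_law))"
    using iA by (intro nn_integral_distr[OF m]) simp
  also have "\<dots> = (\<integral>\<^sup>+x. \<integral>\<^sup>+n. indicator A (step x n) \<partial>noise_law \<partial>\<mu>)"
    using N.nn_integral_fst[OF measurable_compose[OF m iA]] by simp
  also have "\<dots> = (\<integral>\<^sup>+x. indicator A x \<partial>\<mu>)"
    by (rule step_invariant[OF iA])
  also have "\<dots> = emeasure \<mu> A"
    using A by (simp add: sets_\<mu>)
  finally show "emeasure (distr (\<mu> \<Otimes>\<^sub>M noise_law) phase (\<lambda>(x, n). step x n)) A = emeasure \<mu> A" .
qed (simp add: sets_\<mu>)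

lemma invariant_step_kernel: "invariant_probability phase (\<lambda>x. distr noise_law phase (step x)) \<mu>"
proof -
  interpret N: prob_space noise_law by (rule prob_space_noise_law)
  let ?K = "\<lambda>x. distr noise_law phase (step x)"
  have N: "noise_law \<in> space (subprob_algebra noise_space)"
    by (simp add: space_subprob_algebra sets_noise_law N.subprob_space_axioms)
  have K: "?K \<in> phase \<rightarrow>\<^sub>M subprob_algebra phase"
    by (rule measurable_distr2[OF measurable_step]) (rule measurable_const[OF N])
  have K': "?K \<in> phase \<rightarrow>\<^sub>M prob_algebra phase"
    by (rule measurable_prob_algebraI[OF _ K]) (rule N.prob_space_distr[OF measurable_step_section])
  have "\<mu> \<bind> ?K = \<mu>"
  proof (rule measure_eqI)
    have K\<mu>: "?K \<in> \<mu> \<rightarrow>\<^sub>M subprob_algebra phase"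
      using K by (subst measurable_cong_sets[OF sets_\<mu> refl])
    have ne: "space \<mu> \<noteq> {}" by (rule prob_space.not_empty[OF prob_space_\<mu>])
    show sets: "sets (\<mu> \<bind> ?K) = sets \<mu>"
      using sets_bind[of \<mu> ?K phase] ne by (simp add: sets_\<mu>)
    fix A assume "A \<in> sets (\<mu> \<bind> ?K)"
    then have A: "A \<in> sets phase" using sets sets_\<mu> by simp
    have "emeasure (\<mu> \<bind> ?K) A = (\<integral>\<^sup>+x. emeasure (?K x) A \<partial>\<mu>)"
      by (rule emeasure_bind[OF ne K\<mu> A])
    also have "\<dots> = (\<integral>\<^sup>+x. \<integral>\<^sup>+n. indicator A (step x n) \<partial>noise_law \<partial>\<mu>)"
    proof (rule nn_integral_cong)
      fix x assume "x \<in> space \<mu>"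
      then have x: "x \<in> space phase" by (simp add: space_\<mu> space_phase)
      have "emeasure (?K x) A = (\<integral>\<^sup>+y. indicator A y \<partial>?K x)" using A by simp
      also have "\<dots> = (\<integral>\<^sup>+n. indicator A (step x n) \<partial>noise_law)"
        using A by (intro nn_integral_distr[OF measurable_step_section[OF x]]) simp
      finally show "emeasure (?K x) A = (\<integral>\<^sup>+n. indicator A (step x n) \<partial>noise_law)" .
    qed
    also have "\<dots> = (\<integral>\<^sup>+x. indicator A x \<partial>\<mu>)"
      using A by (intro step_invariant) simp
    also have "\<dots> = emeasure \<mu> A"
      using A by (simp add: sets_\<mu>)
    finally show "emeasure (\<mu> \<bind> ?K) A = emeasure \<mu> A" .
  qed
  then show ?thesis
    using K' prob_space_\<mu> by (simp add: invariant_probability_def space_prob_algebra sets_\<mu>)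
qed

end

subsection \<open>Independence of the noise from the past\<close>

lemma measurable_finer:
  "f \<in> M' \<rightarrow>\<^sub>M N \<Longrightarrow> space M' = space M \<Longrightarrow> sets M' \<subseteq> sets M \<Longrightarrow> f \<in> M \<rightarrow>\<^sub>M N"
  by (auto simp: measurable_def)

locale indep_sources = prob_space M for M :: "'a measure" +
  fixes E :: "'i \<Rightarrow> 'a set set"
  assumes indep: "indep_sets E UNIV" and stable: "\<And>s. Int_stable (E s)"
begin

text \<open>The sigma-algebra generated by a set of sources, as a measure space, so that to depend on these sources
  only is to be measurable.\<close>

definition info :: "'i set \<Rightarrow> 'a measure"
  where "info I = sigma (space M) (\<Union>s\<in>I. E s)"

lemma E_events: "E s \<subseteq> events"
  using indep by (simp add: indep_sets_def)

lemma space_info [simp]: "space (info I) = space M"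
  by (simp add: info_def space_measure_of_conv)

lemma sets_info: "sets (info I) = sigma_sets (space M) (\<Union>s\<in>I. E s)"
  unfolding info_def using E_events sets.space_closed by (subst sets_measure_of) blast+

lemma info_events: "sets (info I) \<subseteq> events"
  unfolding sets_info using E_events by (intro sets.sigma_sets_subset) blast

lemma info_measurable: "f \<in> info I \<rightarrow>\<^sub>M T \<Longrightarrow> f \<in> M \<rightarrow>\<^sub>M T"
  by (erule measurable_finer) (simp_all add: info_events)

lemma info_mono:
  assumes "I \<subseteq> J" "f \<in> info I \<rightarrow>\<^sub>M T"
  shows "f \<in> info J \<rightarrow>\<^sub>M T"
proof (rule measurable_finer[OF assms(2)])
  show "sets (info I) \<subseteq> sets (info J)"
    unfolding sets_info using assms(1) by (intro sigma_sets_mono') blast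
qed simp

lemma measurable_infoI:
  assumes "events_of M T f = E s" "s \<in> I" "f \<in> M \<rightarrow>\<^sub>M T"
  shows "f \<in> info I \<rightarrow>\<^sub>M T"
proof (rule measurableI)
  fix A assume "A \<in> sets T"
  then have "f -` A \<inter> space M \<in> E s"
    unfolding assms(1)[symmetric] by (auto simp: events_of_def)
  then show "f -` A \<inter> space (info I) \<in> sets (info I)"
    unfolding sets_info using assms(2) by (auto intro: sigma_sets.Basic)
qed (use assms(3) in \<open>auto dest: measurable_space\<close>)

text \<open>Functions of disjoint groups of independent sources are independent. The statement is about joint laws,
  since \<open>f\<close> and \<open>g\<close> take values in different types.\<close>

lemma indep_info_distr:
  assumes f: "f \<in> info I \<rightarrow>\<^sub>M S" and g: "g \<in> info J \<rightarrow>\<^sub>M T" and IJ: "I \<inter> J = {}"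
  shows "distr M (S \<Otimes>\<^sub>M T) (\<lambda>\<omega>. (f \<omega>, g \<omega>)) = distr M S f \<Otimes>\<^sub>M distr M T g"
proof -
  let ?I = "case_bool I J"
  note fM = info_measurable[OF f] and gM = info_measurable[OF g]
  have "indep_sets (\<lambda>j. sigma_sets (space M) (\<Union>i\<in>?I j. E i)) UNIV"
  proof (rule indep_sets_collect_sigma)
    show "indep_sets E (\<Union>j\<in>UNIV. ?I j)" by (rule indep_sets_mono_index[OF _ indep]) simp
    show "disjoint_family_on ?I UNIV"
      using IJ by (auto simp: disjoint_family_on_def split: bool.splits)
  qed (rule stable)
  then have ind: "indep_set (sets (info I)) (sets (info J))"
    unfolding indep_set_def sets_info by (rule indep_sets_mono_sets) (auto split: bool.splits)
  interpret F: prob_space "distr M S f" by (rule prob_space_distr[OF fM])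
  interpret G: prob_space "distr M T g" by (rule prob_space_distr[OF gM])
  have "distr M S f \<Otimes>\<^sub>M distr M T g = distr M (S \<Otimes>\<^sub>M T) (\<lambda>\<omega>. (f \<omega>, g \<omega>))"
  proof (rule pair_measure_eqI)
    fix A B assume "A \<in> sets (distr M S f)" "B \<in> sets (distr M T g)"
    then have A: "A \<in> sets S" and B: "B \<in> sets T" by simp_all
    let ?a = "f -` A \<inter> space M" and ?b = "g -` B \<inter> space M"
    have "prob (?a \<inter> ?b) = prob ?a * prob ?b"
      by (rule indep_setD[OF ind]) (use measurable_sets[OF f A] measurable_sets[OF g B] in simp_all)
    moreover have "(\<lambda>\<omega>. (f \<omega>, g \<omega>)) -` (A \<times> B) \<inter> space M = ?a \<inter> ?b" by auto
    ultimately show "emeasure (distr M S f) A * emeasure (distr M T g) B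
        = emeasure (distr M (S \<Otimes>\<^sub>M T) (\<lambda>\<omega>. (f \<omega>, g \<omega>))) (A \<times> B)"
      using A B fM gM by (simp add: emeasure_distr emeasure_eq_measure ennreal_mult)
  qed (simp_all add: F.sigma_finite_measure_axioms G.sigma_finite_measure_axioms)
  then show ?thesis ..
qed

end

lemma Int_stable_events_of: "Int_stable (events_of \<Omega> N X)"
proof (rule Int_stableI)
  fix a b assume "a \<in> events_of \<Omega> N X" "b \<in> events_of \<Omega> N X"
  then obtain A B where "a = X -` A \<inter> space \<Omega>" "b = X -` B \<inter> space \<Omega>" "A \<in> sets N" "B \<in> sets N"
    by (auto simp: events_of_def)
  then show "a \<inter> b \<in> events_of \<Omega> N X"
    by (auto simp: events_of_def intro!: exI[of _ "A \<inter> B"])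
qed

context constrained_ghmc
begin

context
  fixes \<Omega> :: "'w measure" and G G_half :: "nat \<Rightarrow> 'w \<Rightarrow> real^'d" and U :: "nat \<Rightarrow> 'w \<Rightarrow> real"
    and X :: "nat \<Rightarrow> 'w \<Rightarrow> (real^'d) \<times> (real^'d)"
  assumes inputs: "ghmc_inputs \<Omega> phase (X 0) G G_half U"
begin

definition source_events :: "noise_source \<Rightarrow> 'w set set"
  where "source_events s = (case s of Initial \<Rightarrow> events_of \<Omega> phase (X 0)
    | Gauss n \<Rightarrow> events_of \<Omega> borel (G n)
    | Gauss_half n \<Rightarrow> events_of \<Omega> borel (G_half n)
    | Uniform n \<Rightarrow> events_of \<Omega> borel (U n))"

interpretation src: indep_sources \<Omega> source_events
proof -
  interpret prob_space \<Omega>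
    using inputs by (simp add: ghmc_inputs_def)
  show "indep_sources \<Omega> source_events"
  proof
    show "indep_sets source_events UNIV"
      using inputs by (simp add: ghmc_inputs_def source_events_def[abs_def])
    show "Int_stable (source_events s)" for s
      by (cases s) (simp_all add: source_events_def Int_stable_events_of)
  qed
qed

lemma info_sources:
  shows "Initial \<in> I \<Longrightarrow> X 0 \<in> src.info I \<rightarrow>\<^sub>M phase"
    and "Gauss n \<in> I \<Longrightarrow> G n \<in> src.info I \<rightarrow>\<^sub>M borel"
    and "Gauss_half n \<in> I \<Longrightarrow> G_half n \<in> src.info I \<rightarrow>\<^sub>M borel"
    and "Uniform n \<in> I \<Longrightarrow> U n \<in> src.info I \<rightarrow>\<^sub>M borel"
  using inputs by (auto intro!: src.measurable_infoI simp: source_events_def ghmc_inputs_def)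

abbreviation "noise_vec n \<omega> \<equiv> (G n \<omega>, U n \<omega>, G_half n \<omega>)"
abbreviation "sources_at n \<equiv> {Gauss n, Uniform n, Gauss_half n}"
abbreviation "sources_before n \<equiv> insert Initial (\<Union>i<n. sources_at i)"

lemma info_noise_vec: "sources_at n \<subseteq> I \<Longrightarrow> noise_vec n \<in> src.info I \<rightarrow>\<^sub>M noise_space"
  by (intro measurable_Pair info_sources) auto

lemma distr_noise_vec: "distr \<Omega> noise_space (noise_vec n) = noise_law"
proof -
  have d: "distr \<Omega> borel (G n) = std_gaussian" "distr \<Omega> borel (G_half n) = std_gaussian" "distr \<Omega> borel (U n) = unif"
    using inputs by (simp_all add: ghmc_inputs_def)
  have "distr \<Omega> (borel \<Otimes>\<^sub>M borel) (\<lambda>\<omega>. (U n \<omega>, G_half n \<omega>)) = unif \<Otimes>\<^sub>M std_gaussian"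
    unfolding d(2)[symmetric] d(3)[symmetric]
    by (rule src.indep_info_distr[of _ "{Uniform n}" _ _ "{Gauss_half n}"]) (auto intro: info_sources)
  moreover have "distr \<Omega> noise_space (\<lambda>\<omega>. (G n \<omega>, (U n \<omega>, G_half n \<omega>)))
      = distr \<Omega> borel (G n) \<Otimes>\<^sub>M distr \<Omega> (borel \<Otimes>\<^sub>M borel) (\<lambda>\<omega>. (U n \<omega>, G_half n \<omega>))"
    by (rule src.indep_info_distr[of _ "{Gauss n}" _ _ "{Uniform n, Gauss_half n}"])
       (auto intro!: info_sources measurable_Pair)
  ultimately show ?thesis by (simp add: d)
qed

lemma kernel_eq:
  assumes x: "x \<in> space phase"
  shows "distr \<Omega> phase (\<lambda>\<omega>. step x (noise_vec n \<omega>)) = distr noise_law phase (step x)"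
proof -
  have "noise_vec n \<in> \<Omega> \<rightarrow>\<^sub>M noise_space"
    by (rule src.info_measurable[OF info_noise_vec[OF subset_refl]])
  moreover have "step x \<in> noise_space \<rightarrow>\<^sub>M phase"
    using measurable_step_section[OF x] by (subst (asm) measurable_cong_sets[OF sets_noise_law refl])
  ultimately show ?thesis
    unfolding distr_noise_vec[of n, symmetric] by (simp add: distr_distr o_def)
qed

lemma invariant_kernel:
  "invariant_probability phase (\<lambda>x. distr \<Omega> phase (\<lambda>\<omega>. step x (noise_vec n \<omega>))) \<mu>"
proof -
  let ?K = "\<lambda>x. distr \<Omega> phase (\<lambda>\<omega>. step x (noise_vec n \<omega>))" and ?K' = "\<lambda>x. distr noise_law phase (step x)"
  note inv = invariant_step_kernel[unfolded invariant_probability_def]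
  have "?K \<in> phase \<rightarrow>\<^sub>M prob_algebra phase \<longleftrightarrow> ?K' \<in> phase \<rightarrow>\<^sub>M prob_algebra phase"
    by (rule measurable_cong) (rule kernel_eq)
  moreover have "\<mu> \<bind> ?K = \<mu> \<bind> ?K'"
    by (rule bind_cong[OF refl]) (simp add: kernel_eq space_\<mu> space_phase)
  ultimately show ?thesis
    using inv by (simp add: invariant_probability_def)
qed

context
  assumes chain: "\<And>n \<omega>. \<omega> \<in> space \<Omega> \<Longrightarrow> X (Suc n) \<omega> = step (X n \<omega>) (noise_vec n \<omega>)"
begin

text \<open>The state before step \<open>n\<close> is a function of the earlier sources, hence independent of the noise of step \<open>n\<close>.\<close>

lemma info_chain: "X n \<in> src.info (sources_before n) \<rightarrow>\<^sub>M phase"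
proof (induction n)
  case 0
  show ?case by (rule info_sources) simp
next
  case (Suc n)
  have "X n \<in> src.info (sources_before (Suc n)) \<rightarrow>\<^sub>M phase"
    by (rule src.info_mono[OF _ Suc]) auto
  then have "(\<lambda>\<omega>. (X n \<omega>, noise_vec n \<omega>)) \<in> src.info (sources_before (Suc n)) \<rightarrow>\<^sub>M phase \<Otimes>\<^sub>M noise_space"
    by (rule measurable_Pair) (rule info_noise_vec, auto)
  from measurable_compose[OF this measurable_step]
  have "(\<lambda>\<omega>. step (X n \<omega>) (noise_vec n \<omega>)) \<in> src.info (sources_before (Suc n)) \<rightarrow>\<^sub>M phase" by simp
  then show ?case
    by (rule measurable_cong[THEN iffD2, rotated]) (simp add: chain)
qed

lemma chain_stationary:
  assumes init: "distr \<Omega> phase (X 0) = \<mu>"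
  shows "distr \<Omega> phase (X n) = \<mu>"
proof (induction n)
  case (Suc n)
  have disj: "sources_before n \<inter> sources_at n = {}" by auto
  have joint: "distr \<Omega> (phase \<Otimes>\<^sub>M noise_space) (\<lambda>\<omega>. (X n \<omega>, noise_vec n \<omega>)) = \<mu> \<Otimes>\<^sub>M noise_law"
    using src.indep_info_distr[OF info_chain info_noise_vec[OF subset_refl] disj]
    by (simp add: Suc distr_noise_vec)
  have pair: "(\<lambda>\<omega>. (X n \<omega>, noise_vec n \<omega>)) \<in> \<Omega> \<rightarrow>\<^sub>M phase \<Otimes>\<^sub>M noise_space"
    by (intro measurable_Pair src.info_measurable[OF info_chain] src.info_measurable[OF info_noise_vec[OF subset_refl]])
  have "distr \<Omega> phase (X (Suc n)) = distr \<Omega> phase (\<lambda>\<omega>. step (X n \<omega>) (noise_vec n \<omega>))"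
    by (rule distr_cong) (auto simp: chain)
  also have "\<dots> = distr (distr \<Omega> (phase \<Otimes>\<^sub>M noise_space) (\<lambda>\<omega>. (X n \<omega>, noise_vec n \<omega>))) phase (\<lambda>(x, n). step x n)"
    using distr_distr[OF measurable_step pair] by (simp add: o_def)
  also have "\<dots> = \<mu>"
    unfolding joint by (rule distr_step)
  finally show ?case .
qed (rule init)

end

end

end

subsection \<open>Invariance of the target measure\<close>

theorem mainTheorem3:
  fixes M :: "real^'d^'d"
    and \<xi> :: "real^'d \<Rightarrow> real^'m"
    and V :: "real^'d \<Rightarrow> real"
    and D :: "((real^'d) \<times> (real^'d)) set"
    and \<Lambda> :: "(real^'d) \<times> (real^'d) \<Rightarrow> real^'m"
    and dt :: real
    and \<gamma> :: "real^'d^'d"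
    and \<Omega> :: "'w measure"
    and G G_half :: "nat \<Rightarrow> 'w \<Rightarrow> real^'d"
    and U :: "nat \<Rightarrow> 'w \<Rightarrow> real"
    and X :: "nat \<Rightarrow> 'w \<Rightarrow> (real^'d) \<times> (real^'d)"
  assumes codim: "CARD('m) < CARD('d)"
    and dim: "CARD('k::finite) = CARD('d) - CARD('m)"
    and M: "spd M"
    and \<xi>: "smooth_on UNIV \<xi>"
    and gram: "\<exists>W. open W \<and> level_set \<xi> \<subseteq> W \<and> (\<forall>q\<in>W. invertible (gram M \<xi> q))"
    and V: "smooth_on UNIV V"
    and Z: "0 < Z_nu TYPE('k) M \<xi> V" "Z_nu TYPE('k) M \<xi> V < \<infinity>"
    and \<Lambda>: "admissible M \<xi> D \<Lambda>"
    and dt: "dt > 0"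
    and \<gamma>: "spd \<gamma>"
    and inputs: "ghmc_inputs \<Omega> (phase_space M \<xi>) (X 0) G G_half U"
    and chain: "\<And>n \<omega>. \<omega> \<in> space \<Omega> \<Longrightarrow>
      X (Suc n) \<omega> = ghmc_step M \<xi> V D \<Lambda> dt \<gamma> (G n \<omega>) (U n \<omega>) (G_half n \<omega>) (X n \<omega>)"
  shows "(\<forall>n. invariant_probability (phase_space M \<xi>)
            (\<lambda>x. distr \<Omega> (phase_space M \<xi>)
               (\<lambda>\<omega>. ghmc_step M \<xi> V D \<Lambda> dt \<gamma> (G n \<omega>) (U n \<omega>) (G_half n \<omega>) x))
            (target_measure TYPE('k) M \<xi> V)) \<and>
         (distr \<Omega> (phase_space M \<xi>) (X 0) = target_measure TYPE('k) M \<xi> V \<longrightarrow>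
            (\<forall>n. distr \<Omega> (phase_space M \<xi>) (X n) = target_measure TYPE('k) M \<xi> V))"
proof -
  interpret constrained_ghmc M \<xi> "TYPE('k)" V dt \<gamma> D \<Lambda>
    using assms by unfold_locales auto
  have "X (Suc n) \<omega> = step (X n \<omega>) (G n \<omega>, U n \<omega>, G_half n \<omega>)" if "\<omega> \<in> space \<Omega>" for n \<omega>
    using chain[OF that] by (simp add: ghmc_step_eq)
  from chain_stationary[where X = X, OF inputs this] invariant_kernel[where X = X, OF inputs]
  show ?thesis
    unfolding ghmc_step_eq by blast
qed

end
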